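(* Let $d=1$, $\Omega=[-L,L]$, $s=1$, $\mathscr{D}=\frac{d}{dx}$. Assume $f^\star\in H^1([-L,L])$, $\frac{d\mathbb{P}_X}{dx}\le\kappa$ for some $\kappa>0$, and that for some $\sigma,M>0$ the noise satisfies $\mathbb{E}(|\varepsilon|^\ell\mid X)\le\frac12\ell!\sigma^2M^{\ell-2}$ for all $\ell\in\mathbb{N}$. Let $\lambda_n=n^{-1}\log n$ and $\mu_n=n^{-2/3}/\|\mathscr{D}(f^\star)\|_{L^2(\Omega)}$ if $\|\mathscr{D}(f^\star)\|_{L^2(\Omega)}\ne0$, $\mu_n=1/\log n$ if $\|\mathscr{D}(f^\star)\|_{L^2(\Omega)}=0$. Then the estimator $\hat f_n$ satisfies \[\mathbb{E}\int_{[-L,L]}|\hat f_n-f^\star|^2\,d\mathbb{P}_X=\|\mathscr{D}(f^\star)\|_{L^2(\Omega)}\,\mathcal{O}\big(n^{-2/3}\log^3 n\big)+\big(\|f^\star\|^2_{H^1(\Omega)}+\sigma^2+M^2\big)\,\mathcal{O}\big(n^{-1}\log^3 n\big).\]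
   Context: $L>0$. Regression model $Y=f^\star(X)+\varepsilon$, $X\in[-L,L]$ with distribution $\mathbb{P}_X$ having a Lebesgue density; $(X_i,Y_i)_{i\le n}$ are i.i.d. copies of $(X,Y)$. $H^1_{\mathrm{per}}([-2L,2L])$ is the set of $f\in L^2([-2L,2L])$ whose $4L$-periodic extension to $[-4L,4L]$ lies in $H^1([-4L,4L])$, with $\|f\|^2_{H^1_{\mathrm{per}}}=\int_{-2L}^{2L}(f^2+f'^2)$. The estimator is $\hat f_n=\mathrm{argmin}_{f\in H^1_{\mathrm{per}}([-2L,2L])}\frac1n\sum_{i=1}^n|f(X_i)-Y_i|^2+\lambda_n\|f\|^2_{H^1_{\mathrm{per}}([-2L,2L])}+\mu_n\|f'\|^2_{L^2([-L,L])}$.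
   Formalization: The noise is additionally assumed centered, E(ε|X)=0 almost surely; without this the claim fails (e.g. f*=0 and ε a small nonzero constant satisfies the moment bounds, yet the risk does not tend to 0). *)

theory Defs
  imports "HOL-Probability.Probability"
begin

definition test_fun :: "real \<Rightarrow> real \<Rightarrow> (real \<Rightarrow> real) \<Rightarrow> bool" where
  "test_fun a b \<phi> \<longleftrightarrow>
     (\<forall>k x. ((deriv ^^ k) \<phi>) differentiable (at x)) \<and>
     (\<exists>c d. a < c \<and> c \<le> d \<and> d < b \<and> (\<forall>x. x \<notin> {c..d} \<longrightarrow> \<phi> x = 0))"

definition L2_on :: "real \<Rightarrow> real \<Rightarrow> (real \<Rightarrow> real) \<Rightarrow> bool" where
  "L2_on a b f \<longleftrightarrow> set_borel_measurable lborel {a..b} f \<and>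
     set_integrable lborel {a..b} (\<lambda>x. (f x)\<^sup>2)"

definition weak_deriv :: "real \<Rightarrow> real \<Rightarrow> (real \<Rightarrow> real) \<Rightarrow> (real \<Rightarrow> real) \<Rightarrow> bool" where
  "weak_deriv a b f g \<longleftrightarrow>
     set_integrable lborel {a..b} f \<and> set_integrable lborel {a..b} g \<and>
     (\<forall>\<phi>. test_fun a b \<phi> \<longrightarrow>
        (LINT x:{a..b}|lborel. f x * deriv \<phi> x) = - (LINT x:{a..b}|lborel. g x * \<phi> x))"

definition H1 :: "real \<Rightarrow> real \<Rightarrow> (real \<Rightarrow> real) \<Rightarrow> (real \<Rightarrow> real) \<Rightarrow> bool" where
  "H1 a b f g \<longleftrightarrow> L2_on a b f \<and> L2_on a b g \<and> weak_deriv a b f g"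

definition per_ext :: "real \<Rightarrow> (real \<Rightarrow> real) \<Rightarrow> real \<Rightarrow> real" where
  "per_ext L f x = f (x - 4 * L * of_int \<lfloor>(x + 2 * L) / (4 * L)\<rfloor>)"

text \<open>f (continuous representative on [-2L,2L]) lies in H^1_per([-2L,2L]); g is the weak
  derivative of its periodic extension on (-4L,4L).\<close>
definition H1per :: "real \<Rightarrow> (real \<Rightarrow> real) \<Rightarrow> (real \<Rightarrow> real) \<Rightarrow> bool" where
  "H1per L f g \<longleftrightarrow> continuous_on {-2*L..2*L} f \<and> H1 (-4*L) (4*L) (per_ext L f) g"

definition pi_objective :: "real \<Rightarrow> real \<Rightarrow> real \<Rightarrow> nat \<Rightarrow> (nat \<Rightarrow> real) \<Rightarrow> (nat \<Rightarrow> real)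
    \<Rightarrow> (real \<Rightarrow> real) \<Rightarrow> (real \<Rightarrow> real) \<Rightarrow> real" where
  "pi_objective L lam mu n xs ys f g =
     (\<Sum>i<n. (f (xs i) - ys i)\<^sup>2) / real n
     + lam * (LINT x:{-2*L..2*L}|lborel. (f x)\<^sup>2 + (g x)\<^sup>2)
     + mu * (LINT x:{-L..L}|lborel. (g x)\<^sup>2)"

definition is_pi_estimator :: "real \<Rightarrow> real \<Rightarrow> real \<Rightarrow> nat \<Rightarrow> (nat \<Rightarrow> real) \<Rightarrow> (nat \<Rightarrow> real)
    \<Rightarrow> (real \<Rightarrow> real) \<Rightarrow> bool" where
  "is_pi_estimator L lam mu n xs ys f \<longleftrightarrow>
     (\<exists>g. H1per L f g \<and>
        (\<forall>f' g'. H1per L f' g' \<longrightarrow> pi_objective L lam mu n xs ys f g \<le> pi_objective L lam mu n xs ys f' g'))"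

end

theory Submission
  imports Defs "HOL-Real_Asymp.Real_Asymp"
begin

text \<open>
  Write \<open>H\<close> for the difference between the estimator and the reflected periodic extension of
  \<open>f\<^sup>\<star>\<close>, \<open>A\<close> for the empirical mean of \<open>H\<^sup>2\<close> and \<open>G\<close> for the integral of \<open>H'\<^sup>2\<close> over \<open>[-L, L]\<close>.
  Minimality gives \<open>A + \<mu> G / 2 \<le> (2 / n) \<Sum> \<epsilon>\<^sub>i H(X\<^sub>i) + b\<close> with \<open>b = O(\<lambda> + \<mu> D\<^sup>2)\<close>.
  In one dimension the oscillation of \<open>H\<close> on an interval is controlled by \<open>G\<close>, and two partitions
  of \<open>[-L, L]\<close> suffice:

  \<^item> About \<open>1 / \<mu>\<close> cells of equal probability. Each contains its share of the sample up to an
    exponentially small probability, and then the integral of \<open>H\<^sup>2\<close> against the law of \<open>X\<close> is at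
    most \<open>8 A + \<mu> G\<close>.
  \<^item> About \<open>\<mu>\<^bsup>-1/2\<^esup>\<close> cells of equal length. Expanding \<open>H\<close> around the left end points turns the noise
    term into finitely many centred sums plus an integral against \<open>H'\<close>; Cauchy-Schwarz absorbs \<open>H\<close>
    on the left and leaves a term of expectation \<open>O(\<sigma>\<^sup>2 \<mu>\<^bsup>-1/2\<^esup> / n)\<close>.

  The expected risk is thus \<open>O(\<lambda> + \<mu> D\<^sup>2 + \<mu>\<^bsup>-1/2\<^esup> / n)\<close> with constants depending on the
  distribution. The claimed rates exceed this by a power of \<open>ln n\<close>, and the threshold \<open>N\<close> may depend
  on everything, so these constants can be absorbed and \<open>C = 1\<close> works.
\<close>

section \<open>Smooth functions of compact support\<close>

text \<open>One partition cannot serve both purposes. The density of the design is bounded above but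
  not below, so a cell of given length may attract no sample point; only cells of prescribed
  probability have a guaranteed share. Their length is then known only to be at most 2L, so about
  1/\<mu> of them are needed to make the oscillation term small, and paying one noise variance per
  cell would cost \<sigma>^2 / (n \<mu>), which for \<mu> of order n^(-2/3) is n^(-1/3). Short cells
  of equal length have a small oscillation by themselves; there the upper bound \<kappa> on the
  density is enough, and the number of cells drops to its square root. The estimator is used through
  its basic inequality, sample by sample, and the noise is bounded simultaneously for all H, so
  neither measurability nor uniqueness of the minimiser has to be established. The hypotheses speak
  of weak derivatives tested against smooth functions, while the argument needs increments between
  points; the bump functions and the du Bois-Reymond argument bridge this gap.\<close>

definition smooth :: "(real \<Rightarrow> real) \<Rightarrow> bool" where
  "smooth \<phi> \<longleftrightarrow> (\<forall>k x. ((deriv ^^ k) \<phi>) differentiable (at x))"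

text \<open>The k-th derivative of \<open>f\<close> stays in \<open>R\<close> by induction on k, so
  no formula for it is ever needed: exhibiting a class of functions closed under differentiation is
  enough.\<close>

lemma smooth_coinduct:
  assumes "R f"
    and step: "\<And>f. R f \<Longrightarrow> \<exists>f'. (\<forall>x. (f has_real_derivative f' x) (at x)) \<and> R f'"
  shows "smooth f"
proof -
  have *: "(\<forall>x. (f has_real_derivative deriv f x) (at x)) \<and> R (deriv f)" if R: "R f" for f
  proof -
    obtain f' where f': "\<And>x. (f has_real_derivative f' x) (at x)" "R f'"
      using step[OF R] by blast
    then have "deriv f = f'" by (auto intro: DERIV_imp_deriv)
    with f' show ?thesis by simp
  qed
  have "R ((deriv ^^ k) f)" for k
    by (induction k) (use assms(1) * in auto)
  with * show ?thesis
    unfolding smooth_def real_differentiable_def by blast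
qed

lemma smooth_has_deriv: "smooth f \<Longrightarrow> (f has_real_derivative deriv f x) (at x)"
  unfolding smooth_def
  by (metis DERIV_imp_deriv funpow_0 real_differentiable_def)

lemma smooth_deriv: "smooth f \<Longrightarrow> smooth (deriv f)"
  unfolding smooth_def by (metis comp_apply funpow_Suc_right)

lemma smooth_continuous: "smooth f \<Longrightarrow> continuous_on A f"
  by (meson DERIV_isCont continuous_at_imp_continuous_on smooth_has_deriv)

lemma smooth_antideriv:
  assumes "\<And>x. (f has_real_derivative f' x) (at x)" "smooth f'"
  shows "smooth f"
proof (rule smooth_coinduct[where R = "\<lambda>h. h = f \<or> smooth h"])
  show "f = f \<or> smooth f" by simp
next
  fix h assume "h = f \<or> smooth h"
  then show "\<exists>h'. (\<forall>x. (h has_real_derivative h' x) (at x)) \<and> (h' = f \<or> smooth h')"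
    using assms smooth_has_deriv smooth_deriv by metis
qed

text \<open>The derivative of a product is a sum of products, so products alone do not form a class
  closed under differentiation. This syntactic closure does, by rule induction, and it contains all
  combinations of bumps that occur later.\<close>

inductive smooth_alg :: "(real \<Rightarrow> real) \<Rightarrow> bool" where
  base: "smooth u \<Longrightarrow> smooth_alg u"
| const: "smooth_alg (\<lambda>_. c)"
| add: "smooth_alg u \<Longrightarrow> smooth_alg v \<Longrightarrow> smooth_alg (\<lambda>x. u x + v x)"
| mult: "smooth_alg u \<Longrightarrow> smooth_alg v \<Longrightarrow> smooth_alg (\<lambda>x. u x * v x)"
| aff: "smooth_alg u \<Longrightarrow> smooth_alg (\<lambda>x. u (a * x + b))"

lemma smooth_alg_deriv:
  "smooth_alg f \<Longrightarrow> \<exists>f'. (\<forall>x. (f has_real_derivative f' x) (at x)) \<and> smooth_alg f'"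
proof (induction rule: smooth_alg.induct)
  case (base u)
  then show ?case using smooth_has_deriv smooth_deriv smooth_alg.base by blast
next
  case (const c)
  have "\<forall>x. ((\<lambda>_. c) has_real_derivative (\<lambda>_. 0) x) (at x)" by simp
  then show ?case by (intro exI[of _ "\<lambda>_. 0"]) (auto intro: smooth_alg.const)
next
  case (add u v)
  then obtain u' v' where
    "\<And>x. (u has_real_derivative u' x) (at x)" "smooth_alg u'"
    "\<And>x. (v has_real_derivative v' x) (at x)" "smooth_alg v'" by blast
  then have "\<forall>x. ((\<lambda>x. u x + v x) has_real_derivative (\<lambda>x. u' x + v' x) x) (at x)"
      "smooth_alg (\<lambda>x. u' x + v' x)"
    by (auto intro!: derivative_eq_intros smooth_alg.add)
  then show ?case by (intro exI[of _ "\<lambda>x. u' x + v' x"]) simp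
next
  case (mult u v)
  then obtain u' v' where
    "\<And>x. (u has_real_derivative u' x) (at x)" "smooth_alg u'"
    "\<And>x. (v has_real_derivative v' x) (at x)" "smooth_alg v'" by blast
  then have "\<forall>x. ((\<lambda>x. u x * v x) has_real_derivative (\<lambda>x. u' x * v x + u x * v' x) x) (at x)"
      "smooth_alg (\<lambda>x. u' x * v x + u x * v' x)"
    using mult.hyps
    by (auto intro!: derivative_eq_intros smooth_alg.add smooth_alg.mult)
  then show ?case by (intro exI[of _ "\<lambda>x. u' x * v x + u x * v' x"]) simp
next
  case (aff u a b)
  then obtain u' where u': "\<And>x. (u has_real_derivative u' x) (at x)" "smooth_alg u'" by blast
  have "((\<lambda>x. u (a * x + b)) has_real_derivative a * u' (a * x + b)) (at x)" for x
  proof -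
    have "((\<lambda>x. a * x + b) has_real_derivative a) (at x)"
      by (auto intro!: derivative_eq_intros)
    from DERIV_chain2[OF u'(1) this] show ?thesis by (simp add: mult.commute)
  qed
  moreover have "smooth_alg (\<lambda>x. a * u' (a * x + b))"
    by (intro smooth_alg.mult[OF smooth_alg.const] smooth_alg.aff u'(2))
  ultimately show ?case by (intro exI[of _ "\<lambda>x. a * u' (a * x + b)"]) auto
qed

lemma smooth_alg_imp_smooth: "smooth_alg f \<Longrightarrow> smooth f"
  using smooth_coinduct[of smooth_alg] smooth_alg_deriv by blast

section \<open>The flat exponential and steepened cut-off functions\<close>

definition flat_exp :: "real \<Rightarrow> real" where
  "flat_exp x = (if x > 0 then exp (- (1 / x)) else 0)"

lemma poly_times_exp_minus_tendsto_0:
  "((\<lambda>y::real. poly p y * exp (- y)) \<longlongrightarrow> 0) at_top"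
proof -
  have "((\<lambda>y::real. \<Sum>i\<le>degree p. coeff p i * (y ^ i / exp y)) \<longlongrightarrow> (\<Sum>i\<le>degree p. coeff p i * 0)) at_top"
    by (intro tendsto_intros tendsto_power_div_exp_0)
  then show ?thesis
    by (simp add: poly_altdef sum_divide_distrib exp_minus divide_inverse sum_distrib_right mult.assoc)
qed

text \<open>With y = 1/x the derivative of p(y) exp(-y) is y^2 (p(y) - p'(y)) exp(-y), and
  \<open>[:0, 0, 1:]\<close> is the polynomial y^2. The family is thus closed under differentiation,
  as \<open>smooth_coinduct\<close> requires; at 0 it remains flat because the exponential beats
  every polynomial.\<close>

lemma flat_poly_exp_deriv:
  fixes p :: "real poly"
  defines "f \<equiv> \<lambda>p x. if x > 0 then poly p (1 / x) * exp (- (1 / x)) else 0"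
  shows "(f p has_real_derivative f ([:0, 0, 1:] * (p - pderiv p)) x) (at x)"
proof -
  consider "x > 0" | "x < 0" | "x = 0" by linarith
  then show ?thesis
  proof cases
    case 1
    have "((\<lambda>x. poly p (1 / x) * exp (- (1 / x))) has_real_derivative
        poly ([:0, 0, 1:] * (p - pderiv p)) (1 / x) * exp (- (1 / x))) (at x)"
      using 1 by (auto intro!: derivative_eq_intros poly_DERIV[THEN DERIV_chain2]
        simp: field_simps power2_eq_square)
    moreover have "\<forall>\<^sub>F y in nhds x. f p y = poly p (1 / y) * exp (- (1 / y))"
      using eventually_nhds_in_open[of "{0<..}" x] 1
      by (auto simp: f_def elim!: eventually_mono)
    ultimately show ?thesis
      using 1 by (subst DERIV_cong_ev[OF refl _ refl]) (auto simp: f_def)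
  next
    case 2
    have "\<forall>\<^sub>F y in nhds x. f p y = 0"
      using eventually_nhds_in_open[of "{..<0}" x] 2
      by (auto simp: f_def elim!: eventually_mono)
    then show ?thesis
      using 2 by (subst DERIV_cong_ev[OF refl _ refl]) (auto simp: f_def)
  next
    case 3
    have L: "((\<lambda>y. f p y / y) \<longlongrightarrow> 0) (at_left 0)"
      by (rule tendsto_eventually) (auto simp: f_def eventually_at_left_field intro: exI[of _ "-1"])
    \<comment> \<open>The difference quotient at 0 carries an extra factor 1/y, which multiplies
      \<open>p\<close> by the polynomial \<open>[:0, 1:]\<close>.\<close>
    have "((\<lambda>y. poly ([:0, 1:] * p) (inverse y) * exp (- inverse y)) \<longlongrightarrow> 0) (at_right (0::real))"
      by (rule filterlim_compose[OF poly_times_exp_minus_tendsto_0 filterlim_inverse_at_top_right])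
    moreover have "\<forall>\<^sub>F y in at_right (0::real).
        poly ([:0, 1:] * p) (inverse y) * exp (- inverse y) = f p y / y"
      unfolding eventually_at_right_field
      by (intro exI[of _ 1]) (auto simp: f_def field_simps)
    ultimately have R: "((\<lambda>y. f p y / y) \<longlongrightarrow> 0) (at_right 0)"
      by (rule Lim_transform_eventually)
    have "((\<lambda>y. f p y / y) \<longlongrightarrow> 0) (at 0)"
      using L R by (rule filterlim_split_at)
    moreover have "(\<lambda>h. (f p (0 + h) - f p 0) / h) = (\<lambda>y. f p y / y)"
      by (auto simp: f_def)
    ultimately have "(f p has_real_derivative 0) (at 0)"
      unfolding DERIV_def by simp
    then show ?thesis
      using 3 by (simp add: f_def)
  qed
qed

lemma smooth_flat_exp: "smooth flat_exp"
proof (rule smooth_coinduct[where R = "\<lambda>f. \<exists>p::real poly.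
    f = (\<lambda>x. if x > 0 then poly p (1 / x) * exp (- (1 / x)) else 0)"])
  show "\<exists>p. flat_exp = (\<lambda>x. if x > 0 then poly p (1 / x) * exp (- (1 / x)) else 0)"
    by (intro exI[of _ "1"]) (auto simp: flat_exp_def)
next
  fix f :: "real \<Rightarrow> real"
  assume "\<exists>p. f = (\<lambda>x. if x > 0 then poly p (1 / x) * exp (- (1 / x)) else 0)"
  then obtain p where p: "f = (\<lambda>x. if x > 0 then poly p (1 / x) * exp (- (1 / x)) else 0)" by blast
  show "\<exists>f'. (\<forall>x. (f has_real_derivative f' x) (at x)) \<and>
      (\<exists>p. f' = (\<lambda>x. if x > 0 then poly p (1 / x) * exp (- (1 / x)) else 0))"
    unfolding p using flat_poly_exp_deriv[of p]
    by (intro exI[of _ "\<lambda>x. if x > 0 then poly ([:0, 0, 1:] * (p - pderiv p)) (1 / x) * exp (- (1 / x)) else 0"]) blast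
qed

text \<open>Steepening the flat exponential replaces the usual normalisation of cut-off functions: the
  limit for large \<open>k\<close> is the indicator of the open interval.\<close>

definition bump :: "real \<Rightarrow> real \<Rightarrow> nat \<Rightarrow> real \<Rightarrow> real" where
  "bump s t k x = flat_exp (real (Suc k) * (x - s)) * flat_exp (real (Suc k) * (t - x))"

lemma smooth_bump: "smooth (bump s t k)"
proof -
  have "smooth_alg (\<lambda>x. flat_exp (real (Suc k) * x + (- real (Suc k) * s))
      * flat_exp ((- real (Suc k)) * x + real (Suc k) * t))"
    by (intro smooth_alg.mult smooth_alg.aff smooth_alg.base smooth_flat_exp)
  then show ?thesis
    unfolding bump_def by (intro smooth_alg_imp_smooth) (simp add: algebra_simps)
qed

lemma flat_exp_bounds: "0 \<le> flat_exp x" "flat_exp x \<le> 1"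
  by (auto simp: flat_exp_def)

lemma bump_bounds: "0 \<le> bump s t k x" "bump s t k x \<le> 1"
  unfolding bump_def using flat_exp_bounds by (auto intro: mult_le_one)

lemma bump_outside: "x \<notin> {s<..<t} \<Longrightarrow> bump s t k x = 0"
  unfolding bump_def flat_exp_def by (auto simp: zero_less_mult_iff)

lemma bump_nonzeroD: "bump s t k x \<noteq> 0 \<Longrightarrow> s < x \<and> x < t"
  using bump_outside[of x s t k] by auto

lemma flat_exp_scaled_tendsto:
  assumes "y > 0" shows "(\<lambda>k. flat_exp (real (Suc k) * y)) \<longlonglongrightarrow> 1"
proof -
  have "(\<lambda>k. exp (- ((1 / y) * inverse (real (Suc k))))) \<longlonglongrightarrow> exp (- ((1 / y) * 0))"
    by (intro tendsto_intros LIMSEQ_inverse_real_of_nat)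
  moreover have "flat_exp (real (Suc k) * y) = exp (- ((1 / y) * inverse (real (Suc k))))" for k
    using assms by (auto simp: flat_exp_def divide_simps)
  ultimately show ?thesis by simp
qed

lemma bump_tendsto: "(\<lambda>k. bump s t k x) \<longlonglongrightarrow> indicator {s<..<t} x"
proof (cases "x \<in> {s<..<t}")
  case True
  then show ?thesis
    unfolding bump_def
    using tendsto_mult[OF flat_exp_scaled_tendsto[of "x - s"] flat_exp_scaled_tendsto[of "t - x"]] by auto
qed (simp add: bump_outside)

section \<open>Weak derivatives and primitives\<close>

text \<open>Absolute continuity of \<open>f\<close> with derivative \<open>g\<close>, stated through
  increments: \<open>f\<close> is pinned down at every point, whereas \<open>g\<close> matters
  through its integrals. Once the weak derivatives are translated, all analysis runs on this
  notion.\<close>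

definition primitive_on :: "real \<Rightarrow> real \<Rightarrow> (real \<Rightarrow> real) \<Rightarrow> (real \<Rightarrow> real) \<Rightarrow> bool" where
  "primitive_on a b f g \<longleftrightarrow> set_integrable lborel {a..b} g \<and>
     (\<forall>x y. a \<le> x \<longrightarrow> x \<le> y \<longrightarrow> y \<le> b \<longrightarrow> f y - f x = (LINT t:{x..y}|lborel. g t))"

lemma set_integrable_Icc_subset:
  fixes g :: "real \<Rightarrow> real"
  assumes "set_integrable lborel {a..b} g" "a \<le> x" "y \<le> b"
  shows "set_integrable lborel {x..y} g"
  by (rule set_integrable_subset[OF assms(1)]) (use assms in auto)

lemma set_integral_Icc_combine:
  fixes g :: "real \<Rightarrow> real"
  assumes g: "set_integrable lborel {x..z} g" and xy: "x \<le> y" "y \<le> z"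
  shows "(LINT t:{x..z}|lborel. g t) = (LINT t:{x..y}|lborel. g t) + (LINT t:{y..z}|lborel. g t)"
proof -
  have i: "set_integrable lborel {x..y} g" "set_integrable lborel {y..z} g"
    by (rule set_integrable_Icc_subset[OF g]; use xy in simp)+
  show ?thesis
    unfolding set_borel_integral_eq_integral(2)[OF g] set_borel_integral_eq_integral(2)[OF i(1)]
      set_borel_integral_eq_integral(2)[OF i(2)]
    using Henstock_Kurzweil_Integration.integral_combine[OF xy set_borel_integral_eq_integral(1)[OF g]] by simp
qed

lemma primitive_onI_left:
  assumes "set_integrable lborel {a..b} g"
    and "\<And>x. a \<le> x \<Longrightarrow> x \<le> b \<Longrightarrow> f x = f a + (LINT t:{a..x}|lborel. g t)"
  shows "primitive_on a b f g"
  unfolding primitive_on_def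
proof (intro conjI allI impI assms(1))
  fix x y assume "a \<le> x" "x \<le> y" "y \<le> b"
  then show "f y - f x = (LINT t:{x..y}|lborel. g t)"
    using set_integral_Icc_combine[OF set_integrable_Icc_subset[OF assms(1)], of a y x] assms(2)[of x] assms(2)[of y]
    by simp
qed

lemma set_integral_singleton [simp]: "(LINT t:{a}|lborel. (g t :: real)) = 0" for a :: real
proof -
  have "(LINT t:{a}|lborel. g t) = (LINT t|lborel. indicator {a} t *\<^sub>R g a)"
    unfolding set_lebesgue_integral_def by (intro Bochner_Integration.integral_cong) (auto simp: indicator_def)
  then show ?thesis by simp
qed

lemma primitive_on_indefinite:
  assumes "set_integrable lborel {a..b} g"
  shows "primitive_on a b (\<lambda>x. LINT t:{a..x}|lborel. g t) g"
  by (rule primitive_onI_left[OF assms]) simp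

lemma primitive_on_subset:
  assumes "primitive_on a b f g" "a \<le> c" "d \<le> b"
  shows "primitive_on c d f g"
  using assms set_integrable_Icc_subset[of a b g c d] unfolding primitive_on_def by simp

lemma primitive_on_continuous:
  assumes "primitive_on a b f g"
  shows "continuous_on {a..b} f"
proof -
  have g: "set_integrable lborel {a..b} g" using assms by (simp add: primitive_on_def)
  have "f x = f a + integral {a..x} g" if "x \<in> {a..b}" for x
  proof -
    have "f x - f a = (LINT t:{a..x}|lborel. g t)"
      using assms that unfolding primitive_on_def by simp
    moreover have "set_integrable lborel {a..x} g"
      using that by (intro set_integrable_Icc_subset[OF g]) auto
    ultimately show ?thesis by (simp add: set_borel_integral_eq_integral(2))
  qed
  moreover have "continuous_on {a..b} (\<lambda>x. f a + integral {a..x} g)"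
    by (intro continuous_intros indefinite_integral_continuous_1 set_borel_integral_eq_integral(1) g)
  ultimately show ?thesis using continuous_on_cong[OF refl, of "{a..b}" f "\<lambda>x. f a + integral {a..x} g"] by blast
qed

lemma primitive_on_diff:
  assumes "primitive_on a b f g" "primitive_on a b f' g'"
  shows "primitive_on a b (\<lambda>x. f x - f' x) (\<lambda>x. g x - g' x)"
  unfolding primitive_on_def
proof (intro conjI allI impI)
  show "set_integrable lborel {a..b} (\<lambda>x. g x - g' x)"
    using assms by (auto simp: primitive_on_def)
  fix x y assume xy: "a \<le> x" "x \<le> y" "y \<le> b"
  then have "set_integrable lborel {x..y} g" "set_integrable lborel {x..y} g'"
    using assms by (auto simp: primitive_on_def intro: set_integrable_Icc_subset)
  then show "f y - f' y - (f x - f' x) = (LINT t:{x..y}|lborel. g t - g' t)"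
    using assms[unfolded primitive_on_def, THEN conjunct2, rule_format, OF xy] by simp
qed

lemma primitive_on_glue:
  assumes "primitive_on a b f g" "primitive_on b c f g" "a \<le> b" "b \<le> c"
  shows "primitive_on a c f g"
proof -
  have U: "{a..c} = {a..b} \<union> {b..c}" using assms by auto
  have int: "set_integrable lborel {a..c} g"
    unfolding U using assms by (intro set_integrable_Un) (auto simp: primitive_on_def)
  show ?thesis
  proof (rule primitive_onI_left[OF int])
    fix x assume x: "a \<le> x" "x \<le> c"
    show "f x = f a + (LINT t:{a..x}|lborel. g t)"
    proof (cases "x \<le> b")
      case True
      have "f x - f a = (LINT t:{a..x}|lborel. g t)"
        using assms(1) x True unfolding primitive_on_def by blast
      then show ?thesis by simp
    next
      case False
      have "f b - f a = (LINT t:{a..b}|lborel. g t)" "f x - f b = (LINT t:{b..x}|lborel. g t)"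
        using assms x False unfolding primitive_on_def by simp_all
      moreover have "(LINT t:{a..x}|lborel. g t) = (LINT t:{a..b}|lborel. g t) + (LINT t:{b..x}|lborel. g t)"
        using x False assms
        by (intro set_integral_Icc_combine set_integrable_Icc_subset[OF int]) auto
      ultimately show ?thesis by simp
    qed
  qed
qed

lemma set_integral_affine:
  fixes g :: "real \<Rightarrow> real"
  assumes "c \<noteq> 0"
  shows "(LINT t:{x. d + c * x \<in> A}|lborel. g (d + c * t)) = (LINT t:A|lborel. g t) / \<bar>c\<bar>"
  using lborel_integral_real_affine[OF assms, of "\<lambda>t. indicator A t *\<^sub>R g t" d] assms
  unfolding set_lebesgue_integral_def by (simp add: indicator_def)

lemma set_integrable_affine:
  fixes g :: "real \<Rightarrow> real"
  assumes "c \<noteq> 0" "set_integrable lborel A g"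
  shows "set_integrable lborel {x. d + c * x \<in> A} (\<lambda>t. g (d + c * t))"
  using lborel_integrable_real_affine[OF assms(2)[unfolded set_integrable_def] assms(1), of d]
  unfolding set_integrable_def by (simp add: indicator_def)

lemma primitive_on_shift:
  assumes "primitive_on a b f g"
  shows "primitive_on (a - d) (b - d) (\<lambda>x. f (d + x)) (\<lambda>x. g (d + x))"
  unfolding primitive_on_def
proof (intro conjI allI impI)
  have "{x. d + 1 * x \<in> {a..b}} = {a - d..b - d}" by auto
  then show "set_integrable lborel {a - d..b - d} (\<lambda>x. g (d + x))"
    using set_integrable_affine[of 1 "{a..b}" g d] assms by (simp add: primitive_on_def)
  fix x y assume xy: "a - d \<le> x" "x \<le> y" "y \<le> b - d"
  have "{t. d + 1 * t \<in> {d + x..d + y}} = {x..y}" by auto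
  then show "f (d + y) - f (d + x) = (LINT t:{x..y}|lborel. g (d + t))"
    using set_integral_affine[of 1 d "{d + x..d + y}" g] assms xy by (simp add: primitive_on_def)
qed

lemma primitive_on_reflect:
  assumes "primitive_on a b f g"
  shows "primitive_on (d - b) (d - a) (\<lambda>x. f (d - x)) (\<lambda>x. - g (d - x))"
  unfolding primitive_on_def
proof (intro conjI allI impI)
  have "{x. d + (-1) * x \<in> {a..b}} = {d - b..d - a}" by auto
  then show "set_integrable lborel {d - b..d - a} (\<lambda>x. - g (d - x))"
    using set_integrable_affine[of "-1" "{a..b}" g d] assms
    by (simp add: primitive_on_def set_integrable_def)
  fix x y assume xy: "d - b \<le> x" "x \<le> y" "y \<le> d - a"
  have "{t. d + (-1) * t \<in> {d - y..d - x}} = {x..y}" by auto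
  moreover have "f (d - x) - f (d - y) = (LINT t:{d - y..d - x}|lborel. g t)"
    using assms xy by (simp add: primitive_on_def)
  ultimately show "f (d - y) - f (d - x) = (LINT t:{x..y}|lborel. - g (d - t))"
    using set_integral_affine[of "-1" d "{d - y..d - x}" g]
    by (simp add: set_lebesgue_integral_def)
qed

text \<open>Agreement of the derivatives is asked for on the open interval, because the slope of a
  reflected extension jumps at break points. Almost everywhere equality does not transport Borel
  measurability, so \<open>g'\<close> is exhibited as \<open>g\<close> modified at the two end
  points.\<close>

lemma primitive_on_cong:
  assumes "primitive_on a b f g" "\<And>x. a \<le> x \<Longrightarrow> x \<le> b \<Longrightarrow> f x = f' x"
    and g: "\<And>x. a < x \<Longrightarrow> x < b \<Longrightarrow> g x = g' x"
  shows "primitive_on a b f' g'"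
proof -
  have ae: "AE x in lborel. x \<in> {a..b} \<longrightarrow> g x = g' x"
    using AE_lborel_singleton[of a] AE_lborel_singleton[of b]
    by eventually_elim (use g in force)
  have ind: "(\<lambda>x. indicator {a..b} x *\<^sub>R g' x) =
      (\<lambda>x. if x = a then indicator {a..b} x *\<^sub>R g' a else if x = b then indicator {a..b} x *\<^sub>R g' b
        else indicator {a..b} x *\<^sub>R g x)"
    using g by (fastforce simp: indicator_def)
  have int: "set_integrable lborel {a..b} g" using assms by (simp add: primitive_on_def)
  then have m: "(\<lambda>x. indicator {a..b} x *\<^sub>R g x) \<in> borel_measurable borel"
    by (auto simp: set_integrable_def dest: borel_measurable_integrable)
  have m': "(\<lambda>x. indicator {a..b} x *\<^sub>R g' x) \<in> borel_measurable borel"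
    unfolding ind using m by measurable
  have sub: "(LINT t:{x..y}|lborel. g t) = (LINT t:{x..y}|lborel. g' t)" if xy: "a \<le> x" "y \<le> b" for x y
  proof -
    have eq: "(\<lambda>t. indicator {x..y} t *\<^sub>R h t) = (\<lambda>t. indicator {x..y} t *\<^sub>R (indicator {a..b} t *\<^sub>R h t))" for h :: "real \<Rightarrow> real"
      using xy by (auto simp: indicator_def)
    show ?thesis
      unfolding set_lebesgue_integral_def
    proof (rule integral_cong_AE)
      show "(\<lambda>t. indicator {x..y} t *\<^sub>R g t) \<in> borel_measurable lborel"
        unfolding eq[of g] using m by measurable
      show "(\<lambda>t. indicator {x..y} t *\<^sub>R g' t) \<in> borel_measurable lborel"
        unfolding eq[of g'] using m' by measurable
      show "AE t in lborel. indicator {x..y} t *\<^sub>R g t = indicator {x..y} t *\<^sub>R g' t"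
        using ae by eventually_elim (use xy in \<open>auto simp: indicator_def\<close>)
    qed
  qed
  have "set_integrable lborel {a..b} g'"
    using int unfolding set_integrable_def
    by (rule integrable_cong_AE_imp) (use m' ae in \<open>auto simp: indicator_def\<close>)
  then show ?thesis
    using assms sub unfolding primitive_on_def by (metis order_trans)
qed

section \<open>Weak derivatives versus primitives\<close>

lemma test_fun_iff: "test_fun a b \<phi> \<longleftrightarrow> smooth \<phi> \<and>
    (\<exists>c d. a < c \<and> c \<le> d \<and> d < b \<and> (\<forall>x. x \<notin> {c..d} \<longrightarrow> \<phi> x = 0))"
  unfolding test_fun_def smooth_def ..

text \<open>Integration by parts for merely integrable \<open>g\<close>: writing f(x) - f(a) as an
  integral of \<open>g\<close> turns the left-hand side into a double integral over the triangle t
  \<le> x, and Fubini leaves the integral of \<phi>' over [t, b], which is -\<phi>(t).\<close>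

lemma primitive_on_imp_weak_deriv:
  assumes P: "primitive_on a b f g" and ab: "a \<le> b"
  shows "weak_deriv a b f g"
  unfolding weak_deriv_def
proof (intro conjI allI impI)
  show g: "set_integrable lborel {a..b} g" using P by (simp add: primitive_on_def)
  show "set_integrable lborel {a..b} f"
    using primitive_on_continuous[OF P] by (rule borel_integrable_atLeastAtMost')
  fix \<phi> assume "test_fun a b \<phi>"
  then have sm: "smooth \<phi>" and \<phi>0: "\<phi> a = 0" "\<phi> b = 0"
    by (auto simp: test_fun_iff)
  define \<psi> where "\<psi> = deriv \<phi>"
  have c\<psi>: "continuous_on A \<psi>" for A
    unfolding \<psi>_def by (intro smooth_continuous smooth_deriv sm)
  have [measurable]: "\<psi> \<in> borel_measurable borel"
    by (intro borel_measurable_continuous_onI c\<psi>)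
  define gi where "gi t = indicator {a..b} t *\<^sub>R g t" for t
  have gi: "integrable lborel gi" using g by (simp add: gi_def[abs_def] set_integrable_def)
  have [measurable]: "gi \<in> borel_measurable borel" using borel_measurable_integrable[OF gi] by simp
  have FTC: "(LINT x:{t..b}|lborel. \<psi> x) = - \<phi> t" if "t \<le> b" for t
  proof -
    have "(\<integral>x. indicator {t..b} x *\<^sub>R \<psi> x \<partial>lborel) = \<phi> b - \<phi> t"
    proof (rule integral_FTC_atLeastAtMost[OF that _ c\<psi>])
      fix x
      show "(\<phi> has_vector_derivative \<psi> x) (at x within {t..b})"
        using smooth_has_deriv[OF sm, of x]
        by (simp add: \<psi>_def has_real_derivative_iff_has_vector_derivative has_vector_derivative_at_within)
    qed
    then show ?thesis using \<phi>0 by (simp add: set_lebesgue_integral_def)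
  qed
  have i\<psi>: "integrable lborel (\<lambda>x. indicator {a..b} x * \<psi> x)"
    using borel_integrable_atLeastAtMost'[OF c\<psi>] by (simp add: set_integrable_def)
  define K where "K = (\<lambda>z. gi (fst z) * (indicator {a..b} (snd z) * \<psi> (snd z)) * (if fst z \<le> snd z then 1 else 0))"
  have KM: "K \<in> borel_measurable (lborel \<Otimes>\<^sub>M lborel)"
    unfolding K_def by measurable
  have prod: "integrable (lborel \<Otimes>\<^sub>M lborel) (\<lambda>(t, x). gi t * (indicator {a..b} x * \<psi> x))"
    by (intro lborel_pair.Fubini_integrable)
      (use gi i\<psi> in \<open>auto simp: norm_mult abs_mult intro!: integrable_abs integrable_mult_left\<close>)
  have KI: "integrable (lborel \<Otimes>\<^sub>M lborel) K"
    by (rule Bochner_Integration.integrable_bound[OF prod KM]) (auto simp: K_def indicator_def)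
  have "(LINT x:{a..b}|lborel. f x * \<psi> x)
      = (LINT x|lborel. f a * (indicator {a..b} x * \<psi> x) + (LINT t|lborel. K (t, x)))"
    unfolding set_lebesgue_integral_def
  proof (intro Bochner_Integration.integral_cong refl)
    fix x
    show "indicator {a..b} x *\<^sub>R (f x * \<psi> x) = f a * (indicator {a..b} x * \<psi> x) + (LINT t|lborel. K (t, x))"
    proof (cases "x \<in> {a..b}")
      case True
      then have "f x - f a = (LINT t:{a..x}|lborel. g t)" using P by (simp add: primitive_on_def)
      moreover have "(LINT t|lborel. K (t, x)) = (LINT t|lborel. (indicator {a..x} t *\<^sub>R g t) * \<psi> x)"
        using True by (intro Bochner_Integration.integral_cong) (auto simp: K_def gi_def indicator_def)
      ultimately show ?thesis using True by (simp add: set_lebesgue_integral_def algebra_simps)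
    qed (simp add: K_def)
  qed
  also have "\<dots> = f a * (LINT x:{a..b}|lborel. \<psi> x) + (LINT x|lborel. LINT t|lborel. K (t, x))"
    using i\<psi> lborel_pair.integrable_snd[of "\<lambda>t x. K (t, x)"] KI
    by (simp add: set_lebesgue_integral_def Bochner_Integration.integral_add)
  also have "(LINT x|lborel. LINT t|lborel. K (t, x)) = (LINT t|lborel. LINT x|lborel. K (t, x))"
    using lborel_pair.Fubini_integral[of "\<lambda>t x. K (t, x)"] KI by simp
  also have "(LINT t|lborel. LINT x|lborel. K (t, x)) = (LINT t|lborel. - (indicator {a..b} t *\<^sub>R (g t * \<phi> t)))"
  proof (intro Bochner_Integration.integral_cong refl)
    fix t
    show "(LINT x|lborel. K (t, x)) = - (indicator {a..b} t *\<^sub>R (g t * \<phi> t))"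
    proof (cases "t \<in> {a..b}")
      case True
      then have "(LINT x|lborel. K (t, x)) = (LINT x|lborel. g t * (indicator {t..b} x *\<^sub>R \<psi> x))"
        by (intro Bochner_Integration.integral_cong) (auto simp: K_def gi_def indicator_def)
      then show ?thesis using True FTC[of t] by (simp add: set_lebesgue_integral_def)
    qed (simp add: K_def gi_def)
  qed
  finally show "(LINT x:{a..b}|lborel. f x * deriv \<phi> x) = - (LINT x:{a..b}|lborel. g x * \<phi> x)"
    using FTC[OF ab] \<phi>0 by (simp add: set_lebesgue_integral_def \<psi>_def)
qed

text \<open>Since \<open>ennreal\<close> cuts off at 0, \<open>ennreal (v x)\<close> and
  \<open>ennreal (- v x)\<close> are the positive and the negative part of \<open>v\<close>. As
  densities they define measures that agree and are finite on all rays, hence coincide; uniqueness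
  of densities makes the two parts equal, and one of them is always 0.\<close>

lemma AE_zero_of_zero_tail_integrals:
  fixes v :: "real \<Rightarrow> real"
  assumes v: "integrable lborel v" and z: "\<And>x. (LINT t:{x<..}|lborel. v t) = 0"
  shows "AE x in lborel. v x = 0"
proof -
  have [measurable]: "v \<in> borel_measurable borel" using borel_measurable_integrable[OF v] by simp
  have eq: "emeasure (density lborel (\<lambda>x. ennreal (v x))) {x<..} = emeasure (density lborel (\<lambda>x. ennreal (- v x))) {x<..}"
    and fin: "emeasure (density lborel (\<lambda>x. ennreal (v x))) {x<..} < \<infinity>" for x
  proof -
    let ?w = "\<lambda>t. indicator {x<..} t * v t"
    have w: "integrable lborel ?w"
      using integrable_mult_indicator[OF _ v, of "{x<..}"] by simp
    have 1: "emeasure (density lborel (\<lambda>x. ennreal (v x))) {x<..} = (\<integral>\<^sup>+t. ennreal (?w t) \<partial>lborel)"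
      by (subst emeasure_density) (auto intro!: nn_integral_cong simp: indicator_def)
    have 2: "emeasure (density lborel (\<lambda>x. ennreal (- v x))) {x<..} = (\<integral>\<^sup>+t. ennreal (- ?w t) \<partial>lborel)"
      by (subst emeasure_density) (auto intro!: nn_integral_cong simp: indicator_def)
    have "(LINT t|lborel. ?w t) = 0" using z[of x] by (simp add: set_lebesgue_integral_def)
    then have e: "enn2real (\<integral>\<^sup>+t. ennreal (?w t) \<partial>lborel) = enn2real (\<integral>\<^sup>+t. ennreal (- ?w t) \<partial>lborel)"
      using real_lebesgue_integral_def[OF w] by simp
    have f: "(\<integral>\<^sup>+t. ennreal (?w t) \<partial>lborel) < \<infinity>" "(\<integral>\<^sup>+t. ennreal (- ?w t) \<partial>lborel) < \<infinity>"
      using w by (auto simp: real_integrable_def less_top)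
    show "emeasure (density lborel (\<lambda>x. ennreal (v x))) {x<..} < \<infinity>" using f 1 by simp
    show "emeasure (density lborel (\<lambda>x. ennreal (v x))) {x<..} = emeasure (density lborel (\<lambda>x. ennreal (- v x))) {x<..}"
      unfolding 1 2 using e f by (metis ennreal_enn2real infinity_ennreal_def)
  qed
  have "density lborel (\<lambda>x. ennreal (v x)) = density lborel (\<lambda>x. ennreal (- v x))"
    by (rule measure_eqI_lessThan) (use eq fin in auto)
  then have "AE x in lborel. ennreal (v x) = ennreal (- v x)"
    by (subst (asm) finite_density_unique) (use v in \<open>auto simp: real_integrable_def\<close>)
  then show ?thesis
  proof eventually_elim
    case (elim x)
    then show ?case
      by (cases "v x \<ge> 0") (auto simp: ennreal_neg ennreal_eq_0_iff dest: sym)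
  qed
qed

text \<open>The primitive vanishes left of the support by its starting point and right of it because
  the total integral is 0. This is the criterion by which a smooth function is recognised as the
  derivative of a test function.\<close>

lemma smooth_primitive_of_compact_support:
  fixes \<psi> :: "real \<Rightarrow> real"
  assumes sm: "smooth \<psi>" and supp: "\<And>x. x \<notin> {c..d} \<Longrightarrow> \<psi> x = 0"
    and zero: "integral {c..d} \<psi> = 0" and cd: "c \<le> d"
  obtains \<phi> where "smooth \<phi>" "deriv \<phi> = \<psi>" "\<And>x. x \<notin> {c..d} \<Longrightarrow> \<phi> x = 0"
proof -
  \<comment> \<open>Starting one unit left of \<open>c\<close> makes every x \<ge> c an interior
    point of the interval of integration, so that the derivative obtained is two-sided.\<close>
  define \<phi> where "\<phi> x = integral {c - 1..x} \<psi>" for x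
  have cont: "continuous_on A \<psi>" for A by (rule smooth_continuous[OF sm])
  have int: "\<psi> integrable_on {x..y}" for x y
    by (rule integrable_continuous_real[OF cont])
  have left: "\<phi> x = 0" if "x \<le> c" for x
  proof -
    have "\<phi> x = integral {c - 1..x} (\<lambda>_. 0)"
      unfolding \<phi>_def
      by (rule integral_spike[of "{c}"]) (use that supp in auto)
    then show ?thesis by simp
  qed
  have right: "\<phi> x = 0" if x: "x > d" for x
  proof -
    have "\<phi> x = integral {c - 1..c} \<psi> + integral {c..x} \<psi>"
      unfolding \<phi>_def using cd x int by (intro Henstock_Kurzweil_Integration.integral_combine[symmetric]) auto
    also have "integral {c - 1..c} \<psi> = 0" using left[of c] by (simp add: \<phi>_def)
    also have "integral {c..x} \<psi> = integral {c..d} \<psi> + integral {d..x} \<psi>"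
      using cd x int by (intro Henstock_Kurzweil_Integration.integral_combine[symmetric]) auto
    also have "integral {d..x} \<psi> = integral {d..x} (\<lambda>_. 0)"
      by (rule integral_spike[of "{d}"]) (use supp in auto)
    finally show ?thesis using zero by simp
  qed
  have der: "(\<phi> has_real_derivative \<psi> x) (at x)" for x
  proof (cases "x < c")
    case True
    have "\<forall>\<^sub>F y in nhds x. \<phi> y = 0"
      using eventually_nhds_in_open[of "{..<c}" x] True left by (auto elim!: eventually_mono)
    then show ?thesis
      using True supp[of x] by (subst DERIV_cong_ev[OF refl _ refl]) auto
  next
    case False
    have "(\<phi> has_real_derivative \<psi> x) (at x within {c - 1..x + 1})"
      unfolding \<phi>_def by (rule integral_has_real_derivative[OF cont]) (use False in auto)
    moreover have "at x within {c - 1..x + 1} = at x"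
      using False by (intro at_within_Icc_at) auto
    ultimately show ?thesis by simp
  qed
  show thesis
  proof
    show "deriv \<phi> = \<psi>" using der by (auto intro: DERIV_imp_deriv)
    show "smooth \<phi>" by (rule smooth_antideriv[OF der sm])
    show "\<phi> x = 0" if "x \<notin> {c..d}" for x
      using that left[of x] right[of x] by (cases "x < c") auto
  qed
qed

lemma integrable_bump: "integrable lborel (bump s t k)"
proof -
  have "set_integrable lborel {s..t} (bump s t k)"
    by (intro borel_integrable_atLeastAtMost' smooth_continuous smooth_bump)
  moreover have "(\<lambda>x. indicator {s..t} x *\<^sub>R bump s t k x) = bump s t k"
    by (rule ext) (auto simp: indicator_def dest: bump_nonzeroD)
  ultimately show ?thesis by (simp add: set_integrable_def)
qed

lemma borel_measurable_bump [measurable]: "bump s t k \<in> borel_measurable borel"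
  by (intro borel_measurable_continuous_onI smooth_continuous smooth_bump)

lemma bump_integral_tendsto:
  fixes u :: "real \<Rightarrow> real"
  assumes "integrable lborel u"
  shows "(\<lambda>k. LINT x|lborel. u x * bump s t k x) \<longlonglongrightarrow> (LINT x:{s<..<t}|lborel. u x)"
proof -
  have [measurable]: "u \<in> borel_measurable borel" using borel_measurable_integrable[OF assms] by simp
  have "(\<lambda>k. LINT x|lborel. u x * bump s t k x) \<longlonglongrightarrow> (LINT x|lborel. u x * indicator {s<..<t} x)"
  proof (rule integral_dominated_convergence[where w = "\<lambda>x. \<bar>u x\<bar>"])
    show "AE x in lborel. (\<lambda>k. u x * bump s t k x) \<longlonglongrightarrow> u x * indicator {s<..<t} x"
      by (intro AE_I2 tendsto_mult tendsto_const bump_tendsto)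
    show "AE x in lborel. norm (u x * bump s t k x) \<le> \<bar>u x\<bar>" for k
      using bump_bounds by (auto simp: abs_mult intro!: mult_left_le)
  qed (use assms in auto)
  then show ?thesis by (simp add: set_lebesgue_integral_def mult.commute)
qed

text \<open>The du Bois-Reymond lemma. The difference \<open>u\<close> of \<open>f\<close> and the
  primitive of \<open>g\<close> is orthogonal to all derivatives of test functions, in particular to
  mean-zero combinations of bumps, so its integral against a bump is a fixed constant times the
  integral of the bump. Sharpening the bumps to indicators shows that \<open>u\<close> has the same
  mean \<open>c\<close> on every interior interval.\<close>

lemma weak_deriv_imp_AE_primitive:
  assumes wd: "weak_deriv a b f g" and ab: "a < b"
  obtains c where "AE x in lborel. x \<in> {a..b} \<longrightarrow> f x = c + (LINT t:{a..x}|lborel. g t)"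
proof -
  have fi: "set_integrable lborel {a..b} f" and gi: "set_integrable lborel {a..b} g"
    using wd by (auto simp: weak_deriv_def)
  define G where "G x = (LINT t:{a..x}|lborel. g t)" for x
  have GP: "primitive_on a b G g" unfolding G_def by (rule primitive_on_indefinite[OF gi])
  have Gi: "set_integrable lborel {a..b} G"
    using primitive_on_continuous[OF GP] by (rule borel_integrable_atLeastAtMost')
  have wdG: "weak_deriv a b G g" by (rule primitive_on_imp_weak_deriv[OF GP]) (use ab in simp)
  define u where "u x = indicator {a..b} x * (f x - G x)" for x
  have ui: "integrable lborel u"
    using set_integral_diff(1)[OF fi Gi] by (simp add: u_def[abs_def] set_integrable_def)
  have [measurable]: "u \<in> borel_measurable borel" using borel_measurable_integrable[OF ui] by simp
  have u\<phi>: "(LINT x|lborel. u x * deriv \<phi> x) = 0" if t: "test_fun a b \<phi>" for \<phi>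
  proof -
    have "continuous_on {a..b} (deriv \<phi>)"
      using t by (intro smooth_continuous smooth_deriv) (simp add: test_fun_iff)
    then have bd: "set_integrable lborel {a..b} (\<lambda>x. h x * deriv \<phi> x)" if "set_integrable lborel {a..b} h" for h
    proof -
      have "bounded (deriv \<phi> ` {a..b})"
        by (intro compact_imp_bounded compact_continuous_image \<open>continuous_on {a..b} (deriv \<phi>)\<close>) auto
      then obtain B where B: "\<And>x. x \<in> {a..b} \<Longrightarrow> \<bar>deriv \<phi> x\<bar> \<le> B"
        unfolding bounded_iff by (metis imageI real_norm_def)
      have "deriv \<phi> \<in> borel_measurable borel"
        using t by (intro borel_measurable_continuous_onI smooth_continuous smooth_deriv) (simp add: test_fun_iff)
      then have m: "(\<lambda>x. indicator {a..b} x *\<^sub>R h x * deriv \<phi> x) \<in> borel_measurable lborel"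
        using that borel_measurable_integrable unfolding set_integrable_def
        by (intro borel_measurable_times) auto
      have "integrable lborel (\<lambda>x. indicator {a..b} x *\<^sub>R h x * deriv \<phi> x)"
      proof (rule Bochner_Integration.integrable_bound[OF _ m])
        show "integrable lborel (\<lambda>x. B * (indicator {a..b} x *\<^sub>R h x))"
          using that by (simp add: set_integrable_def)
        show "AE x in lborel. norm (indicator {a..b} x *\<^sub>R h x * deriv \<phi> x) \<le> norm (B * (indicator {a..b} x *\<^sub>R h x))"
        proof (rule AE_I2)
          fix x
          show "norm (indicator {a..b} x *\<^sub>R h x * deriv \<phi> x) \<le> norm (B * (indicator {a..b} x *\<^sub>R h x))"
            using B[of x] by (auto simp: indicator_def abs_mult mult.commute[of B] mult.commute[of "\<bar>B\<bar>"] intro!: mult_left_mono)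
        qed
      qed
      then show ?thesis by (simp add: set_integrable_def mult.assoc)
    qed
    have "(LINT x:{a..b}|lborel. f x * deriv \<phi> x) = (LINT x:{a..b}|lborel. G x * deriv \<phi> x)"
      using wd wdG t by (simp add: weak_deriv_def)
    then have "(LINT x:{a..b}|lborel. f x * deriv \<phi> x - G x * deriv \<phi> x) = 0"
      using bd[OF fi] bd[OF Gi] by simp
    then show ?thesis by (simp add: set_lebesgue_integral_def u_def algebra_simps)
  qed
  \<comment> \<open>An arbitrary reference interval strictly inside (a, b); the middle third
    serves.\<close>
  define s0 t0 where "s0 = (2 * a + b) / 3" and "t0 = (a + 2 * b) / 3"
  have st0: "a < s0" "s0 < t0" "t0 < b" using ab by (auto simp: s0_def t0_def field_simps)
  have lim1: "(\<lambda>k. LINT x|lborel. bump s t k x) \<longlonglongrightarrow> t - s" if "s \<le> t" for s t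
  proof -
    have "(\<lambda>k. LINT x|lborel. indicator {s..t} x * bump s t k x) \<longlonglongrightarrow> (LINT x:{s<..<t}|lborel. indicator {s..t} x)"
      by (rule bump_integral_tendsto) (auto intro!: integrable_real_indicator simp: emeasure_lborel_Icc_eq)
    moreover have "indicator {s..t} x * bump s t k x = bump s t k x" for x k
      by (auto simp: indicator_def dest: bump_nonzeroD)
    moreover have "(LINT x:{s<..<t}|lborel. indicat_real {s..t} x) = (LINT x|lborel. indicat_real {s<..<t} x)"
      unfolding set_lebesgue_integral_def by (intro Bochner_Integration.integral_cong) (auto simp: indicator_def)
    ultimately show ?thesis using that by simp
  qed
  obtain k0 where k0: "(LINT x|lborel. bump s0 t0 k0 x) > 0"
  proof -
    have "\<forall>\<^sub>F k in sequentially. (LINT x|lborel. bump s0 t0 k x) > 0"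
      using lim1[of s0 t0] st0 by (intro order_tendstoD) auto
    then show thesis using that eventually_happens[of _ sequentially] by auto
  qed
  define I0 where "I0 = (LINT x|lborel. bump s0 t0 k0 x)"
  define c where "c = (LINT x|lborel. u x * bump s0 t0 k0 x) / I0"
  have ub: "integrable lborel (\<lambda>x. u x * bump s t k x)" for s t k
  proof (rule Bochner_Integration.integrable_bound[OF ui])
    show "AE x in lborel. norm (u x * bump s t k x) \<le> norm (u x)"
      using bump_bounds[of s t k] by (intro AE_I2) (simp add: abs_mult mult_left_le)
  qed measurable
  have ubump: "(LINT x|lborel. u x * bump s t k x) = c * (LINT x|lborel. bump s t k x)"
    if st: "a < s" "s < t" "t < b" for s t k
  proof -
    define r where "r = (LINT x|lborel. bump s t k x) / I0"
    \<comment> \<open>\<open>r\<close> is chosen so that the integral of \<open>\<psi>\<close>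
      vanishes, which makes \<open>\<psi>\<close> the derivative of a test function.\<close>
    define \<psi> where "\<psi> x = bump s t k x + (- r) * bump s0 t0 k0 x" for x
    have "smooth_alg \<psi>"
      unfolding \<psi>_def
      by (intro smooth_alg.add smooth_alg.mult smooth_alg.const smooth_alg.base[OF smooth_bump])
    then have sm: "smooth \<psi>" by (rule smooth_alg_imp_smooth)
    define c' d' where "c' = min s s0" and "d' = max t t0"
    have supp: "\<psi> x = 0" if "x \<notin> {c'..d'}" for x
    proof -
      have "x \<notin> {s<..<t}" "x \<notin> {s0<..<t0}" using that by (auto simp: c'_def d'_def)
      then show ?thesis by (simp add: \<psi>_def bump_outside)
    qed
    have tot: "(LINT x|lborel. \<psi> x) = 0"
      using k0 integrable_bump[of s t k] integrable_bump[of s0 t0 k0] by (simp add: \<psi>_def r_def I0_def)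
    have \<psi>S: "set_integrable lborel {c'..d'} \<psi>"
      by (intro borel_integrable_atLeastAtMost' smooth_continuous sm)
    have "integral {c'..d'} \<psi> = (LINT x:{c'..d'}|lborel. \<psi> x)"
      by (rule set_borel_integral_eq_integral(2)[OF \<psi>S, symmetric])
    also have "\<dots> = (LINT x|lborel. \<psi> x)"
      unfolding set_lebesgue_integral_def using supp
      by (intro Bochner_Integration.integral_cong) (auto simp: indicator_def)
    finally have "integral {c'..d'} \<psi> = 0" using tot by simp
    moreover have "c' \<le> d'" using st by (auto simp: c'_def d'_def)
    ultimately obtain \<phi> where \<phi>: "smooth \<phi>" "deriv \<phi> = \<psi>" "\<And>x. x \<notin> {c'..d'} \<Longrightarrow> \<phi> x = 0"
      using smooth_primitive_of_compact_support[OF sm supp] by blast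
    have "test_fun a b \<phi>"
      unfolding test_fun_iff
      using \<phi> st st0 \<open>c' \<le> d'\<close>
      by (intro conjI exI[of _ c'] exI[of _ d']) (auto simp: c'_def d'_def)
    from u\<phi>[OF this] have "(LINT x|lborel. u x * bump s t k x + (- r) * (u x * bump s0 t0 k0 x)) = 0"
      by (simp add: \<phi>(2) \<psi>_def algebra_simps)
    then have "(LINT x|lborel. u x * bump s t k x) - r * (LINT x|lborel. u x * bump s0 t0 k0 x) = 0"
      using ub[of s t k] ub[of s0 t0 k0] by simp
    then show ?thesis by (simp add: c_def r_def)
  qed
  have uint: "(LINT x:{s<..<t}|lborel. u x) = c * (t - s)" if st: "a < s" "s < t" "t < b" for s t
  proof (rule LIMSEQ_unique)
    show "(\<lambda>k. LINT x|lborel. u x * bump s t k x) \<longlonglongrightarrow> (LINT x:{s<..<t}|lborel. u x)"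
      by (rule bump_integral_tendsto[OF ui])
    show "(\<lambda>k. LINT x|lborel. u x * bump s t k x) \<longlonglongrightarrow> c * (t - s)"
      unfolding ubump[OF st] using st by (intro tendsto_intros lim1) auto
  qed
  define v where "v x = indicator {a..b} x * (u x - c)" for x
  have vi: "integrable lborel v"
    using integrable_mult_indicator[OF _ ui, of "{a..b}"] integrable_real_indicator[of "{a..b}" lborel]
    by (auto simp: v_def[abs_def] right_diff_distrib emeasure_lborel_Icc_eq intro!: Bochner_Integration.integrable_diff)
  have vset: "set_integrable lborel A v" if "A \<in> sets borel" for A
    unfolding set_integrable_def using integrable_mult_indicator[OF _ vi] that by simp
  have VP: "primitive_on a b (\<lambda>x. LINT t:{a..x}|lborel. v t) v"
    by (rule primitive_on_indefinite) (simp add: vset)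
  define V where "V x = (LINT t:{a..x}|lborel. v t)" for x
  have V0: "V y - V x = 0" if xy: "a < x" "x < y" "y < b" for x y
  proof -
    have "V y - V x = (LINT t:{x..y}|lborel. v t)"
      using VP xy by (simp add: primitive_on_def V_def)
    also have "\<dots> = integral {x..y} v" by (rule set_borel_integral_eq_integral(2)) (simp add: vset)
    also have "\<dots> = integral {x<..<y} v" by (rule integral_open_interval_real)
    also have "\<dots> = (LINT t:{x<..<y}|lborel. v t)"
      by (rule set_borel_integral_eq_integral(2)[symmetric]) (simp add: vset)
    also have "\<dots> = (LINT t:{x<..<y}|lborel. u t - c)"
      unfolding set_lebesgue_integral_def v_def using xy
      by (intro Bochner_Integration.integral_cong) (auto simp: indicator_def)
    also have "\<dots> = (LINT t:{x<..<y}|lborel. u t) - (LINT t:{x<..<y}|lborel. c)"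
      using integrable_mult_indicator[OF _ ui, of "{x<..<y}"] integrable_real_indicator[of "{x<..<y}" lborel]
      by (intro set_integral_diff) (use xy in \<open>auto simp: set_integrable_def\<close>)
    also have "\<dots> = 0" using uint[OF xy] xy by (simp add: set_lebesgue_integral_def)
    finally show ?thesis .
  qed
  \<comment> \<open>\<open>V\<close> is constant on the open interval, with the midpoint as
    reference, and continuity extends this to the end points, where \<open>V a = 0\<close>.\<close>
  define p where "p = (a + b) / 2"
  have "V x = V p" if "x \<in> {a..b}" for x
  proof (rule continuous_constant_on_closure[of "{a<..<b}" V])
    have cl: "closure {a<..<b} = {a..b}" using ab by simp
    show "continuous_on (closure {a<..<b}) V"
      unfolding cl V_def by (rule primitive_on_continuous[OF VP])
    show "x \<in> closure {a<..<b}" using that cl by simp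
    show "V y = V p" if "y \<in> {a<..<b}" for y
    proof -
      consider "y < p" | "y = p" | "p < y" by linarith
      moreover have "a < p" "p < b" using ab by (simp_all add: p_def)
      ultimately show ?thesis
        using V0[of y p] V0[of p y] that by cases simp_all
    qed
  qed
  moreover have "V a = 0" by (simp add: V_def)
  ultimately have Vz: "V x = 0" if "x \<in> {a..b}" for x
    using that ab by (metis atLeastAtMost_iff order_refl less_imp_le)
  have "AE x in lborel. v x = 0"
  proof (rule AE_zero_of_zero_tail_integrals[OF vi])
    fix x
    show "(LINT t:{x<..}|lborel. v t) = 0"
    proof (cases "x < b")
      case True
      have "(LINT t:{x<..}|lborel. v t) = (LINT t:{max a x<..<b}|lborel. v t)"
        unfolding set_lebesgue_integral_def
      proof (rule integral_cong_AE)
        show "AE t in lborel. indicator {x<..} t *\<^sub>R v t = indicator {max a x<..<b} t *\<^sub>R v t"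
          using AE_lborel_singleton[of a] AE_lborel_singleton[of b]
          by eventually_elim (auto simp: v_def indicator_def)
      qed (use borel_measurable_integrable[OF vi] in auto)
      also have "\<dots> = integral {max a x<..<b} v" by (rule set_borel_integral_eq_integral(2)) (simp add: vset)
      also have "\<dots> = integral {max a x..b} v" by (rule integral_open_interval_real[symmetric])
      also have "\<dots> = (LINT t:{max a x..b}|lborel. v t)"
        by (rule set_borel_integral_eq_integral(2)[symmetric]) (simp add: vset)
      also have "\<dots> = V b - V (max a x)"
        using VP True ab by (simp add: primitive_on_def V_def)
      also have "\<dots> = 0" using Vz[of b] Vz[of "max a x"] True ab by simp
      finally show ?thesis .
    next
      case False
      have "(LINT t:{x<..}|lborel. v t) = (LINT t:{x<..}|lborel. 0)"
        unfolding set_lebesgue_integral_def using False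
        by (intro Bochner_Integration.integral_cong) (auto simp: v_def indicator_def)
      then show ?thesis by (simp add: set_lebesgue_integral_def)
    qed
  qed
  then have "AE x in lborel. x \<in> {a..b} \<longrightarrow> f x = c + G x"
    by eventually_elim (auto simp: v_def u_def)
  then show thesis using that by (simp add: G_def)
qed

text \<open>The set of disagreement is open, and a non-empty open set is not negligible.\<close>

lemma continuous_AE_eq_imp_eq:
  fixes f h :: "real \<Rightarrow> real"
  assumes c: "continuous_on {a<..<b} f" "continuous_on {a<..<b} h"
    and ae: "AE x in lborel. x \<in> {a<..<b} \<longrightarrow> f x = h x" and x: "x \<in> {a<..<b}"
  shows "f x = h x"
proof (rule ccontr)
  assume ne: "f x \<noteq> h x"
  define S where "S = {a<..<b} \<inter> (\<lambda>y. f y - h y) -` (- {0})"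
  have op: "open S"
    unfolding S_def by (intro continuous_open_preimage continuous_intros c)
  have "AE y in lborel. y \<notin> S"
    using ae by eventually_elim (auto simp: S_def)
  then have "S \<in> null_sets lborel"
    using op by (subst (asm) AE_iff_null_sets[symmetric]) auto
  then have "negligible S"
    using negligible_iff_null_sets null_sets_completionI by blast
  then show False
    using open_not_negligible[OF op] ne x unfolding S_def by fastforce
qed

section \<open>Periodic extension, continuous representatives and reflection\<close>

lemma per_ext_eq: 
  assumes "L > 0" "- 2 * L \<le> x" "x < 2 * L"
  shows "per_ext L f x = f x"
proof -
  have "\<lfloor>(x + 2 * L) / (4 * L)\<rfloor> = 0"
    using assms by (intro floor_unique) (auto simp: field_simps)
  then show ?thesis by (simp add: per_ext_def)
qed

text \<open>The weak derivative belongs to the extension on (-4L, 4L), which repeats the values of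
  \<open>f\<close> itself on [-2L, 2L). There the primitive agrees with \<open>f\<close> almost
  everywhere, and continuity of \<open>f\<close> upgrades this to every point of the open interval,
  so that \<open>f\<close> may be evaluated at sample points.\<close>

lemma H1per_primitive_on:
  assumes H: "H1per L f g" and L: "L > 0"
  shows "primitive_on (- L) L f g"
proof -
  have wd: "weak_deriv (- 4 * L) (4 * L) (per_ext L f) g" and cf: "continuous_on {- 2 * L..2 * L} f"
    using H by (auto simp: H1per_def H1_def)
  obtain c where c: "AE x in lborel. x \<in> {- 4 * L..4 * L} \<longrightarrow>
      per_ext L f x = c + (LINT t:{- 4 * L..x}|lborel. g t)"
    using weak_deriv_imp_AE_primitive[OF wd] L by auto
  define G where "G x = (LINT t:{- 4 * L..x}|lborel. g t)" for x
  have GP: "primitive_on (- 4 * L) (4 * L) G g"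
    unfolding G_def using wd by (intro primitive_on_indefinite) (simp add: weak_deriv_def)
  have eq: "f x = c + G x" if "x \<in> {- 2 * L<..<2 * L}" for x
  proof (rule continuous_AE_eq_imp_eq[OF _ _ _ that])
    show "continuous_on {- 2 * L<..<2 * L} f"
      by (rule continuous_on_subset[OF cf]) auto
    show "continuous_on {- 2 * L<..<2 * L} (\<lambda>x. c + G x)"
      using L by (intro continuous_intros continuous_on_subset[OF primitive_on_continuous[OF GP]]) auto
    show "AE x in lborel. x \<in> {- 2 * L<..<2 * L} \<longrightarrow> f x = c + G x"
      using c by eventually_elim (use L in \<open>auto simp: G_def per_ext_eq\<close>)
  qed
  have "primitive_on (- L) L G g"
    by (rule primitive_on_subset[OF GP]) (use L in auto)
  then show ?thesis
    using eq L unfolding primitive_on_def by simp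
qed

text \<open>The regression function is given up to null sets; since the design has a density,
  exchanging it for this representative almost surely changes neither the data nor the loss.\<close>

lemma H1_continuous_representative:
  assumes H: "H1 a b f g" and ab: "a < b"
  obtains F where "primitive_on a b F g" "AE x in lborel. x \<in> {a..b} \<longrightarrow> f x = F x"
proof -
  have wd: "weak_deriv a b f g" using H by (simp add: H1_def)
  then obtain c where c: "AE x in lborel. x \<in> {a..b} \<longrightarrow> f x = c + (LINT t:{a..x}|lborel. g t)"
    using weak_deriv_imp_AE_primitive[OF wd ab] by blast
  have "primitive_on a b (\<lambda>x. c + (LINT t:{a..x}|lborel. g t)) g"
    by (rule primitive_onI_left) (use wd in \<open>auto simp: weak_deriv_def\<close>)
  then show thesis using that c by blast
qed

text \<open>The triangle wave that folds \<open>[-4L, 4L]\<close> onto \<open>[-L, L]\<close>, and its slope: composing with it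
  extends a function by reflection to a \<open>4L\<close>-periodic one.\<close>

definition fold_pos :: "real \<Rightarrow> real \<Rightarrow> real" where
  "fold_pos L x = (if x < - 3 * L then 4 * L + x else if x < - L then - 2 * L - x
     else if x \<le> L then x else if x \<le> 3 * L then 2 * L - x else - 4 * L + x)"

definition fold_sign :: "real \<Rightarrow> real \<Rightarrow> real" where
  "fold_sign L x = (if x < - 3 * L then 1 else if x < - L then -1
     else if x \<le> L then 1 else if x \<le> 3 * L then -1 else 1)"

text \<open>The pieces follow the branches of \<open>fold_pos\<close> exactly, end points included,
  so that each restriction is an affine substitution.\<close>

lemma fold_pos_integrable:
  fixes h :: "real \<Rightarrow> real"
  assumes h: "set_integrable lborel {- L..L} h" and L: "L > 0"
  shows "set_integrable lborel {- 4 * L..4 * L} (\<lambda>x. h (fold_pos L x))"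
proof -
  have piece: "set_integrable lborel A (\<lambda>x. h (fold_pos L x))"
    if "A \<in> sets borel" "c \<noteq> 0" "\<And>x. x \<in> A \<Longrightarrow> fold_pos L x = d + c * x \<and> d + c * x \<in> {- L..L}" for A c d
  proof -
    have "set_integrable lborel A (\<lambda>t. h (d + c * t))"
      by (rule set_integrable_subset[OF set_integrable_affine[OF that(2) h, of d]]) (use that in auto)
    then show ?thesis
      by (subst set_integrable_cong[OF refl refl, of _ _ "\<lambda>t. h (d + c * t)"]) (use that in auto)
  qed
  have U: "{- 4 * L..4 * L} = {- 4 * L..<- 3 * L} \<union> ({- 3 * L..<- L} \<union> ({- L..L} \<union> ({L<..3 * L} \<union> {3 * L<..4 * L})))"
    using L by auto
  show ?thesis
    unfolding U
  proof (intro set_integrable_Un)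
    show "set_integrable lborel {- 4 * L..<- 3 * L} (\<lambda>x. h (fold_pos L x))"
      by (rule piece[of _ 1 "4 * L"]) (use L in \<open>auto simp: fold_pos_def\<close>)
    show "set_integrable lborel {- 3 * L..<- L} (\<lambda>x. h (fold_pos L x))"
      by (rule piece[of _ "-1" "- 2 * L"]) (use L in \<open>auto simp: fold_pos_def\<close>)
    show "set_integrable lborel {- L..L} (\<lambda>x. h (fold_pos L x))"
      by (rule piece[of _ 1 "0"]) (use L in \<open>auto simp: fold_pos_def\<close>)
    show "set_integrable lborel {L<..3 * L} (\<lambda>x. h (fold_pos L x))"
      by (rule piece[of _ "-1" "2 * L"]) (use L in \<open>auto simp: fold_pos_def\<close>)
    show "set_integrable lborel {3 * L<..4 * L} (\<lambda>x. h (fold_pos L x))"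
      by (rule piece[of _ 1 "- 4 * L"]) (use L in \<open>auto simp: fold_pos_def\<close>)
  qed auto
qed

text \<open>Each of the five pieces is a translate or a reflection of \<open>F\<close>. All of them
  agree with the same global function on closed intervals, which is how continuity at the break
  points enters the gluing.\<close>

lemma fold_primitive_on:
  assumes P: "primitive_on (- L) L F g" and L: "L > 0"
  shows "primitive_on (- 4 * L) (4 * L) (\<lambda>x. F (fold_pos L x)) (\<lambda>x. fold_sign L x * g (fold_pos L x))"
    (is "primitive_on _ _ ?e ?d")
proof -
  have 1: "primitive_on (- 4 * L) (- 3 * L) ?e ?d"
    by (rule primitive_on_cong[OF primitive_on_subset[OF primitive_on_shift[OF P, of "4 * L"]]])
      (use L in \<open>auto simp: fold_pos_def fold_sign_def\<close>)
  have 2: "primitive_on (- 3 * L) (- L) ?e ?d"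
    by (rule primitive_on_cong[OF primitive_on_subset[OF primitive_on_reflect[OF P, of "- 2 * L"]]])
      (use L in \<open>auto simp: fold_pos_def fold_sign_def\<close>)
  have 3: "primitive_on (- L) L ?e ?d"
    by (rule primitive_on_cong[OF P]) (use L in \<open>auto simp: fold_pos_def fold_sign_def\<close>)
  have 4: "primitive_on L (3 * L) ?e ?d"
    by (rule primitive_on_cong[OF primitive_on_subset[OF primitive_on_reflect[OF P, of "2 * L"]]])
      (use L in \<open>auto simp: fold_pos_def fold_sign_def\<close>)
  have 5: "primitive_on (3 * L) (4 * L) ?e ?d"
    by (rule primitive_on_cong[OF primitive_on_subset[OF primitive_on_shift[OF P, of "- 4 * L"]]])
      (use L in \<open>auto simp: fold_pos_def fold_sign_def\<close>)
  show ?thesis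
    using L by (intro primitive_on_glue[OF 1] primitive_on_glue[OF 2] primitive_on_glue[OF 3] primitive_on_glue[OF 4 5]) auto
qed

text \<open>The wave already repeats with period 4L, so extending periodically changes
  nothing.\<close>

lemma per_ext_fold_pos:
  assumes L: "L > 0" and x: "- 4 * L \<le> x" "x \<le> 4 * L"
  shows "per_ext L (\<lambda>x. F (fold_pos L x)) x = F (fold_pos L x)"
proof -
  consider "x < - 2 * L" | "- 2 * L \<le> x" "x < 2 * L" | "2 * L \<le> x" by linarith
  then show ?thesis
  proof cases
    case 1
    then have "\<lfloor>(x + 2 * L) / (4 * L)\<rfloor> = -1"
      using L x by (intro floor_unique) (auto simp: field_simps)
    then have "per_ext L (\<lambda>x. F (fold_pos L x)) x = F (fold_pos L (x + 4 * L))"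
      by (simp add: per_ext_def)
    also have "fold_pos L (x + 4 * L) = fold_pos L x"
      using L x 1 by (auto simp: fold_pos_def)
    finally show ?thesis .
  next
    case 2
    then show ?thesis using L by (simp add: per_ext_eq)
  next
    case 3
    then have "\<lfloor>(x + 2 * L) / (4 * L)\<rfloor> = 1"
      using L x by (intro floor_unique) (auto simp: field_simps)
    then have "per_ext L (\<lambda>x. F (fold_pos L x)) x = F (fold_pos L (x - 4 * L))"
      by (simp add: per_ext_def)
    also have "fold_pos L (x - 4 * L) = fold_pos L x"
      using L x 3 by (auto simp: fold_pos_def)
    finally show ?thesis .
  qed
qed

lemma L2_on_continuous:
  assumes "continuous_on {a..b} f"
  shows "L2_on a b f"
  unfolding L2_on_def
proof
  show "set_borel_measurable lborel {a..b} f"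
    using borel_integrable_atLeastAtMost'[OF assms]
    unfolding set_borel_measurable_def set_integrable_def by (rule borel_measurable_integrable)
  show "set_integrable lborel {a..b} (\<lambda>x. (f x)\<^sup>2)"
    by (intro borel_integrable_atLeastAtMost' continuous_intros assms)
qed

text \<open>Supplies the competitor against which the minimality of the estimator is tested.\<close>

lemma H1per_fold:
  assumes P: "primitive_on (- L) L F g" and g: "L2_on (- L) L g" and L: "L > 0"
  shows "H1per L (\<lambda>x. F (fold_pos L x)) (\<lambda>x. fold_sign L x * g (fold_pos L x))"
    (is "H1per L ?e ?d")
proof -
  have P4: "primitive_on (- 4 * L) (4 * L) ?e ?d" by (rule fold_primitive_on[OF P L])
  have P4': "primitive_on (- 4 * L) (4 * L) (per_ext L ?e) ?d"
    by (rule primitive_on_cong[OF P4]) (simp_all add: per_ext_fold_pos[OF L])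
  have sq: "(fold_sign L x * g (fold_pos L x))\<^sup>2 = (g (fold_pos L x))\<^sup>2" for x
    by (auto simp: fold_sign_def)
  have "L2_on (- 4 * L) (4 * L) ?d"
    unfolding L2_on_def sq
  proof
    show "set_borel_measurable lborel {- 4 * L..4 * L} ?d"
      using P4 by (auto simp: primitive_on_def set_integrable_def set_borel_measurable_def
          dest: borel_measurable_integrable)
    show "set_integrable lborel {- 4 * L..4 * L} (\<lambda>x. (g (fold_pos L x))\<^sup>2)"
      by (rule fold_pos_integrable[OF _ L]) (use g in \<open>simp add: L2_on_def\<close>)
  qed
  moreover have "L2_on (- 4 * L) (4 * L) (per_ext L ?e)"
    by (rule L2_on_continuous[OF primitive_on_continuous[OF P4']])
  moreover have "weak_deriv (- 4 * L) (4 * L) (per_ext L ?e) ?d"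
    by (rule primitive_on_imp_weak_deriv[OF P4']) (use L in simp)
  moreover have "continuous_on {- 2 * L..2 * L} ?e"
    by (rule continuous_on_subset[OF primitive_on_continuous[OF P4]]) (use L in auto)
  ultimately show ?thesis by (simp add: H1per_def H1_def)
qed

text \<open>Cauchy-Schwarz against the constant 1, obtained by expanding the integral of (g - r)^2
  with \<open>r\<close> the mean of \<open>g\<close> over [x, y].\<close>

lemma primitive_on_increment_sq_le:
  assumes P: "primitive_on a b f g" and g2: "set_integrable lborel {a..b} (\<lambda>x. (g x)\<^sup>2)"
    and xy: "a \<le> x" "x \<le> y" "y \<le> b"
  shows "(f y - f x)\<^sup>2 \<le> (y - x) * (LINT t:{x..y}|lborel. (g t)\<^sup>2)"
proof (cases "x = y")
  case False
  define I where "I = (LINT t:{x..y}|lborel. g t)"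
  define J where "J = (LINT t:{x..y}|lborel. (g t)\<^sup>2)"
  define r where "r = I / (y - x)"
  have gi: "set_integrable lborel {x..y} g" and g2i: "set_integrable lborel {x..y} (\<lambda>x. (g x)\<^sup>2)"
    using P g2 xy set_integrable_Icc_subset by (auto simp: primitive_on_def)
  have ci: "set_integrable lborel {x..y} (\<lambda>_. c)" for c :: real
    by (intro borel_integrable_atLeastAtMost' continuous_intros)
  have "0 \<le> (LINT t:{x..y}|lborel. (g t - r)\<^sup>2)"
    unfolding set_lebesgue_integral_def by (intro Bochner_Integration.integral_nonneg) auto
  also have "\<dots> = (LINT t:{x..y}|lborel. ((g t)\<^sup>2 - 2 * r * g t) + r\<^sup>2)"
    by (simp add: power2_diff algebra_simps)
  also have "\<dots> = (LINT t:{x..y}|lborel. (g t)\<^sup>2 - 2 * r * g t) + (LINT t:{x..y}|lborel. r\<^sup>2)"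
    using gi g2i ci by (intro set_integral_add) auto
  also have "(LINT t:{x..y}|lborel. (g t)\<^sup>2 - 2 * r * g t) = J - 2 * r * I"
    using gi g2i by (simp add: I_def J_def)
  also have "(LINT t:{x..y}|lborel. r\<^sup>2) = r\<^sup>2 * (y - x)"
    using xy by (simp add: set_lebesgue_integral_def)
  finally have "0 \<le> J - 2 * r * I + r\<^sup>2 * (y - x)" .
  then have "0 \<le> (y - x) * (J - 2 * r * I + r\<^sup>2 * (y - x))" using xy by simp
  also have "\<dots> = (y - x) * J - I\<^sup>2"
    using False xy unfolding r_def power2_eq_square by (simp add: divide_simps)
  finally have "I\<^sup>2 \<le> (y - x) * J" by simp
  moreover have "f y - f x = I" using P xy by (simp add: primitive_on_def I_def)
  ultimately show ?thesis by (simp add: J_def)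
qed simp

section \<open>Partitions into cells and the deterministic risk bound\<close>

lemma sum_indicator_cells:
  fixes q :: "nat \<Rightarrow> real"
  assumes "\<And>k. k < r \<Longrightarrow> q k \<le> q (Suc k)"
  shows "(\<Sum>k<r. indicator {q k..<q (Suc k)} x) = indicat_real {q 0..<q r} x \<and> q 0 \<le> q r"
  using assms
proof (induction r)
  case (Suc r)
  then have "(\<Sum>k<r. indicator {q k..<q (Suc k)} x) = indicat_real {q 0..<q r} x" "q 0 \<le> q r"
    "q r \<le> q (Suc r)" by auto
  then show ?case by (auto simp: indicator_def)
qed simp

text \<open>For fixed \<open>x\<close> this is the indicator of the stretch from the left end of the
  cell of \<open>x\<close> up to \<open>x\<close>; for fixed \<open>t\<close> it is that of the rest
  of the cell of \<open>t\<close> beyond \<open>t\<close>. The first view expands H, the second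
  bounds variances. The form as a sum makes joint measurability immediate.\<close>

definition cell_kernel :: "(nat \<Rightarrow> real) \<Rightarrow> nat \<Rightarrow> real \<Rightarrow> real \<Rightarrow> real" where
  "cell_kernel q m t x =
     (\<Sum>j<m. indicator {q j..<q (Suc j)} t * indicator {q j..<q (Suc j)} x * (if t < x then 1 else 0))"

text \<open>Cells are half-open and may be empty; the right end point L stays uncovered, which is a
  null set for the design.\<close>

locale cell_partition =
  fixes L :: real and q :: "nat \<Rightarrow> real" and m :: nat
  assumes q_mono: "\<And>k. k < m \<Longrightarrow> q k \<le> q (Suc k)"
    and q_first: "q 0 = - L" and q_last: "q m = L"
begin

lemma cells_sum: "(\<Sum>k<m. indicator {q k..<q (Suc k)} x) = indicat_real {- L..<L} x"
  using sum_indicator_cells[of m q x] q_mono q_first q_last by simp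

lemma q_le: "j \<le> k \<Longrightarrow> k \<le> m \<Longrightarrow> q j \<le> q k"
  by (induction rule: dec_induct) (use q_mono in \<open>auto intro: order_trans\<close>)

lemma q_bounds: "k \<le> m \<Longrightarrow> - L \<le> q k \<and> q k \<le> L"
  using q_le[of 0 k] q_le[of k m] q_first q_last by simp

lemma cell_subset: "k < m \<Longrightarrow> {q k..<q (Suc k)} \<subseteq> {- L..<L}"
  using q_bounds[of k] q_bounds[of "Suc k"] by auto

lemma cell_obtain:
  assumes "x \<in> {- L..<L}"
  obtains k where "k < m" "x \<in> {q k..<q (Suc k)}"
proof -
  have "(\<Sum>k<m. indicator {q k..<q (Suc k)} x) \<noteq> (0::real)" using cells_sum[of x] assms by simp
  then obtain k where "k < m" "indicat_real {q k..<q (Suc k)} x \<noteq> 0"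
    using sum.not_neutral_contains_not_neutral by blast
  then show thesis using that by (auto simp: indicator_def split: if_splits)
qed

lemma cell_unique:
  assumes "j < m" "k < m" "x \<in> {q j..<q (Suc j)}" "x \<in> {q k..<q (Suc k)}"
  shows "j = k"
proof (rule ccontr)
  assume "j \<noteq> k"
  then consider "Suc j \<le> k" | "Suc k \<le> j" by linarith
  then show False
    using q_le[of "Suc j" k] q_le[of "Suc k" j] assms by cases auto
qed

lemma cells_sum_select:
  fixes c :: "nat \<Rightarrow> real"
  assumes "j < m" "x \<in> {q j..<q (Suc j)}"
  shows "(\<Sum>k<m. indicator {q k..<q (Suc k)} x * c k) = c j"
proof -
  have "(\<Sum>k<m. indicator {q k..<q (Suc k)} x * c k) = (\<Sum>k<m. if k = j then c j else 0)"
  proof (intro sum.cong refl)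
    fix k assume "k \<in> {..<m}"
    then show "indicator {q k..<q (Suc k)} x * c k = (if k = j then c j else 0)"
      using cell_unique[of j k x] assms by (cases "k = j") (auto simp: indicator_eq_0_iff simp del: atLeastLessThan_iff)
  qed
  then show ?thesis using assms by simp
qed

lemma cell_kernel_eq:
  assumes "j < m" "x \<in> {q j..<q (Suc j)}"
  shows "cell_kernel q m t x = indicator {q j..<x} t"
proof -
  have "cell_kernel q m t x = (\<Sum>k<m. indicator {q k..<q (Suc k)} x * (indicator {q k..<q (Suc k)} t * (if t < x then 1 else 0)))"
    unfolding cell_kernel_def by (intro sum.cong refl) simp
  also have "\<dots> = indicator {q j..<q (Suc j)} t * (if t < x then 1 else 0)"
    by (rule cells_sum_select[OF assms])
  also have "\<dots> = indicator {q j..<x} t" using assms by (auto simp: indicator_def)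
  finally show ?thesis .
qed

text \<open>Separates the unknown \<open>H\<close> from the sample point: \<open>x\<close> enters
  through indicators and \<open>cell_kernel\<close>, which do not depend on \<open>H\<close>, so a
  bound on noise sums of these serves all \<open>H\<close> at once.\<close>

lemma primitive_on_cell_expansion:
  assumes P: "primitive_on (- L) L H \<gamma>" and x: "x \<in> {- L..<L}"
  shows "H x = (\<Sum>j<m. indicator {q j..<q (Suc j)} x * H (q j))
      + (LINT t:{- L..L}|lborel. \<gamma> t * cell_kernel q m t x)"
proof -
  obtain j where j: "j < m" "x \<in> {q j..<q (Suc j)}" using cell_obtain[OF x] .
  have qj: "- L \<le> q j" "q j \<le> x" "x \<le> L" using q_bounds[of j] j x by auto
  have gi: "set_integrable lborel {q j..x} \<gamma>"
    using P qj by (auto simp: primitive_on_def intro: set_integrable_Icc_subset)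
  have "(LINT t:{- L..L}|lborel. \<gamma> t * cell_kernel q m t x) = (LINT t:{q j..<x}|lborel. \<gamma> t)"
    unfolding set_lebesgue_integral_def cell_kernel_eq[OF j] using qj
    by (intro Bochner_Integration.integral_cong) (auto simp: indicator_def)
  also have "\<dots> = (LINT t:{q j..x}|lborel. \<gamma> t)"
    unfolding set_lebesgue_integral_def
  proof (rule integral_cong_AE)
    show "(\<lambda>t. indicator {q j..x} t *\<^sub>R \<gamma> t) \<in> borel_measurable lborel"
      using gi unfolding set_integrable_def by (rule borel_measurable_integrable)
    show "(\<lambda>t. indicator {q j..<x} t *\<^sub>R \<gamma> t) \<in> borel_measurable lborel"
    proof -
      have "set_integrable lborel {q j..<x} \<gamma>"
        by (rule set_integrable_subset[OF gi]) auto
      then show ?thesis unfolding set_integrable_def by (rule borel_measurable_integrable)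
    qed
    show "AE t in lborel. indicator {q j..<x} t *\<^sub>R \<gamma> t = indicator {q j..x} t *\<^sub>R \<gamma> t"
      using AE_lborel_singleton[of x] by eventually_elim (auto simp: indicator_def)
  qed
  also have "\<dots> = H x - H (q j)" using P qj by (simp add: primitive_on_def)
  finally show ?thesis using cells_sum_select[OF j, of "\<lambda>j. H (q j)"] by simp
qed

end

lemma borel_measurable_cell_kernel [measurable]:
  assumes [measurable]: "f \<in> borel_measurable N" "g \<in> borel_measurable N"
  shows "(\<lambda>z. cell_kernel q m (f z) (g z)) \<in> borel_measurable N"
  unfolding cell_kernel_def by measurable

lemma integrable_bounded_on_prob:
  fixes f :: "real \<Rightarrow> real"
  assumes "prob_space P" "f \<in> borel_measurable P" "\<And>x. \<bar>f x\<bar> \<le> B"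
  shows "integrable P f"
proof -
  interpret prob_space P by fact
  show ?thesis by (rule integrable_const_bound[of f B]) (use assms in auto)
qed

text \<open>The weights 72 and 8 are those of the two applications of AM-GM to the noise term, small enough
  for absorption into the left-hand side. Cells of probability zero contribute \<open>x / 0 = 0\<close>, which
  is harmless as they almost surely contain no sample point.\<close>

definition noise_size :: "real \<Rightarrow> real measure \<Rightarrow> (nat \<Rightarrow> real) \<Rightarrow> nat \<Rightarrow> real \<Rightarrow> nat \<Rightarrow> (nat \<Rightarrow> real) \<Rightarrow> (nat \<Rightarrow> real) \<Rightarrow> real" where
  "noise_size L P q m \<mu> n xs es =
     72 / (real n)\<^sup>2 * (\<Sum>j<m. (\<Sum>i<n. es i * indicator {q j..<q (Suc j)} (xs i))\<^sup>2 / measure P {q j..<q (Suc j)})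
     + 8 / (\<mu> * (real n)\<^sup>2) * (LINT t:{- L..L}|lborel. (\<Sum>i<n. es i * cell_kernel q m t (xs i))\<^sup>2)"

text \<open>\<open>A\<close> is the empirical norm, \<open>G\<close> the energy times \<mu>,
  \<open>N\<close> the noise term, \<open>W\<close> the weighted node values and \<open>v\<close>
  the noise size. Since W/72 + G/8 is at most 2A/9 + 13G/72, there remains 7A/9 + 23G/72 \<le> v +
  b, and 64 is generous.\<close>

lemma risk_absorption:
  fixes A G N b v W R :: real
  assumes "A + G / 2 \<le> N + b" "N \<le> W / 72 + G / 8 + v" "W \<le> 16 * A + 4 * G"
    and "R \<le> 8 * A + G" "0 \<le> A" "0 \<le> G"
  shows "R \<le> 64 * (v + b)"
  using assms by argo

section \<open>Pathwise risk bounds\<close>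

text \<open>\<open>H\<close> stands for one frozen realisation of the difference; sample points and
  noise enter the lemmas as given sequences, so every bound here is deterministic.\<close>

locale sobolev_design =
  fixes L :: real and P :: "real measure" and H \<gamma> :: "real \<Rightarrow> real"
  assumes L_pos: "L > 0" and P_prob: "prob_space P" and P_sets: "sets P = sets borel"
    and P_supp: "AE x in P. x \<in> {- L..<L}"
    and prim: "primitive_on (- L) L H \<gamma>"
    and \<gamma>_sq: "set_integrable lborel {- L..L} (\<lambda>t. (\<gamma> t)\<^sup>2)"
begin

sublocale prob_space P by (rule P_prob)

text \<open>Cumulative, so that the energies of cells are increments and telescope.\<close>

definition energy :: "real \<Rightarrow> real" where
  "energy x = (LINT t:{- L..x}|lborel. (\<gamma> t)\<^sup>2)"

definition risk :: real where
  "risk = (LINT x|P. indicator {- L..<L} x * (H x)\<^sup>2)"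

lemma energy_start: "energy (- L) = 0"
  by (simp add: energy_def)

lemma energy_diff:
  assumes "- L \<le> x" "x \<le> y" "y \<le> L"
  shows "energy y - energy x = (LINT t:{x..y}|lborel. (\<gamma> t)\<^sup>2)"
  using primitive_on_indefinite[OF \<gamma>_sq] assms by (simp add: primitive_on_def energy_def)

lemma energy_mono: "- L \<le> x \<Longrightarrow> x \<le> y \<Longrightarrow> y \<le> L \<Longrightarrow> energy x \<le> energy y"
proof -
  assume "- L \<le> x" "x \<le> y" "y \<le> L"
  moreover have "0 \<le> (LINT t:{x..y}|lborel. (\<gamma> t)\<^sup>2)"
    unfolding set_lebesgue_integral_def by (intro Bochner_Integration.integral_nonneg) auto
  ultimately show ?thesis using energy_diff[of x y] by simp
qed

lemma increment_sq_le:
  assumes "x \<in> {u..v}" "y \<in> {u..v}" "- L \<le> u" "v \<le> L"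
  shows "(H y - H x)\<^sup>2 \<le> (v - u) * (energy v - energy u)"
proof -
  have main: "(H y - H x)\<^sup>2 \<le> (v - u) * (energy v - energy u)" if "x \<le> y" "x \<in> {u..v}" "y \<in> {u..v}" for x y
  proof -
    have "(H y - H x)\<^sup>2 \<le> (y - x) * (energy y - energy x)"
      using primitive_on_increment_sq_le[OF prim \<gamma>_sq, of x y] energy_diff[of x y] that assms by simp
    also have "\<dots> \<le> (v - u) * (energy v - energy u)"
      using that assms energy_mono[of x y] energy_mono[of u x] energy_mono[of y v]
      by (intro mult_mono) auto
    finally show ?thesis .
  qed
  show ?thesis
    using main[of x y] main[of y x] assms by (cases "x \<le> y") (auto simp: power2_commute)
qed

lemma sq_le_twice:
  assumes "x \<in> {u..v}" "y \<in> {u..v}" "- L \<le> u" "v \<le> L"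
  shows "(H x)\<^sup>2 \<le> 2 * (H y)\<^sup>2 + 2 * ((v - u) * (energy v - energy u))"
proof -
  have "(H x)\<^sup>2 \<le> 2 * (H y)\<^sup>2 + 2 * (H x - H y)\<^sup>2"
    using zero_le_power2[of "H x - 2 * H y"] by (simp add: power2_eq_square algebra_simps)
  then show ?thesis using increment_sq_le[of y u v x] assms by simp
qed

text \<open>\<open>sq_le_twice\<close> averaged over the sample points in the interval; the price
  for moving to an arbitrary \<open>x\<close> is the oscillation.\<close>

lemma sq_le_average:
  assumes C: "finite C" "C \<noteq> {}" "\<And>i. i \<in> C \<Longrightarrow> xs i \<in> {u..v}" and x: "x \<in> {u..v}"
    and uv: "- L \<le> u" "v \<le> L"
  shows "(H x)\<^sup>2 \<le> 2 * (\<Sum>i\<in>C. (H (xs i))\<^sup>2) / real (card C) + 2 * ((v - u) * (energy v - energy u))"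
proof -
  have "real (card C) * (H x)\<^sup>2 = (\<Sum>i\<in>C. (H x)\<^sup>2)" by simp
  also have "\<dots> \<le> (\<Sum>i\<in>C. 2 * (H (xs i))\<^sup>2 + 2 * ((v - u) * (energy v - energy u)))"
    by (intro sum_mono sq_le_twice) (use assms in auto)
  also have "\<dots> = 2 * (\<Sum>i\<in>C. (H (xs i))\<^sup>2) + real (card C) * (2 * ((v - u) * (energy v - energy u)))"
    by (simp add: sum.distrib sum_distrib_left)
  finally have *: "real (card C) * (H x)\<^sup>2 \<le> \<dots>" .
  have c: "real (card C) > 0" using C by (simp add: card_gt_0_iff)
  have "(H x)\<^sup>2 = real (card C) * (H x)\<^sup>2 / real (card C)" using c by simp
  also have "\<dots> \<le> (2 * (\<Sum>i\<in>C. (H (xs i))\<^sup>2) + real (card C) * (2 * ((v - u) * (energy v - energy u)))) / real (card C)"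
    using * c by (intro divide_right_mono) auto
  also have "\<dots> = 2 * (\<Sum>i\<in>C. (H (xs i))\<^sup>2) / real (card C) + 2 * ((v - u) * (energy v - energy u))"
    using c by (simp add: add_divide_distrib)
  finally show ?thesis .
qed

lemma H_sq_indicator_measurable: "A \<in> sets borel \<Longrightarrow> A \<subseteq> {- L..L} \<Longrightarrow> (\<lambda>x. indicator A x * (H x)\<^sup>2) \<in> borel_measurable P"
proof -
  assume A: "A \<in> sets borel" "A \<subseteq> {- L..L}"
  have "set_integrable lborel {- L..L} (\<lambda>x. (H x)\<^sup>2)"
    by (intro borel_integrable_atLeastAtMost' continuous_intros primitive_on_continuous[OF prim])
  then have "set_integrable lborel A (\<lambda>x. (H x)\<^sup>2)"
    by (rule set_integrable_subset) (use A in auto)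
  then have "(\<lambda>x. indicator A x * (H x)\<^sup>2) \<in> borel_measurable borel"
    unfolding set_integrable_def by (auto dest: borel_measurable_integrable)
  then show ?thesis by (simp add: measurable_cong_sets[OF P_sets refl])
qed

lemma H_sq_indicator_integrable:
  assumes A: "A \<in> sets borel" "A \<subseteq> {- L..L}"
  shows "integrable P (\<lambda>x. indicator A x * (H x)\<^sup>2)"
proof -
  have "bounded (H ` {- L..L})"
    by (intro compact_imp_bounded compact_continuous_image primitive_on_continuous[OF prim]) auto
  then obtain B where B: "\<And>x. x \<in> {- L..L} \<Longrightarrow> \<bar>H x\<bar> \<le> B"
    unfolding bounded_iff by (metis imageI real_norm_def)
  have "\<bar>indicator A x * (H x)\<^sup>2\<bar> \<le> B\<^sup>2" for x
    using B[of x] A(2) by (auto simp: indicator_def abs_le_square_iff[symmetric])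
  then show ?thesis
    by (intro integrable_bounded_on_prob[OF P_prob, of _ "B\<^sup>2"] H_sq_indicator_measurable A)
qed

lemma risk_le_sup:
  assumes "\<And>x. x \<in> {- L..<L} \<Longrightarrow> (H x)\<^sup>2 \<le> B" "0 \<le> B"
  shows "risk \<le> B"
proof -
  have "risk \<le> (LINT x|P. B)"
    unfolding risk_def
    by (intro integral_mono H_sq_indicator_integrable) (use assms in \<open>auto simp: indicator_def\<close>)
  then show ?thesis by (simp add: prob_space)
qed

lemma risk_eq_sum_cells:
  assumes "cell_partition L q m"
  shows "risk = (\<Sum>k<m. LINT x|P. indicator {q k..<q (Suc k)} x * (H x)\<^sup>2)"
proof -
  interpret cell_partition L q m by fact
  have sub: "{q k..<q (Suc k)} \<subseteq> {- L..L}" if "k < m" for k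
    by (rule subset_trans[OF cell_subset[OF that]]) auto
  have "risk = (LINT x|P. (\<Sum>k<m. indicator {q k..<q (Suc k)} x * (H x)\<^sup>2))"
    unfolding risk_def by (simp add: cells_sum[symmetric] sum_distrib_right)
  also have "\<dots> = (\<Sum>k<m. LINT x|P. indicator {q k..<q (Suc k)} x * (H x)\<^sup>2)"
    by (intro Bochner_Integration.integral_sum H_sq_indicator_integrable sub) auto
  finally show ?thesis .
qed

lemma sum_energy_cells:
  assumes "cell_partition L q m"
  shows "(\<Sum>k<m. energy (q (Suc k)) - energy (q k)) = energy L"
proof -
  interpret cell_partition L q m by fact
  show ?thesis
    using sum_lessThan_telescope[of "\<lambda>k. energy (q k)" m] by (simp add: energy_start q_first q_last)
qed

text \<open>A cell of mass 1/r holds at least a quarter of its n/r expected points, so passing from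
  its sample average to the integral costs 2 times 4. The oscillation inside a cell is bounded with
  the crude length 2L; smallness comes from the mass 1/r, and the cell energies add up to the
  total.\<close>

lemma risk_le_empirical:
  assumes part: "cell_partition L q r" and r: "r > 0" and n: "n > 0"
    and mass: "\<And>k. k < r \<Longrightarrow> prob {q k..<q (Suc k)} = 1 / real r"
    and count: "\<And>k. k < r \<Longrightarrow> real n / (4 * real r) \<le> real (card {i. i < n \<and> xs i \<in> {q k..<q (Suc k)}})"
    and xs: "\<And>i. i < n \<Longrightarrow> xs i \<in> {- L..<L}"
  shows "risk \<le> 8 * ((\<Sum>i<n. (H (xs i))\<^sup>2) / real n) + 4 * L / real r * energy L"
proof -
  interpret cell_partition L q r by fact
  define C where "C k = {i. i < n \<and> xs i \<in> {q k..<q (Suc k)}}" for k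
  have cell: "(LINT x|P. indicator {q k..<q (Suc k)} x * (H x)\<^sup>2)
      \<le> 8 / real n * (\<Sum>i\<in>C k. (H (xs i))\<^sup>2) + 4 * L / real r * (energy (q (Suc k)) - energy (q k))"
    if k: "k < r" for k
  proof -
    let ?I = "{q k..<q (Suc k)}" and ?S = "\<Sum>i\<in>C k. (H (xs i))\<^sup>2" and ?E = "energy (q (Suc k)) - energy (q k)"
    have qk: "- L \<le> q k" "q k \<le> q (Suc k)" "q (Suc k) \<le> L" 
      using q_bounds[of k] q_bounds[of "Suc k"] q_mono k by auto
    have E0: "?E \<ge> 0" using energy_mono qk by simp
    have S0: "?S \<ge> 0" by (intro sum_nonneg) auto
    have cpos: "0 < real n / (4 * real r)" using n r by simp
    have cge1: "real n / (4 * real r) \<le> real (card (C k))"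
      using count[OF k] by (simp add: C_def)
    have cge: "real n / (4 * real r) \<le> real (card (C k))" "C k \<noteq> {}"
      using cge1 cpos by auto
    have "(H x)\<^sup>2 \<le> 8 * real r / real n * ?S + 4 * L * ?E" if x: "x \<in> ?I" for x
    proof -
      have "(H x)\<^sup>2 \<le> 2 * ?S / real (card (C k)) + 2 * ((q (Suc k) - q k) * ?E)"
        by (rule sq_le_average) (use cge x qk in \<open>auto simp: C_def\<close>)
      also have "2 * ?S / real (card (C k)) \<le> 2 * ?S / (real n / (4 * real r))"
        using cge cpos S0 by (intro divide_left_mono mult_pos_pos) auto
      also have "2 * ?S / (real n / (4 * real r)) = 8 * real r / real n * ?S"
        using n r by (simp add: field_simps)
      also have "(q (Suc k) - q k) * ?E \<le> (2 * L) * ?E"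
        using qk E0 by (intro mult_right_mono) auto
      finally show ?thesis by simp
    qed note bd = this
    have "(LINT x|P. indicator ?I x * (H x)\<^sup>2)
        \<le> (LINT x|P. indicator ?I x * (8 * real r / real n * ?S + 4 * L * ?E))"
    proof (rule integral_mono)
      show "integrable P (\<lambda>x. indicator ?I x * (H x)\<^sup>2)"
        by (rule H_sq_indicator_integrable) (use qk in auto)
      show "integrable P (\<lambda>x. indicator ?I x * (8 * real r / real n * ?S + 4 * L * ?E))"
        by (intro integrable_mult_left integrable_real_indicator) (auto simp: P_sets emeasure_eq_measure)
    qed (use bd in \<open>auto simp: indicator_def\<close>)
    also have "\<dots> = 1 / real r * (8 * real r / real n * ?S + 4 * L * ?E)"
      using mass[OF k] by (simp add: P_sets)
    also have "\<dots> = 8 / real n * ?S + 4 * L / real r * ?E"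
      using r n by (simp add: field_simps)
    finally show ?thesis .
  qed
  have "risk \<le> (\<Sum>k<r. 8 / real n * (\<Sum>i\<in>C k. (H (xs i))\<^sup>2) + 4 * L / real r * (energy (q (Suc k)) - energy (q k)))"
    unfolding risk_eq_sum_cells[OF part] by (intro sum_mono cell) auto
  also have "\<dots> = 8 / real n * (\<Sum>k<r. \<Sum>i\<in>C k. (H (xs i))\<^sup>2) + 4 * L / real r * energy L"
    using sum_energy_cells[OF part] by (simp only: sum.distrib sum_distrib_left[symmetric])
  also have "(\<Sum>k<r. \<Sum>i\<in>C k. (H (xs i))\<^sup>2) = (\<Sum>k<r. \<Sum>i<n. indicator {q k..<q (Suc k)} (xs i) * (H (xs i))\<^sup>2)"
    unfolding C_def by (intro sum.cong refl sum.mono_neutral_cong_left) (auto simp: indicator_def)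
  also have "\<dots> = (\<Sum>i<n. \<Sum>k<r. indicator {q k..<q (Suc k)} (xs i) * (H (xs i))\<^sup>2)"
    by (rule sum.swap)
  also have "\<dots> = (\<Sum>i<n. (H (xs i))\<^sup>2)"
    using xs by (intro sum.cong refl) (simp add: sum_distrib_right[symmetric] cells_sum)
  finally show ?thesis by simp
qed

text \<open>The noise term involves \<open>H\<close> at the left end points, where there need be no
  data; these values are recovered from the risk. A cell contributes its mass, at most \<kappa>
  \<Delta>, times an oscillation of \<Delta> times its energy, whence \<kappa> \<Delta>^2.\<close>

lemma weighted_nodes_le:
  assumes part: "cell_partition L q m" and \<Delta>: "\<And>j. j < m \<Longrightarrow> q (Suc j) - q j = \<Delta>"
    and mass: "\<And>j. j < m \<Longrightarrow> prob {q j..<q (Suc j)} \<le> \<kappa> * \<Delta>"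
  shows "(\<Sum>j<m. prob {q j..<q (Suc j)} * (H (q j))\<^sup>2) \<le> 2 * risk + 2 * \<kappa> * \<Delta>\<^sup>2 * energy L"
proof -
  interpret cell_partition L q m by fact
  have cell: "prob {q j..<q (Suc j)} * (H (q j))\<^sup>2 \<le> 2 * (LINT x|P. indicator {q j..<q (Suc j)} x * (H x)\<^sup>2)
      + 2 * \<kappa> * \<Delta>\<^sup>2 * (energy (q (Suc j)) - energy (q j))" if j: "j < m" for j
  proof -
    let ?I = "{q j..<q (Suc j)}" and ?E = "energy (q (Suc j)) - energy (q j)"
    have qj: "- L \<le> q j" "q j \<le> q (Suc j)" "q (Suc j) \<le> L" 
      using q_bounds[of j] q_bounds[of "Suc j"] q_mono j by auto
    have \<Delta>0: "\<Delta> \<ge> 0" using qj \<Delta>[OF j] by simp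
    have E0: "?E \<ge> 0" using energy_mono qj by simp
    have "prob ?I * (H (q j))\<^sup>2 = (LINT x|P. indicator ?I x * (H (q j))\<^sup>2)"
      by (simp add: P_sets)
    also have "\<dots> \<le> (LINT x|P. 2 * (indicator ?I x * (H x)\<^sup>2) + indicator ?I x * (2 * (\<Delta> * ?E)))"
    proof (rule integral_mono)
      show "integrable P (\<lambda>x. indicator ?I x * (H (q j))\<^sup>2)"
        by (intro integrable_mult_left integrable_real_indicator) (auto simp: P_sets emeasure_eq_measure)
      show "integrable P (\<lambda>x. 2 * (indicator ?I x * (H x)\<^sup>2) + indicator ?I x * (2 * (\<Delta> * ?E)))"
        by (intro Bochner_Integration.integrable_add integrable_mult_right H_sq_indicator_integrable
          integrable_mult_left integrable_real_indicator) (use qj in \<open>auto simp: P_sets emeasure_eq_measure\<close>)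
      fix x
      show "indicator ?I x * (H (q j))\<^sup>2 \<le> 2 * (indicator ?I x * (H x)\<^sup>2) + indicator ?I x * (2 * (\<Delta> * ?E))"
        using sq_le_twice[of "q j" "q j" "q (Suc j)" x] qj \<Delta>[OF j] by (auto simp: indicator_def)
    qed
    also have "\<dots> = 2 * (LINT x|P. indicator ?I x * (H x)\<^sup>2) + prob ?I * (2 * (\<Delta> * ?E))"
      by (subst Bochner_Integration.integral_add)
        (use qj in \<open>auto simp: P_sets emeasure_eq_measure
          intro!: integrable_mult_right H_sq_indicator_integrable integrable_mult_left integrable_real_indicator\<close>)
    also have "prob ?I * (2 * (\<Delta> * ?E)) \<le> (\<kappa> * \<Delta>) * (2 * (\<Delta> * ?E))"
      using mass[OF j] \<Delta>0 E0 by (intro mult_right_mono) auto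
    finally show ?thesis by (simp add: power2_eq_square mult_ac)
  qed
  have "(\<Sum>j<m. prob {q j..<q (Suc j)} * (H (q j))\<^sup>2)
      \<le> (\<Sum>j<m. 2 * (LINT x|P. indicator {q j..<q (Suc j)} x * (H x)\<^sup>2)
      + 2 * \<kappa> * \<Delta>\<^sup>2 * (energy (q (Suc j)) - energy (q j)))"
    by (intro sum_mono cell) auto
  also have "\<dots> = 2 * risk + 2 * \<kappa> * \<Delta>\<^sup>2 * energy L"
    unfolding risk_eq_sum_cells[OF part] sum_energy_cells[OF part, symmetric]
    by (simp only: sum.distrib sum_distrib_left[symmetric])
  finally show ?thesis .
qed

text \<open>Expansion over cells followed by AM-GM, cellwise with weight \<open>p j\<close> for the
  node part and pointwise in \<open>t\<close> for the part against \<open>\<gamma>\<close>.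
  Weighting by the mass matches the variance of \<open>S j\<close>, which will be bounded by a
  multiple of \<open>p j\<close>.\<close>

lemma noise_le:
  assumes part: "cell_partition L q m" and n: "n > 0" and \<mu>: "\<mu> > 0"
    and xs: "\<And>i. i < n \<Longrightarrow> xs i \<in> {- L..<L}"
    and null: "\<And>i j. i < n \<Longrightarrow> j < m \<Longrightarrow> prob {q j..<q (Suc j)} = 0 \<Longrightarrow> xs i \<notin> {q j..<q (Suc j)}"
  shows "2 / real n * (\<Sum>i<n. es i * H (xs i)) \<le> (\<Sum>j<m. prob {q j..<q (Suc j)} * (H (q j))\<^sup>2) / 72
     + \<mu> / 8 * energy L + noise_size L P q m \<mu> n xs es"
proof -
  interpret cell_partition L q m by fact
  define S where "S j = (\<Sum>i<n. es i * indicator {q j..<q (Suc j)} (xs i))" for j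
  define T where "T t = (\<Sum>i<n. es i * cell_kernel q m t (xs i))" for t
  define p where "p j = prob {q j..<q (Suc j)}" for j
  have \<gamma>: "set_integrable lborel {- L..L} \<gamma>" using prim by (simp add: primitive_on_def)
  have [measurable]: "T \<in> borel_measurable borel" unfolding T_def by measurable
  have kb: "\<bar>cell_kernel q m t (xs i)\<bar> \<le> 1" if i: "i < n" for t i
  proof -
    obtain j where "j < m" "xs i \<in> {q j..<q (Suc j)}" using cell_obtain[OF xs[OF i]] .
    then show ?thesis by (simp add: cell_kernel_eq indicator_def)
  qed
  have Tb: "\<bar>T t\<bar> \<le> (\<Sum>i<n. \<bar>es i\<bar>)" for t
    unfolding T_def
  proof (rule order_trans[OF sum_abs sum_mono])
    fix i assume "i \<in> {..<n}"
    then show "\<bar>es i * cell_kernel q m t (xs i)\<bar> \<le> \<bar>es i\<bar>"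
      using kb[of i t] by (simp add: abs_mult mult_left_le)
  qed
  have bint: "set_integrable lborel {- L..L} h" if "h \<in> borel_measurable borel" "\<And>t. \<bar>h t\<bar> \<le> B" for h :: "real \<Rightarrow> real" and B
  proof -
    have "set_integrable lborel {- L..L} (\<lambda>_. B)"
      by (intro borel_integrable_atLeastAtMost' continuous_intros)
    then show ?thesis
      by (rule set_integrable_bound) (use that in \<open>auto simp: set_borel_measurable_def intro: order_trans[OF _ abs_ge_self]\<close>)
  qed
  have T2i: "set_integrable lborel {- L..L} (\<lambda>t. (T t)\<^sup>2)"
    by (rule bint[of _ "(\<Sum>i<n. \<bar>es i\<bar>)\<^sup>2"]) (use Tb in \<open>auto simp: abs_le_square_iff[symmetric] intro: order_trans[OF _ abs_ge_self]\<close>)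
  have \<gamma>b: "set_integrable lborel {- L..L} (\<lambda>t. \<gamma> t * h t)"
    if "h \<in> borel_measurable borel" "\<And>t. \<bar>h t\<bar> \<le> B" for h :: "real \<Rightarrow> real" and B
  proof -
    have "set_integrable lborel {- L..L} (\<lambda>t. B * \<gamma> t)" using \<gamma> by simp
    then show ?thesis
    proof (rule set_integrable_bound)
      have "(\<lambda>x. indicator {- L..L} x *\<^sub>R \<gamma> x) \<in> borel_measurable borel"
        using \<gamma> unfolding set_integrable_def by (auto dest: borel_measurable_integrable)
      then have "(\<lambda>x. indicator {- L..L} x *\<^sub>R \<gamma> x * h x) \<in> borel_measurable borel"
        using that by measurable
      then show "set_borel_measurable lborel {- L..L} (\<lambda>t. \<gamma> t * h t)"
        by (simp add: set_borel_measurable_def mult.assoc)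
      show "AE x in lborel. x \<in> {- L..L} \<longrightarrow> norm (\<gamma> x * h x) \<le> norm (B * \<gamma> x)"
      proof (intro AE_I2 impI)
        fix x
        have "\<bar>h x\<bar> \<le> \<bar>B\<bar>" using that(2)[of x] by linarith
        then show "norm (\<gamma> x * h x) \<le> norm (B * \<gamma> x)"
          by (simp add: abs_mult mult.commute[of "\<bar>B\<bar>"] mult_left_mono)
      qed
    qed
  qed
  have "(\<Sum>i<n. es i * H (xs i)) = (\<Sum>i<n. es i * (\<Sum>j<m. indicator {q j..<q (Suc j)} (xs i) * H (q j))
      + (LINT t:{- L..L}|lborel. es i * (\<gamma> t * cell_kernel q m t (xs i))))"
    using primitive_on_cell_expansion[OF prim xs] by (intro sum.cong refl) (simp add: distrib_left)
  also have "\<dots> = (\<Sum>i<n. \<Sum>j<m. es i * (indicator {q j..<q (Suc j)} (xs i) * H (q j)))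
      + (\<Sum>i<n. LINT t:{- L..L}|lborel. es i * (\<gamma> t * cell_kernel q m t (xs i)))"
    by (simp only: sum.distrib sum_distrib_left)
  also have "(\<Sum>i<n. \<Sum>j<m. es i * (indicator {q j..<q (Suc j)} (xs i) * H (q j))) = (\<Sum>j<m. H (q j) * S j)"
    unfolding S_def sum_distrib_left by (subst sum.swap) (intro sum.cong refl; simp)
  also have "(\<Sum>i<n. LINT t:{- L..L}|lborel. es i * (\<gamma> t * cell_kernel q m t (xs i)))
      = (LINT t:{- L..L}|lborel. (\<Sum>i<n. es i * (\<gamma> t * cell_kernel q m t (xs i))))"
    unfolding set_lebesgue_integral_def scaleR_sum_right
  proof (rule Bochner_Integration.integral_sum[symmetric])
    show "integrable lborel (\<lambda>t. indicator {- L..L} t *\<^sub>R (es i * (\<gamma> t * cell_kernel q m t (xs i))))" if "i \<in> {..<n}" for i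
      using \<gamma>b[of "\<lambda>t. cell_kernel q m t (xs i)" 1, THEN set_integrable_mult_right, of "es i"] kb[of i] that
      by (simp add: set_integrable_def)
  qed
  also have "\<dots> = (LINT t:{- L..L}|lborel. \<gamma> t * T t)"
    by (simp add: T_def sum_distrib_left mult_ac)
  finally have dec: "(\<Sum>i<n. es i * H (xs i)) = (\<Sum>j<m. H (q j) * S j) + (LINT t:{- L..L}|lborel. \<gamma> t * T t)" .
  have "2 / real n * (\<Sum>j<m. H (q j) * S j) = (\<Sum>j<m. 2 / real n * (H (q j) * S j))"
    by (simp add: sum_distrib_left)
  also have "\<dots> \<le> (\<Sum>j<m. p j * (H (q j))\<^sup>2 / 72 + 72 / (real n)\<^sup>2 * ((S j)\<^sup>2 / p j))"
  proof (rule sum_mono)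
    fix j assume "j \<in> {..<m}"
    then have j: "j < m" by simp
    show "2 / real n * (H (q j) * S j) \<le> p j * (H (q j))\<^sup>2 / 72 + 72 / (real n)\<^sup>2 * ((S j)\<^sup>2 / p j)"
    proof (cases "p j = 0")
      case True
      then have "S j = 0"
        using null[OF _ j] unfolding S_def p_def by (intro sum.neutral) (auto simp: indicator_def)
      then show ?thesis using True by simp
    next
      case False
      then have pj: "p j > 0" unfolding p_def by (simp add: zero_less_measure_iff measure_nonneg order.not_eq_order_implies_strict)
      \<comment> \<open>The square is centred at the minimiser in \<open>H (q j)\<close>, so its
        expansion is precisely the difference of the two sides.\<close>
      have "0 \<le> p j / 72 * (H (q j) - 72 * S j / (real n * p j))\<^sup>2" using pj by simp
      also have "\<dots> = p j * (H (q j))\<^sup>2 / 72 - 2 / real n * (H (q j) * S j) + 72 / (real n)\<^sup>2 * ((S j)\<^sup>2 / p j)"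
        using pj n by (simp add: field_simps power2_eq_square)
      finally show ?thesis by simp
    qed
  qed
  also have "\<dots> = (\<Sum>j<m. p j * (H (q j))\<^sup>2) / 72 + 72 / (real n)\<^sup>2 * (\<Sum>j<m. (S j)\<^sup>2 / p j)"
    by (simp add: sum.distrib sum_divide_distrib sum_distrib_left)
  finally have part1: "2 / real n * (\<Sum>j<m. H (q j) * S j) \<le> \<dots>" .
  have "2 / real n * (LINT t:{- L..L}|lborel. \<gamma> t * T t) = (LINT t:{- L..L}|lborel. 2 / real n * (\<gamma> t * T t))"
    by simp
  also have "\<dots> \<le> (LINT t:{- L..L}|lborel. \<mu> / 8 * (\<gamma> t)\<^sup>2 + 8 / (\<mu> * (real n)\<^sup>2) * (T t)\<^sup>2)"
  proof (rule set_integral_mono)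
    show "set_integrable lborel {- L..L} (\<lambda>t. 2 / real n * (\<gamma> t * T t))"
      by (intro set_integrable_mult_right \<gamma>b[OF _ Tb]) measurable
    show "set_integrable lborel {- L..L} (\<lambda>t. \<mu> / 8 * (\<gamma> t)\<^sup>2 + 8 / (\<mu> * (real n)\<^sup>2) * (T t)\<^sup>2)"
      by (intro set_integral_add(1) set_integrable_mult_right \<gamma>_sq T2i)
    fix t
    have "0 \<le> \<mu> / 8 * (\<gamma> t - 8 * T t / (\<mu> * real n))\<^sup>2" using \<mu> by simp
    also have "\<dots> = \<mu> / 8 * (\<gamma> t)\<^sup>2 - 2 / real n * (\<gamma> t * T t) + 8 / (\<mu> * (real n)\<^sup>2) * (T t)\<^sup>2"
      using \<mu> n by (simp add: field_simps power2_eq_square)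
    finally show "2 / real n * (\<gamma> t * T t) \<le> \<mu> / 8 * (\<gamma> t)\<^sup>2 + 8 / (\<mu> * (real n)\<^sup>2) * (T t)\<^sup>2" by simp
  qed
  also have "\<dots> = \<mu> / 8 * energy L + 8 / (\<mu> * (real n)\<^sup>2) * (LINT t:{- L..L}|lborel. (T t)\<^sup>2)"
    using \<gamma>_sq T2i by (simp add: energy_def)
  finally have part2: "2 / real n * (LINT t:{- L..L}|lborel. \<gamma> t * T t) \<le> \<dots>" .
  show ?thesis
    using part1 part2 unfolding dec distrib_left noise_size_def S_def T_def p_def by linarith
qed

text \<open>The two partitions meet: the quantile cells bound the risk by A and G, the uniform cells
  bound the node values by the risk, hence again by A and G, and both are absorbed into the basic
  inequality. \<open>b\<close> collects the bias; the right-hand side no longer mentions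
  \<open>H\<close>.\<close>

lemma risk_le_noise_size:
  assumes basic: "(\<Sum>i<n. (H (xs i))\<^sup>2) / real n + \<mu> / 2 * energy L \<le> 2 / real n * (\<Sum>i<n. es i * H (xs i)) + b"
    and n: "n > 0" and \<mu>: "\<mu> > 0" and xs: "\<And>i. i < n \<Longrightarrow> xs i \<in> {- L..<L}"
    and part: "cell_partition L q m" and \<Delta>: "\<And>j. j < m \<Longrightarrow> q (Suc j) - q j = \<Delta>"
    and mass: "\<And>j. j < m \<Longrightarrow> prob {q j..<q (Suc j)} \<le> \<kappa> * \<Delta>" and \<kappa>: "\<kappa> * \<Delta>\<^sup>2 \<le> \<mu>"
    and null: "\<And>i j. i < n \<Longrightarrow> j < m \<Longrightarrow> prob {q j..<q (Suc j)} = 0 \<Longrightarrow> xs i \<notin> {q j..<q (Suc j)}"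
    and part': "cell_partition L q' r" and r: "r > 0" "4 * L / real r \<le> \<mu>"
    and mass': "\<And>k. k < r \<Longrightarrow> prob {q' k..<q' (Suc k)} = 1 / real r"
    and count: "\<And>k. k < r \<Longrightarrow> real n / (4 * real r) \<le> real (card {i. i < n \<and> xs i \<in> {q' k..<q' (Suc k)}})"
  shows "risk \<le> 64 * (noise_size L P q m \<mu> n xs es + b)"
proof -
  define A where "A = (\<Sum>i<n. (H (xs i))\<^sup>2) / real n"
  define G where "G = \<mu> * energy L"
  have E0: "energy L \<ge> 0" using energy_mono[of "- L" L] L_pos energy_start by simp
  have A0: "A \<ge> 0" unfolding A_def by (intro divide_nonneg_nonneg sum_nonneg) auto
  have G0: "G \<ge> 0" using E0 \<mu> by (simp add: G_def)
  have "risk \<le> 8 * A + 4 * L / real r * energy L"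
    unfolding A_def by (rule risk_le_empirical[OF part' r(1) n mass' count xs])
  also have "4 * L / real r * energy L \<le> G"
    unfolding G_def using r E0 by (intro mult_right_mono) auto
  finally have r1: "risk \<le> 8 * A + G" by simp
  have "(\<Sum>j<m. prob {q j..<q (Suc j)} * (H (q j))\<^sup>2) \<le> 2 * risk + 2 * \<kappa> * \<Delta>\<^sup>2 * energy L"
    by (rule weighted_nodes_le[OF part \<Delta> mass])
  also have "2 * \<kappa> * \<Delta>\<^sup>2 * energy L \<le> 2 * G"
    unfolding G_def using mult_right_mono[OF \<kappa> E0] by (simp add: mult_ac)
  finally have W: "(\<Sum>j<m. prob {q j..<q (Suc j)} * (H (q j))\<^sup>2) \<le> 16 * A + 4 * G"
    using r1 by simp
  define N where "N = 2 / real n * (\<Sum>i<n. es i * H (xs i))"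
  have "A + G / 2 \<le> N + b"
    using basic by (simp add: A_def G_def N_def)
  moreover have "N \<le> (\<Sum>j<m. prob {q j..<q (Suc j)} * (H (q j))\<^sup>2) / 72
      + G / 8 + noise_size L P q m \<mu> n xs es"
  proof -
    have G8: "G / 8 = \<mu> / 8 * energy L" by (simp add: G_def)
    show ?thesis
      unfolding N_def G8 by (rule noise_le[OF part n \<mu> xs null])
  qed
  ultimately show ?thesis using W r1 A0 G0 by (rule risk_absorption)
qed

text \<open>Makes no assumption on cell counts: the whole of [-L, L] is one cell containing all n
  points. The price is a factor 1/\<mu>, affordable on an event of exponentially small
  probability.\<close>

lemma risk_le_crude:
  assumes basic: "(\<Sum>i<n. (H (xs i))\<^sup>2) / real n + \<mu> / 2 * energy L \<le> 2 / real n * (\<Sum>i<n. es i * H (xs i)) + b"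
    and n: "n > 0" and \<mu>: "\<mu> > 0" "\<mu> \<le> 1" and xs: "\<And>i. i < n \<Longrightarrow> xs i \<in> {- L..<L}"
  shows "risk \<le> (2 + 4 * L) / \<mu> * (4 * ((\<Sum>i<n. (es i)\<^sup>2) / real n) + 2 * b)"
proof -
  define A where "A = (\<Sum>i<n. (H (xs i))\<^sup>2) / real n"
  define B where "B = (\<Sum>i<n. (es i)\<^sup>2) / real n"
  have E0: "energy L \<ge> 0" using energy_mono[of "- L" L] L_pos energy_start by simp
  have A0: "A \<ge> 0" unfolding A_def by (intro divide_nonneg_nonneg sum_nonneg) auto
  have "2 / real n * (\<Sum>i<n. es i * H (xs i)) = (\<Sum>i<n. 2 * (es i * H (xs i))) / real n"
    by (simp add: sum_distrib_left sum_divide_distrib)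
  also have "\<dots> \<le> (\<Sum>i<n. 1/2 * (H (xs i))\<^sup>2 + 2 * (es i)\<^sup>2) / real n"
  proof (intro divide_right_mono sum_mono)
    fix i
    show "2 * (es i * H (xs i)) \<le> 1/2 * (H (xs i))\<^sup>2 + 2 * (es i)\<^sup>2"
      using zero_le_power2[of "H (xs i) - 2 * es i"] by (simp add: power2_eq_square algebra_simps)
  qed simp
  also have "\<dots> = A / 2 + 2 * B"
    by (simp add: A_def B_def sum.distrib add_divide_distrib sum_distrib_left[symmetric] sum_divide_distrib[symmetric])
  finally have "A / 2 + \<mu> / 2 * energy L \<le> 2 * B + b" using basic by (simp add: A_def)
  then have AB: "A + \<mu> * energy L \<le> 4 * B + 2 * b" by simp
  have sup: "(H x)\<^sup>2 \<le> 2 * A + 4 * L * energy L" if "x \<in> {- L..<L}" for x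
    using sq_le_average[of "{..<n}" xs "- L" L x] that n xs energy_start
    by (force simp: A_def lessThan_empty_iff)
  have "risk \<le> 2 * A + 4 * L * energy L"
    by (rule risk_le_sup[OF sup]) (use A0 E0 L_pos in auto)
  also have "\<dots> \<le> (2 + 4 * L) / \<mu> * (A + \<mu> * energy L)"
  proof -
    have "2 * A \<le> (2 + 4 * L) / \<mu> * A"
      using A0 L_pos \<mu> by (intro mult_right_mono) (auto simp: field_simps)
    moreover have "4 * L * energy L \<le> (2 + 4 * L) / \<mu> * (\<mu> * energy L)"
      using E0 L_pos \<mu> by (simp add: mult_right_mono)
    ultimately show ?thesis by (simp add: distrib_left)
  qed
  also have "\<dots> \<le> (2 + 4 * L) / \<mu> * (4 * B + 2 * b)"
    using AB L_pos \<mu> by (intro mult_left_mono) auto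
  finally show ?thesis by (simp add: B_def)
qed

end

section \<open>Probabilistic estimates\<close>

text \<open>Additivity of the variance, by integrating out the last coordinate; the cross term dies
  because the mean is 0. The nonnegative integral is chosen so that the result combines with
  Tonelli.\<close>

lemma nn_integral_PiM_sum_sq:
  fixes g :: "'a \<Rightarrow> real"
  assumes Q: "prob_space Q" and g [measurable]: "g \<in> borel_measurable Q"
    and g2: "integrable Q (\<lambda>z. (g z)\<^sup>2)" and mean: "(LINT z|Q. g z) = 0"
  shows "(\<integral>\<^sup>+\<omega>. ennreal ((\<Sum>i<n. g (\<omega> i))\<^sup>2) \<partial>PiM {..<n} (\<lambda>_. Q)) = ennreal (real n * (LINT z|Q. (g z)\<^sup>2))"
proof (induction n)
  case 0
  show ?case by (simp add: PiM_empty)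
next
  case (Suc n)
  interpret Q: prob_space Q by fact
  interpret product_sigma_finite "\<lambda>_::nat. Q" by standard
  interpret Pn: prob_space "PiM {..<n} (\<lambda>_. Q)" by (intro prob_space_PiM Q)
  have gi: "integrable Q g" using g g2 by (rule Q.square_integrable_imp_integrable)
  have ms: "(\<lambda>\<omega>. \<Sum>i<k. g (\<omega> i)) \<in> borel_measurable (PiM {..<k} (\<lambda>_. Q))" for k
  proof (rule borel_measurable_sum)
    fix i assume "i \<in> {..<k}"
    then have "(\<lambda>\<omega>. \<omega> i) \<in> PiM {..<k} (\<lambda>_. Q) \<rightarrow>\<^sub>M Q" by (rule measurable_component_singleton)
    then show "(\<lambda>\<omega>. g (\<omega> i)) \<in> borel_measurable (PiM {..<k} (\<lambda>_. Q))" by (rule measurable_compose[OF _ g])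
  qed
  define v where "v = (LINT z|Q. (g z)\<^sup>2)"
  have v0: "v \<ge> 0" by (simp add: v_def)
  have inner: "(\<integral>\<^sup>+z. ennreal ((s + g z)\<^sup>2) \<partial>Q) = ennreal (s\<^sup>2 + v)" for s :: real
  proof -
    have eq: "(s + g z)\<^sup>2 = (s\<^sup>2 + 2 * s * g z) + (g z)\<^sup>2" for z by (simp add: power2_sum)
    have "(\<integral>\<^sup>+z. ennreal ((s + g z)\<^sup>2) \<partial>Q) = ennreal (LINT z|Q. (s + g z)\<^sup>2)"
    proof (rule nn_integral_eq_integral)
      show "integrable Q (\<lambda>z. (s + g z)\<^sup>2)" unfolding eq using gi g2 by simp
    qed simp
    also have "(LINT z|Q. (s + g z)\<^sup>2) = s\<^sup>2 + v"
      unfolding eq using gi g2 mean by (simp add: v_def Q.prob_space)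
    finally show ?thesis .
  qed
  let ?f = "\<lambda>\<omega>. ennreal ((\<Sum>i<Suc n. g (\<omega> i))\<^sup>2)"
  have "?f \<in> borel_measurable (PiM (insert n {..<n}) (\<lambda>_. Q))"
    using ms[of "Suc n"] unfolding lessThan_Suc by measurable
  then have "(\<integral>\<^sup>+\<omega>. ?f \<omega> \<partial>PiM {..<Suc n} (\<lambda>_. Q))
      = (\<integral>\<^sup>+x. (\<integral>\<^sup>+y. ?f (x(n := y)) \<partial>Q) \<partial>PiM {..<n} (\<lambda>_. Q))"
    unfolding lessThan_Suc[of n] by (intro product_nn_integral_insert) auto
  also have "\<dots> = (\<integral>\<^sup>+x. ennreal ((\<Sum>i<n. g (x i))\<^sup>2) + ennreal v \<partial>PiM {..<n} (\<lambda>_. Q))"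
  proof (intro nn_integral_cong)
    fix x
    have "?f (x(n := y)) = ennreal (((\<Sum>i<n. g (x i)) + g y)\<^sup>2)" for y by simp
    then show "(\<integral>\<^sup>+y. ?f (x(n := y)) \<partial>Q) = ennreal ((\<Sum>i<n. g (x i))\<^sup>2) + ennreal v"
      by (simp only: inner) (simp add: v0)
  qed
  also have "\<dots> = ennreal (real n * v) + ennreal v"
    using ms[of n] Suc.IH by (subst nn_integral_add) (auto simp: v_def Pn.emeasure_space_1)
  also have "\<dots> = ennreal (real (Suc n) * v)"
    using v0 by (simp add: ennreal_plus[symmetric] algebra_simps del: ennreal_plus)
  finally show ?case by (simp add: v_def)
qed

text \<open>Chernoff bound with parameter 1. With p the mass of \<open>A\<close>, the expectation of
  exp(-1_A) is 1 - (1 - 1/e) p \<le> 1 - p/2 \<le> exp(-p/2); by independence and Markov the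
  threshold n p / 4 leaves exp(n p / 4 - n p / 2).\<close>

lemma empirical_count_lower_tail:
  assumes Q: "prob_space Q" and A [measurable]: "A \<in> sets Q"
  shows "emeasure (PiM {..<n} (\<lambda>_. Q))
      {\<omega> \<in> space (PiM {..<n} (\<lambda>_. Q)). (\<Sum>i<n. indicat_real A (\<omega> i)) < real n * measure Q A / 4}
    \<le> ennreal (exp (- (real n * measure Q A / 4)))"
proof -
  interpret Q: prob_space Q by fact
  interpret product_sigma_finite "\<lambda>_::nat. Q" by standard
  let ?PM = "PiM {..<n} (\<lambda>_::nat. Q)"
  define p where "p = measure Q A"
  define S where "S = {\<omega> \<in> space ?PM. (\<Sum>i<n. indicat_real A (\<omega> i)) < real n * p / 4}"
  have "(\<lambda>\<omega>. \<Sum>i<n. indicat_real A (\<omega> i)) \<in> borel_measurable ?PM"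
    by (intro borel_measurable_sum measurable_compose[OF measurable_component_singleton]) auto
  then have S: "S \<in> sets ?PM" unfolding S_def by measurable
  have p1: "0 \<le> p" "p \<le> 1" by (auto simp: p_def)
  have e2: "exp (-1) \<le> (1/2 :: real)"
    using exp_ge_add_one_self[of 1] by (simp add: exp_minus field_simps)
  have one: "(\<integral>\<^sup>+z. ennreal (exp (- indicat_real A z)) \<partial>Q) \<le> ennreal (exp (- (p / 2)))"
  proof -
    have eq: "exp (- indicat_real A z) = 1 - (1 - exp (-1)) * indicator A z" for z
      by (simp add: indicator_def)
    have "(\<integral>\<^sup>+z. ennreal (exp (- indicat_real A z)) \<partial>Q) = ennreal (LINT z|Q. exp (- indicat_real A z))"
      by (rule nn_integral_eq_integral) (auto intro!: Q.integrable_const_bound[where B = 1])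
    also have "(LINT z|Q. exp (- indicat_real A z)) = 1 - (1 - exp (-1)) * p"
      unfolding eq by (subst Bochner_Integration.integral_diff)
        (auto simp: p_def Q.prob_space Q.emeasure_eq_measure intro!: integrable_real_indicator)
    also have "\<dots> \<le> 1 + (- (p / 2))"
      using mult_right_mono[OF e2 p1(1)] by (simp add: algebra_simps)
    also have "\<dots> \<le> exp (- (p / 2))" by (rule exp_ge_add_one_self)
    finally show ?thesis by (simp add: ennreal_leI)
  qed
  have "emeasure ?PM S = (\<integral>\<^sup>+\<omega>. indicator S \<omega> \<partial>?PM)" using S by simp
  also have "\<dots> \<le> (\<integral>\<^sup>+\<omega>. ennreal (exp (real n * p / 4)) * (\<Prod>i<n. ennreal (exp (- indicat_real A (\<omega> i)))) \<partial>?PM)"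
  proof (rule nn_integral_mono)
    fix \<omega>
    have "1 \<le> exp (real n * p / 4) * exp (- (\<Sum>i<n. indicat_real A (\<omega> i)))" if "\<omega> \<in> S"
      unfolding exp_add[symmetric] using that by (simp add: S_def)
    moreover have "exp (- (\<Sum>i<n. indicat_real A (\<omega> i))) = (\<Prod>i<n. exp (- indicat_real A (\<omega> i)))"
      by (simp add: exp_sum[symmetric] sum_negf)
    ultimately show "indicator S \<omega> \<le> ennreal (exp (real n * p / 4)) * (\<Prod>i<n. ennreal (exp (- indicat_real A (\<omega> i))))"
      by (auto simp: indicator_def prod_ennreal ennreal_mult[symmetric] prod_nonneg ennreal_leI
          simp flip: ennreal_1 split: if_splits)
  qed
  also have "\<dots> = ennreal (exp (real n * p / 4)) * (\<integral>\<^sup>+\<omega>. (\<Prod>i<n. ennreal (exp (- indicat_real A (\<omega> i)))) \<partial>?PM)"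
    by (rule nn_integral_cmult)
      (intro borel_measurable_prod_ennreal measurable_compose[OF measurable_component_singleton], auto)
  also have "(\<integral>\<^sup>+\<omega>. (\<Prod>i<n. ennreal (exp (- indicat_real A (\<omega> i)))) \<partial>?PM)
      = (\<Prod>i<n. \<integral>\<^sup>+z. ennreal (exp (- indicat_real A z)) \<partial>Q)"
    by (rule product_nn_integral_prod) auto
  also have "\<dots> \<le> (\<Prod>i<n. ennreal (exp (- (p / 2))))"
    using power_mono_ennreal[OF one] by simp
  also have "\<dots> = ennreal (exp (- (real n * p / 2)))"
    by (simp add: ennreal_power exp_of_nat_mult[symmetric])
  finally have "emeasure ?PM S \<le> ennreal (exp (real n * p / 4)) * ennreal (exp (- (real n * p / 2)))"
    by (simp add: mult_left_mono)
  also have "\<dots> = ennreal (exp (- (real n * p / 4)))"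
    by (simp add: ennreal_mult[symmetric] exp_add[symmetric])
  finally show ?thesis by (simp add: S_def p_def)
qed

text \<open>Without atoms the distribution function is continuous, and the intermediate value
  theorem yields points of level k/r.\<close>

lemma quantile_cells:
  assumes P: "prob_space P" "sets P = sets borel" and L: "L > 0" and r: "r > 0"
    and supp: "AE x in P. x \<in> {- L..L}" and atom: "\<And>a. measure P {a} = 0"
  obtains q where "cell_partition L q r" "\<And>k. k < r \<Longrightarrow> measure P {q k..<q (Suc k)} = 1 / real r"
proof -
  interpret prob_space P by fact
  have sp: "space P = UNIV" using P(2) by (metis sets_eq_imp_space_eq space_borel)
  interpret real_distribution P by standard (use P(2) sp in auto)
  have ne: "AE x in P. x \<noteq> a" for a
    using atom[of a] by (subst AE_iff_measurable[of "{a}"]) (auto simp: P(2) sp emeasure_eq_measure)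
  have cont: "continuous_on A (cdf P)" for A
    by (intro continuous_at_imp_continuous_on ballI) (simp add: isCont_cdf atom)
  have c0: "cdf P (- L) = 0"
    unfolding cdf_def by (subst prob_eq_0) (use supp ne[of "- L"] in \<open>auto simp: P(2)\<close>)
  have c1: "cdf P L = 1"
    unfolding cdf_def by (subst prob_eq_1) (use supp in \<open>auto simp: P(2)\<close>)
  have "\<exists>x. - L \<le> x \<and> x \<le> L \<and> cdf P x = real k / real r" if "k \<le> r" for k
    by (rule IVT'[of "cdf P"]) (use that r L c0 c1 cont in auto)
  then obtain q' where q': "\<And>k. k \<le> r \<Longrightarrow> - L \<le> q' k \<and> q' k \<le> L \<and> cdf P (q' k) = real k / real r"
    by metis
  \<comment> \<open>The distribution function may be flat near the ends, so the points found for
    levels 0 and 1 need not be -L and L; they are replaced.\<close>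
  define q where "q k = (if k = 0 then - L else if k = r then L else q' k)" for k
  have qc: "cdf P (q k) = real k / real r" "- L \<le> q k" "q k \<le> L" if "k \<le> r" for k
    using q'[OF that] c0 c1 r L by (auto simp: q_def)
  have mono: "q k < q (Suc k)" if "k < r" for k
  proof (rule ccontr)
    assume "\<not> q k < q (Suc k)"
    then have "cdf P (q (Suc k)) \<le> cdf P (q k)" by (intro cdf_nondecreasing) simp
    then show False using qc(1)[of k] qc(1)[of "Suc k"] that r by (simp add: divide_le_cancel)
  qed
  show thesis
  proof
    show "cell_partition L q r"
      by standard (use mono r in \<open>auto simp: q_def less_imp_le\<close>)
    fix k assume k: "k < r"
    \<comment> \<open>Cells are closed on the left, while increments of \<open>cdf\<close> belong to
      intervals closed on the right.\<close>
    have "measure P {q k..<q (Suc k)} = measure P {q k<..q (Suc k)}"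
    proof (rule measure_eq_AE)
      show "AE x in P. (x \<in> {q k..<q (Suc k)}) = (x \<in> {q k<..q (Suc k)})"
        using ne[of "q k"] ne[of "q (Suc k)"] by eventually_elim auto
    qed (auto simp: P(2))
    also have "\<dots> = cdf P (q (Suc k)) - cdf P (q k)"
      using cdf_diff_eq[OF mono[OF k]] by simp
    also have "\<dots> = 1 / real r" using qc(1)[of k] qc(1)[of "Suc k"] k by (simp add: diff_divide_distrib[symmetric])
    finally show "measure P {q k..<q (Suc k)} = 1 / real r" .
  qed
qed

lemma uniform_cells:
  assumes "L > 0" "m > 0"
  shows "cell_partition L (\<lambda>j. - L + 2 * L / real m * real j) m"
    and "(- L + 2 * L / real m * real (Suc j)) - (- L + 2 * L / real m * real j) = 2 * L / real m"
  using assms by (auto simp: cell_partition_def field_simps)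

section \<open>Moments of the noise and the expected noise size\<close>

text \<open>\<open>Q\<close> is the law of the pair (X, \<epsilon>), not of (X, Y): the first
  coordinate is the design point, the second the noise, and conditioning on X is conditioning on the
  sigma-algebra generated by \<open>fst\<close>.\<close>

locale noisy_design =
  fixes L \<kappa> \<sigma> M :: real and Q :: "(real \<times> real) measure" and p :: "real \<Rightarrow> ennreal"
  assumes L_pos: "L > 0" and \<kappa>_pos: "\<kappa> > 0" and Q_prob: "prob_space Q" and Q_sets: "sets Q = sets borel"
    and dens: "distributed Q lborel fst p" and dens_le: "AE x in lborel. p x \<le> ennreal \<kappa>"
    and supp: "AE z in Q. fst z \<in> {- L..L}" and \<sigma>_pos: "\<sigma> > 0" and M_pos: "M > 0"
    and moments: "\<And>l::nat. AE z in Q.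
        nn_cond_exp Q (vimage_algebra (space Q) fst borel) (\<lambda>w. ennreal (\<bar>snd w\<bar> ^ l)) z
          \<le> ennreal (1/2 * fact l * \<sigma>\<^sup>2 * M powr (real l - 2))"
    and centered: "AE z in Q. real_cond_exp Q (vimage_algebra (space Q) fst borel) snd z = 0"
begin

sublocale Q: prob_space Q by (rule Q_prob)

definition P :: "real measure" where "P = distr Q lborel fst"

lemma fst_measurable [measurable]: "fst \<in> borel_measurable Q"
  by (subst measurable_cong_sets[OF Q_sets refl]) (intro borel_measurable_continuous_onI continuous_intros)

lemma snd_measurable [measurable]: "snd \<in> borel_measurable Q"
  by (subst measurable_cong_sets[OF Q_sets refl]) (intro borel_measurable_continuous_onI continuous_intros)

lemma space_Q: "space Q = UNIV"
  using Q_sets by (metis sets_eq_imp_space_eq space_borel)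

lemma P_sets: "sets P = sets borel" by (simp add: P_def)

lemma P_density: "P = density lborel p"
  using dens by (simp add: P_def distributed_distr_eq_density)

lemma P_prob: "prob_space P"
  unfolding P_def by (rule Q.prob_space_distr) simp

sublocale P: prob_space P by (rule P_prob)

lemma measure_P: "B \<in> sets borel \<Longrightarrow> measure P B = measure Q {z. fst z \<in> B}"
  unfolding P_def by (subst measure_distr) (auto simp: space_Q vimage_def)

lemma emeasure_P: "B \<in> sets borel \<Longrightarrow> emeasure P B = (\<integral>\<^sup>+z. indicator B (fst z) \<partial>Q)"
  proof -
  assume B: "B \<in> sets borel"
  have "emeasure P B = (\<integral>\<^sup>+x. indicator B x \<partial>P)" using B by (simp add: P_sets)
  also have "\<dots> = (\<integral>\<^sup>+z. indicator B (fst z) \<partial>Q)"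
    unfolding P_def using B by (subst nn_integral_distr) auto
  finally show ?thesis .
qed

lemma AE_P_of_lborel: "AE x in lborel. R x \<Longrightarrow> AE x in P. R x"
  unfolding P_density using dens by (subst AE_density) (auto simp: distributed_def)

lemma AE_Q_of_P: "AE x in P. R x \<Longrightarrow> AE z in Q. R (fst z)"
  unfolding P_def by (rule AE_distrD) auto

lemma P_atomless: "measure P {a} = 0"
proof -
  have "AE x in P. x \<noteq> a" by (rule AE_P_of_lborel[OF AE_lborel_singleton])
  then show ?thesis by (subst P.prob_eq_0) (auto simp: P_sets)
qed

lemma P_supp: "AE x in P. x \<in> {- L..<L}"
proof -
  have "AE x in P. x \<in> {- L..L}"
    unfolding P_def using supp by (subst AE_distr_iff) auto
  moreover have "AE x in P. x \<noteq> L" by (rule AE_P_of_lborel[OF AE_lborel_singleton])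
  ultimately show ?thesis by eventually_elim auto
qed

lemma measure_P_interval_le:
  assumes "a \<le> b"
  shows "measure P {a..<b} \<le> \<kappa> * (b - a)"
proof -
  have [measurable]: "p \<in> borel_measurable borel" using dens by (simp add: distributed_def)
  have "emeasure P {a..<b} = (\<integral>\<^sup>+x. p x * indicator {a..<b} x \<partial>lborel)"
    unfolding P_density by (subst emeasure_density) auto
  also have "\<dots> \<le> (\<integral>\<^sup>+x. ennreal \<kappa> * indicator {a..<b} x \<partial>lborel)"
    using dens_le by (intro nn_integral_mono_AE) (auto elim!: eventually_mono intro: mult_right_mono)
  also have "\<dots> = ennreal \<kappa> * ennreal (b - a)"
    using assms by (simp add: nn_integral_cmult)
  also have "\<dots> = ennreal (\<kappa> * (b - a))" using \<kappa>_pos assms by (simp add: ennreal_mult)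
  finally show ?thesis
    using \<kappa>_pos assms by (simp add: P.emeasure_eq_measure)
qed

abbreviation FX :: "(real \<times> real) measure" where "FX \<equiv> vimage_algebra (space Q) fst borel"

lemma FX_subalgebra: "subalgebra Q FX"
  unfolding subalgebra_def
proof
  show "sets FX \<subseteq> sets Q"
    by (subst sets_vimage_algebra2) (auto intro: measurable_sets[OF fst_measurable])
qed simp

sublocale FX: finite_measure_subalgebra Q FX
  by standard (rule FX_subalgebra)

text \<open>Indicators of events in X are the test functions that define the conditional
  expectation, so the conditional bound integrates to one localised on \<open>B\<close>. It serves
  with l = 2 for variances and with l = 4 for the exceptional event.\<close>

lemma noise_moment_le:
  assumes B: "B \<in> sets borel"
  shows "(\<integral>\<^sup>+z. indicator B (fst z) * ennreal (\<bar>snd z\<bar> ^ l) \<partial>Q)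
      \<le> ennreal (1/2 * fact l * \<sigma>\<^sup>2 * M powr (real l - 2)) * emeasure P B"
proof -
  let ?g = "\<lambda>w::real \<times> real. ennreal (\<bar>snd w\<bar> ^ l)" and ?c = "ennreal (1/2 * fact l * \<sigma>\<^sup>2 * M powr (real l - 2))"
  have "fst \<in> FX \<rightarrow>\<^sub>M borel" by (rule measurable_vimage_algebra1) simp
  then have f: "(\<lambda>z. indicator B (fst z) :: ennreal) \<in> borel_measurable FX"
    by (rule measurable_compose) (use B in simp)
  have "(\<integral>\<^sup>+z. indicator B (fst z) * ?g z \<partial>Q) = (\<integral>\<^sup>+z. indicator B (fst z) * nn_cond_exp Q FX ?g z \<partial>Q)"
    by (rule FX.nn_cond_exp_intg[symmetric]) (use f in auto)
  also have "\<dots> \<le> (\<integral>\<^sup>+z. ?c * indicator B (fst z) \<partial>Q)"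
    using moments[of l] by (intro nn_integral_mono_AE) (auto elim!: eventually_mono simp: indicator_def)
  also have "\<dots> = ?c * emeasure P B"
    using B by (subst nn_integral_cmult) (auto simp: emeasure_P)
  finally show ?thesis .
qed

lemma snd_sq_integrable: "integrable Q (\<lambda>z. (snd z)\<^sup>2)"
proof (rule integrableI_bounded)
  have "(\<integral>\<^sup>+z. ennreal (norm ((snd z)\<^sup>2)) \<partial>Q) = (\<integral>\<^sup>+z. indicator UNIV (fst z) * ennreal (\<bar>snd z\<bar> ^ 2) \<partial>Q)"
    by simp
  also have "\<dots> < \<infinity>"
    using noise_moment_le[of UNIV 2] by (rule le_less_trans) (auto simp: ennreal_mult_less_top P.emeasure_eq_measure)
  finally show "(\<integral>\<^sup>+z. ennreal (norm ((snd z)\<^sup>2)) \<partial>Q) < \<infinity>" .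
qed measurable

lemma noise_centered:
  assumes B: "B \<in> sets borel"
  shows "(LINT z|Q. snd z * indicator B (fst z)) = 0"
proof -
  have i: "integrable Q snd"
    by (rule Q.square_integrable_imp_integrable[OF snd_measurable snd_sq_integrable])
  let ?A = "fst -` B \<inter> space Q"
  have A: "?A \<in> sets FX" using B by (rule in_vimage_algebra)
  have "(LINT z|Q. snd z * indicator B (fst z)) = (LINT z:?A|Q. snd z)"
    unfolding set_lebesgue_integral_def by (intro Bochner_Integration.integral_cong) (auto simp: indicator_def)
  also have "\<dots> = (LINT z:?A|Q. real_cond_exp Q FX snd z)"
    by (rule FX.real_cond_exp_intA[OF i A])
  also have "\<dots> = 0"
    unfolding set_lebesgue_integral_def using centered
    by (intro integral_eq_zero_AE) (auto elim!: eventually_mono)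
  finally show ?thesis .
qed

text \<open>For l = 2 the moment constant is (1/2) 2! \<sigma>^2 M^0 = \<sigma>^2. The factor
  \<open>measure P B\<close> is the point: a small cell has a proportionally small variance.\<close>

lemma noise_sum_sq_le:
  assumes B [measurable]: "B \<in> sets borel"
  shows "(\<integral>\<^sup>+\<omega>. ennreal ((\<Sum>i<n. snd (\<omega> i) * indicator B (fst (\<omega> i)))\<^sup>2) \<partial>PiM {..<n} (\<lambda>_. Q))
      \<le> ennreal (real n * \<sigma>\<^sup>2 * measure P B)"
proof -
  let ?g = "\<lambda>z::real \<times> real. snd z * indicat_real B (fst z)"
  have gm: "?g \<in> borel_measurable Q" by measurable
  have g2: "integrable Q (\<lambda>z. (?g z)\<^sup>2)"
    by (rule Bochner_Integration.integrable_bound[OF snd_sq_integrable]) (auto simp: indicator_def)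
  have "ennreal (LINT z|Q. (?g z)\<^sup>2) = (\<integral>\<^sup>+z. ennreal ((?g z)\<^sup>2) \<partial>Q)"
    using g2 by (intro nn_integral_eq_integral[symmetric]) auto
  also have "\<dots> = (\<integral>\<^sup>+z. indicator B (fst z) * ennreal (\<bar>snd z\<bar> ^ 2) \<partial>Q)"
    by (intro nn_integral_cong) (auto simp: indicator_def)
  also have "\<dots> \<le> ennreal (1/2 * fact 2 * \<sigma>\<^sup>2 * M powr (real 2 - 2)) * emeasure P B"
    by (rule noise_moment_le[OF B])
  also have "\<dots> = ennreal (\<sigma>\<^sup>2 * measure P B)"
    using M_pos by (simp add: P.emeasure_eq_measure ennreal_mult fact_numeral)
  finally have v: "(LINT z|Q. (?g z)\<^sup>2) \<le> \<sigma>\<^sup>2 * measure P B" by (simp add: ennreal_le_iff)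
  have "(\<integral>\<^sup>+\<omega>. ennreal ((\<Sum>i<n. ?g (\<omega> i))\<^sup>2) \<partial>PiM {..<n} (\<lambda>_. Q)) = ennreal (real n * (LINT z|Q. (?g z)\<^sup>2))"
    by (rule nn_integral_PiM_sum_sq[OF Q_prob gm g2 noise_centered[OF B]])
  also have "\<dots> \<le> ennreal (real n * \<sigma>\<^sup>2 * measure P B)"
    using v by (intro ennreal_leI) (simp add: mult_left_mono mult.assoc)
  finally show ?thesis .
qed

lemma component_measurable:
  "i < n \<Longrightarrow> (\<lambda>\<omega>. fst (\<omega> i)) \<in> borel_measurable (PiM {..<n} (\<lambda>_. Q))"
  "i < n \<Longrightarrow> (\<lambda>\<omega>. snd (\<omega> i)) \<in> borel_measurable (PiM {..<n} (\<lambda>_. Q))"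
  by (auto intro!: measurable_compose[OF measurable_component_singleton])

lemma AE_PiM_all:
  fixes n :: nat
  assumes "AE z in Q. R z"
  shows "AE \<omega> in PiM {..<n} (\<lambda>_. Q). \<forall>i<n. R (\<omega> i)"
proof -
  have "AE \<omega> in PiM {..<n} (\<lambda>_. Q). \<forall>i\<in>{..<n}. R (\<omega> i)"
    by (rule eventually_ball_finite) (use AE_PiM_component[of "{..<n}" "\<lambda>_. Q"] Q_prob assms in auto)
  then show ?thesis by eventually_elim auto
qed

end

text \<open>For fixed \<open>t\<close> the kernel selects the points beyond \<open>t\<close> in the
  cell of \<open>t\<close>, or nothing if \<open>t\<close> lies in no cell. Its noise sum therefore
  has at most the variance allowed for a single cell.\<close>

lemma (in cell_partition) cell_kernel_indicator:
  obtains B where "B \<in> sets borel" "\<And>x. cell_kernel q m t x = indicator B x"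
    "B = {} \<or> (\<exists>j<m. B \<subseteq> {q j..<q (Suc j)})"
proof (cases "t \<in> {- L..<L}")
  case True
  then obtain j where j: "j < m" "t \<in> {q j..<q (Suc j)}" by (rule cell_obtain)
  have "cell_kernel q m t x = indicator ({q j..<q (Suc j)} \<inter> {t<..}) x" for x
  proof -
    have "cell_kernel q m t x = (\<Sum>k<m. indicator {q k..<q (Suc k)} t * (indicator {q k..<q (Suc k)} x * (if t < x then 1 else 0)))"
      unfolding cell_kernel_def by (intro sum.cong refl) simp
    also have "\<dots> = indicator {q j..<q (Suc j)} x * (if t < x then 1 else 0)"
      by (rule cells_sum_select[OF j])
    also have "\<dots> = indicator ({q j..<q (Suc j)} \<inter> {t<..}) x" by (auto simp: indicator_def)
    finally show ?thesis .
  qed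
  then show thesis using j by (intro that[of "{q j..<q (Suc j)} \<inter> {t<..}"]) auto
next
  case False
  have "cell_kernel q m t x = 0" for x
    unfolding cell_kernel_def
  proof (rule sum.neutral, rule ballI)
    fix k assume "k \<in> {..<m}"
    then have "t \<notin> {q k..<q (Suc k)}" using cell_subset[of k] False by blast
    then show "indicator {q k..<q (Suc k)} t * indicator {q k..<q (Suc k)} x * (if t < x then 1 else 0) = (0::real)"
      by (simp add: indicator_eq_0_iff del: atLeastLessThan_iff)
  qed
  then show thesis using that[of "{}"] by simp
qed

context noisy_design
begin

lemma noise_size_nonneg: "\<mu> > 0 \<Longrightarrow> 0 \<le> noise_size L P q m \<mu> n xs es"
  unfolding noise_size_def set_lebesgue_integral_def
  by (intro add_nonneg_nonneg mult_nonneg_nonneg sum_nonneg divide_nonneg_nonneg Bochner_Integration.integral_nonneg) auto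

text \<open>In the first sum the mass cancels: a cell has variance at most n \<sigma>^2 times its
  mass, divided by that mass, so the expectation just counts cells. In the second, Tonelli reduces
  to a fixed t, where the variance is at most n \<sigma>^2 \<kappa> \<Delta>, integrated over length
  2L.\<close>

lemma noise_size_expectation:
  fixes n m :: nat and q :: "nat \<Rightarrow> real"
  assumes part: "cell_partition L q m" and \<Delta>: "\<And>j. j < m \<Longrightarrow> q (Suc j) - q j = \<Delta>" "0 \<le> \<Delta>"
    and n: "n > 0" and \<mu>: "\<mu> > 0"
  defines "N \<equiv> \<lambda>\<omega>. ennreal (noise_size L P q m \<mu> n (\<lambda>i. fst (\<omega> i)) (\<lambda>i. snd (\<omega> i)))"
  shows "N \<in> borel_measurable (PiM {..<n} (\<lambda>_. Q))"
    and "(\<integral>\<^sup>+\<omega>. N \<omega> \<partial>PiM {..<n} (\<lambda>_. Q))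
      \<le> ennreal (72 * \<sigma>\<^sup>2 * real m / real n + 16 * L * \<kappa> * \<Delta> * \<sigma>\<^sup>2 / (\<mu> * real n))"
proof -
  interpret cell_partition L q m by fact
  let ?PM = "PiM {..<n} (\<lambda>_::nat. Q)"
  interpret PM: prob_space ?PM by (intro prob_space_PiM Q_prob)
  define S where "S j \<omega> = (\<Sum>i<n. snd (\<omega> i) * indicator {q j..<q (Suc j)} (fst (\<omega> i)))" for j and \<omega> :: "nat \<Rightarrow> real \<times> real"
  define T where "T t \<omega> = (\<Sum>i<n. snd (\<omega> i) * cell_kernel q m t (fst (\<omega> i)))" for t and \<omega> :: "nat \<Rightarrow> real \<times> real"
  define c1 where "c1 = 72 / (real n)\<^sup>2"
  define c2 where "c2 = 8 / (\<mu> * (real n)\<^sup>2)"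
  have c0: "c1 \<ge> 0" "c2 \<ge> 0" using \<mu> by (auto simp: c1_def c2_def)
  have mass: "measure P {q j..<q (Suc j)} \<le> \<kappa> * \<Delta>" if "j < m" for j
    using measure_P_interval_le[OF q_mono[OF that]] \<Delta>(1)[OF that] by simp
  have Sm: "S j \<in> borel_measurable ?PM" for j
    unfolding S_def
  proof (rule borel_measurable_sum)
    fix i assume "i \<in> {..<n}"
    then have [measurable]: "(\<lambda>\<omega>. fst (\<omega> i)) \<in> borel_measurable ?PM" "(\<lambda>\<omega>. snd (\<omega> i)) \<in> borel_measurable ?PM"
      by (auto intro: component_measurable)
    show "(\<lambda>\<omega>. snd (\<omega> i) * indicator {q j..<q (Suc j)} (fst (\<omega> i))) \<in> borel_measurable ?PM"
      by measurable
  qed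
  have TM: "(\<lambda>z. T (snd z) (fst z)) \<in> borel_measurable (?PM \<Otimes>\<^sub>M lborel)"
    unfolding T_def
  proof (rule borel_measurable_sum)
    fix i assume "i \<in> {..<n}"
    then have [measurable]: "(\<lambda>\<omega>. fst (\<omega> i)) \<in> borel_measurable ?PM" "(\<lambda>\<omega>. snd (\<omega> i)) \<in> borel_measurable ?PM"
      by (auto intro: component_measurable)
    show "(\<lambda>z. snd (fst z i) * cell_kernel q m (snd z) (fst (fst z i))) \<in> borel_measurable (?PM \<Otimes>\<^sub>M lborel)"
      by measurable
  qed
  have kb: "\<bar>cell_kernel q m t x\<bar> \<le> 1" for t x
    by (rule cell_kernel_indicator[of t]) (simp add: indicator_def)
  have Ti: "ennreal (LINT t:{- L..L}|lborel. (T t \<omega>)\<^sup>2) = (\<integral>\<^sup>+t. indicator {- L..L} t * ennreal ((T t \<omega>)\<^sup>2) \<partial>lborel)" for \<omega>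
  proof -
    define K where "K = (\<Sum>i<n. \<bar>snd (\<omega> i)\<bar>)"
    have Tb: "\<bar>T t \<omega>\<bar> \<le> K" for t
      unfolding T_def K_def
    proof (rule order_trans[OF sum_abs sum_mono])
      fix i
      show "\<bar>snd (\<omega> i) * cell_kernel q m t (fst (\<omega> i))\<bar> \<le> \<bar>snd (\<omega> i)\<bar>"
        using kb[of t "fst (\<omega> i)"] by (simp add: abs_mult mult_left_le)
    qed
    have [measurable]: "(\<lambda>t. T t \<omega>) \<in> borel_measurable borel" unfolding T_def by measurable
    have "set_integrable lborel {- L..L} (\<lambda>_. K\<^sup>2)"
      by (intro borel_integrable_atLeastAtMost' continuous_intros)
    then have "set_integrable lborel {- L..L} (\<lambda>t. (T t \<omega>)\<^sup>2)"
    proof (rule set_integrable_bound)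
      show "set_borel_measurable lborel {- L..L} (\<lambda>t. (T t \<omega>)\<^sup>2)"
        unfolding set_borel_measurable_def by measurable
      show "AE t in lborel. t \<in> {- L..L} \<longrightarrow> norm ((T t \<omega>)\<^sup>2) \<le> norm (K\<^sup>2)"
      proof (intro AE_I2 impI)
        fix t
        have "\<bar>T t \<omega>\<bar>\<^sup>2 \<le> K\<^sup>2" by (rule power_mono[OF Tb]) simp
        then show "norm ((T t \<omega>)\<^sup>2) \<le> norm (K\<^sup>2)" by simp
      qed
    qed
    then have "(\<integral>\<^sup>+t. ennreal (indicator {- L..L} t *\<^sub>R (T t \<omega>)\<^sup>2) \<partial>lborel) = ennreal (LINT t:{- L..L}|lborel. (T t \<omega>)\<^sup>2)"
      unfolding set_integrable_def set_lebesgue_integral_def by (rule nn_integral_eq_integral) simp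
    then show ?thesis
      by (simp add: ennreal_mult' ennreal_indicator)
  qed
  \<comment> \<open>Division by 0 gives 0 in the reals, but infinity in \<open>ennreal\<close> when
    the numerator is positive; the last factor restores 0, as infinity times 0 is 0.\<close>
  have Neq: "N \<omega> = ennreal c1 * (\<Sum>j<m. ennreal ((S j \<omega>)\<^sup>2) / ennreal (measure P {q j..<q (Suc j)}) * (if measure P {q j..<q (Suc j)} = 0 then 0 else 1))
      + ennreal c2 * (\<integral>\<^sup>+t. indicator {- L..L} t * ennreal ((T t \<omega>)\<^sup>2) \<partial>lborel)" for \<omega>
  proof -
    have a: "(\<Sum>j<m. ennreal ((S j \<omega>)\<^sup>2) / ennreal (measure P {q j..<q (Suc j)}) * (if measure P {q j..<q (Suc j)} = 0 then 0 else 1))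
        = ennreal (\<Sum>j<m. (S j \<omega>)\<^sup>2 / measure P {q j..<q (Suc j)})"
    proof -
      have "ennreal ((S j \<omega>)\<^sup>2) / ennreal (measure P {q j..<q (Suc j)}) * (if measure P {q j..<q (Suc j)} = 0 then 0 else 1)
          = ennreal ((S j \<omega>)\<^sup>2 / measure P {q j..<q (Suc j)})" for j
        by (cases "measure P {q j..<q (Suc j)} = 0") (auto simp: divide_ennreal zero_less_measure_iff)
      then show ?thesis by (simp add: sum_ennreal)
    qed
    have nn: "0 \<le> (LINT t:{- L..L}|lborel. (T t \<omega>)\<^sup>2)"
      unfolding set_lebesgue_integral_def by (intro Bochner_Integration.integral_nonneg) auto
    have "N \<omega> = ennreal (c1 * (\<Sum>j<m. (S j \<omega>)\<^sup>2 / measure P {q j..<q (Suc j)}) + c2 * (LINT t:{- L..L}|lborel. (T t \<omega>)\<^sup>2))"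
      by (simp add: N_def noise_size_def c1_def c2_def S_def T_def)
    also have "\<dots> = ennreal c1 * ennreal (\<Sum>j<m. (S j \<omega>)\<^sup>2 / measure P {q j..<q (Suc j)}) + ennreal c2 * ennreal (LINT t:{- L..L}|lborel. (T t \<omega>)\<^sup>2)"
      using c0 nn by (simp add: ennreal_plus ennreal_mult sum_nonneg)
    finally show ?thesis unfolding a Ti .
  qed
  have m1: "(\<lambda>\<omega>. \<Sum>j<m. ennreal ((S j \<omega>)\<^sup>2) / ennreal (measure P {q j..<q (Suc j)}) * (if measure P {q j..<q (Suc j)} = 0 then 0 else 1)) \<in> borel_measurable ?PM"
    using Sm by measurable
  interpret pair_sigma_finite ?PM lborel ..
  have m2': "(\<lambda>(\<omega>, t). indicator {- L..L} t * ennreal ((T t \<omega>)\<^sup>2)) \<in> borel_measurable (?PM \<Otimes>\<^sub>M lborel)"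
    using TM by (simp add: case_prod_beta)
  have m2: "(\<lambda>\<omega>. \<integral>\<^sup>+t. indicator {- L..L} t * ennreal ((T t \<omega>)\<^sup>2) \<partial>lborel) \<in> borel_measurable ?PM"
    by (rule lborel.borel_measurable_nn_integral[OF m2'])
  show "N \<in> borel_measurable ?PM"
    unfolding Neq[abs_def] using m1 m2 by measurable
  have e1: "(\<integral>\<^sup>+\<omega>. ennreal ((S j \<omega>)\<^sup>2) / ennreal (measure P {q j..<q (Suc j)}) * (if measure P {q j..<q (Suc j)} = 0 then 0 else 1) \<partial>?PM) \<le> ennreal (real n * \<sigma>\<^sup>2)" for j
  proof (cases "measure P {q j..<q (Suc j)} = 0")
    case False
    then have pos: "measure P {q j..<q (Suc j)} > 0" by (simp add: zero_less_measure_iff)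
    have "(\<integral>\<^sup>+\<omega>. ennreal ((S j \<omega>)\<^sup>2) / ennreal (measure P {q j..<q (Suc j)}) \<partial>?PM)
        = (\<integral>\<^sup>+\<omega>. ennreal ((S j \<omega>)\<^sup>2) \<partial>?PM) / ennreal (measure P {q j..<q (Suc j)})"
      using Sm by (intro nn_integral_divide) measurable
    also have "\<dots> \<le> ennreal (real n * \<sigma>\<^sup>2 * measure P {q j..<q (Suc j)}) / ennreal (measure P {q j..<q (Suc j)})"
      unfolding S_def by (intro divide_right_mono_ennreal noise_sum_sq_le) simp
    also have "\<dots> = ennreal (real n * \<sigma>\<^sup>2)"
      using pos by (simp add: divide_ennreal)
    finally show ?thesis using False by simp
  qed simp
  have e2: "(\<integral>\<^sup>+\<omega>. ennreal ((T t \<omega>)\<^sup>2) \<partial>?PM) \<le> ennreal (real n * \<sigma>\<^sup>2 * (\<kappa> * \<Delta>))" for t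
  proof -
    obtain B where B: "B \<in> sets borel" "\<And>x. cell_kernel q m t x = indicator B x"
      "B = {} \<or> (\<exists>j<m. B \<subseteq> {q j..<q (Suc j)})" using cell_kernel_indicator[of t] by metis
    have "measure P B \<le> \<kappa> * \<Delta>"
      using B(3)
    proof
      assume "\<exists>j<m. B \<subseteq> {q j..<q (Suc j)}"
      then obtain j where j: "j < m" "B \<subseteq> {q j..<q (Suc j)}" by blast
      have "measure P B \<le> measure P {q j..<q (Suc j)}"
        using j(2) by (intro P.finite_measure_mono) (auto simp: P_sets)
      then show ?thesis using mass[OF j(1)] by simp
    qed (use \<kappa>_pos \<Delta> in simp)
    moreover have "(\<integral>\<^sup>+\<omega>. ennreal ((T t \<omega>)\<^sup>2) \<partial>?PM) \<le> ennreal (real n * \<sigma>\<^sup>2 * measure P B)"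
      unfolding T_def B(2) by (rule noise_sum_sq_le[OF B(1)])
    ultimately show ?thesis
      by (elim order_trans) (intro ennreal_leI mult_left_mono, auto)
  qed
  have mj: "(\<lambda>\<omega>. ennreal ((S j \<omega>)\<^sup>2) / ennreal (measure P {q j..<q (Suc j)}) * (if measure P {q j..<q (Suc j)} = 0 then 0 else 1)) \<in> borel_measurable ?PM" for j
    using Sm[of j] by measurable
  have "(\<integral>\<^sup>+\<omega>. (\<Sum>j<m. ennreal ((S j \<omega>)\<^sup>2) / ennreal (measure P {q j..<q (Suc j)}) * (if measure P {q j..<q (Suc j)} = 0 then 0 else 1)) \<partial>?PM) = (\<Sum>j<m. \<integral>\<^sup>+\<omega>. ennreal ((S j \<omega>)\<^sup>2) / ennreal (measure P {q j..<q (Suc j)}) * (if measure P {q j..<q (Suc j)} = 0 then 0 else 1) \<partial>?PM)"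
    by (intro nn_integral_sum mj)
  also have "\<dots> \<le> (\<Sum>j<m. ennreal (real n * \<sigma>\<^sup>2))"
    by (intro sum_mono e1)
  also have "\<dots> = ennreal (real m * (real n * \<sigma>\<^sup>2))"
    by (simp add: ennreal_mult ennreal_of_nat_eq_real_of_nat)
  finally have b1: "(\<integral>\<^sup>+\<omega>. (\<Sum>j<m. ennreal ((S j \<omega>)\<^sup>2) / ennreal (measure P {q j..<q (Suc j)}) * (if measure P {q j..<q (Suc j)} = 0 then 0 else 1)) \<partial>?PM) \<le> ennreal (real m * (real n * \<sigma>\<^sup>2))" .
  have "(\<integral>\<^sup>+\<omega>. (\<integral>\<^sup>+t. indicator {- L..L} t * ennreal ((T t \<omega>)\<^sup>2) \<partial>lborel) \<partial>?PM)
      = (\<integral>\<^sup>+t. (\<integral>\<^sup>+\<omega>. indicator {- L..L} t * ennreal ((T t \<omega>)\<^sup>2) \<partial>?PM) \<partial>lborel)"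
    by (rule Fubini'[symmetric, OF m2'])
  also have "\<dots> \<le> (\<integral>\<^sup>+t. ennreal (real n * \<sigma>\<^sup>2 * (\<kappa> * \<Delta>)) * indicator {- L..L} t \<partial>lborel)"
  proof (rule nn_integral_mono)
    fix t
    show "(\<integral>\<^sup>+\<omega>. indicator {- L..L} t * ennreal ((T t \<omega>)\<^sup>2) \<partial>?PM) \<le> ennreal (real n * \<sigma>\<^sup>2 * (\<kappa> * \<Delta>)) * indicator {- L..L} t"
      using e2[of t] by (cases "t \<in> {- L..L}") auto
  qed
  also have "\<dots> = ennreal (real n * \<sigma>\<^sup>2 * (\<kappa> * \<Delta>)) * ennreal (2 * L)"
    using L_pos by (simp add: nn_integral_cmult)
  finally have b2: "(\<integral>\<^sup>+\<omega>. (\<integral>\<^sup>+t. indicator {- L..L} t * ennreal ((T t \<omega>)\<^sup>2) \<partial>lborel) \<partial>?PM) \<le> \<dots>" .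
  have "(\<integral>\<^sup>+\<omega>. N \<omega> \<partial>?PM) = ennreal c1 * (\<integral>\<^sup>+\<omega>. (\<Sum>j<m. ennreal ((S j \<omega>)\<^sup>2) / ennreal (measure P {q j..<q (Suc j)}) * (if measure P {q j..<q (Suc j)} = 0 then 0 else 1)) \<partial>?PM)
      + ennreal c2 * (\<integral>\<^sup>+\<omega>. (\<integral>\<^sup>+t. indicator {- L..L} t * ennreal ((T t \<omega>)\<^sup>2) \<partial>lborel) \<partial>?PM)"
    unfolding Neq using m1 m2 by (subst nn_integral_add) (auto simp: nn_integral_cmult)
  also have "\<dots> \<le> ennreal c1 * ennreal (real m * (real n * \<sigma>\<^sup>2))
      + ennreal c2 * (ennreal (real n * \<sigma>\<^sup>2 * (\<kappa> * \<Delta>)) * ennreal (2 * L))"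
    by (intro add_mono mult_left_mono b1 b2) auto
  also have "\<dots> = ennreal (c1 * (real m * (real n * \<sigma>\<^sup>2)) + c2 * (real n * \<sigma>\<^sup>2 * (\<kappa> * \<Delta>) * (2 * L)))"
    using c0 L_pos \<kappa>_pos \<Delta>(2) by (simp add: ennreal_mult ennreal_plus)
  also have "c1 * (real m * (real n * \<sigma>\<^sup>2)) + c2 * (real n * \<sigma>\<^sup>2 * (\<kappa> * \<Delta>) * (2 * L))
      = 72 * \<sigma>\<^sup>2 * real m / real n + 16 * L * \<kappa> * \<Delta> * \<sigma>\<^sup>2 / (\<mu> * real n)"
    using n \<mu> by (simp add: c1_def c2_def field_simps power2_eq_square)
  finally show "(\<integral>\<^sup>+\<omega>. N \<omega> \<partial>?PM) \<le> ennreal (72 * \<sigma>\<^sup>2 * real m / real n + 16 * L * \<kappa> * \<Delta> * \<sigma>\<^sup>2 / (\<mu> * real n))" .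
qed

lemma nn_integral_PiM_component:
  assumes "i < n" and [measurable]: "f \<in> borel_measurable Q"
  shows "(\<integral>\<^sup>+\<omega>. f (\<omega> i) \<partial>PiM {..<n} (\<lambda>_::nat. Q)) = (\<integral>\<^sup>+z. f z \<partial>Q)"
proof -
  have "distr (PiM {..<n} (\<lambda>_. Q)) Q (\<lambda>\<omega>. \<omega> i) = Q"
    using assms(1) by (intro distr_PiM_component) (auto intro: Q_prob)
  then have "(\<integral>\<^sup>+z. f z \<partial>Q) = (\<integral>\<^sup>+z. f z \<partial>distr (PiM {..<n} (\<lambda>_. Q)) Q (\<lambda>\<omega>. \<omega> i))" by simp
  also have "\<dots> = (\<integral>\<^sup>+\<omega>. f (\<omega> i) \<partial>PiM {..<n} (\<lambda>_. Q))"
    using assms(1) by (intro nn_integral_distr) auto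
  finally show ?thesis by simp
qed

lemma noise_fourth_moment: "(\<integral>\<^sup>+z. ennreal ((snd z) ^ 4) \<partial>Q) \<le> ennreal (12 * \<sigma>\<^sup>2 * M\<^sup>2)"
proof -
  have "(\<integral>\<^sup>+z. ennreal ((snd z) ^ 4) \<partial>Q) = (\<integral>\<^sup>+z. indicator UNIV (fst z) * ennreal (\<bar>snd z\<bar> ^ 4) \<partial>Q)"
    by (simp add: power_even_abs_numeral)
  also have "\<dots> \<le> ennreal (1/2 * fact 4 * \<sigma>\<^sup>2 * M powr (real 4 - 2)) * emeasure P UNIV"
    by (rule noise_moment_le) simp
  also have "emeasure P UNIV = 1" using P.emeasure_space_1 P_sets by (metis sets_eq_imp_space_eq space_borel)
  also have "1/2 * fact 4 * \<sigma>\<^sup>2 * M powr (real 4 - 2) = 12 * \<sigma>\<^sup>2 * M\<^sup>2"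
    using M_pos by (simp add: fact_numeral powr_numeral)
  finally show ?thesis by simp
qed

text \<open>The loss need not be measurable: it is dominated pointwise by a measurable function. On the event
  that some quantile cell is undersampled, the crude bound is used together with
  \<open>\<epsilon>\<^sup>2 \<le> s \<epsilon>\<^sup>4 + 1 / s\<close>, which decouples the noise from the event.\<close>

lemma expected_risk_le:
  fixes n m r :: nat and loss :: "(nat \<Rightarrow> real \<times> real) \<Rightarrow> ennreal"
  assumes n: "n > 0" and \<mu>: "0 < \<mu>" "\<mu> \<le> 1" and b: "0 \<le> b" and s: "s > 0"
    and m: "m > 0" "\<kappa> * (2 * L / real m)\<^sup>2 \<le> \<mu>" and r: "r > 0" "4 * L / real r \<le> \<mu>"
    and loss: "AE \<omega> in PiM {..<n} (\<lambda>_. Q). \<exists>H \<gamma>. primitive_on (- L) L H \<gamma> \<and>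
        set_integrable lborel {- L..L} (\<lambda>t. (\<gamma> t)\<^sup>2) \<and>
        loss \<omega> = (\<integral>\<^sup>+x. ennreal (indicator {- L..<L} x * (H x)\<^sup>2) \<partial>P) \<and>
        (\<Sum>i<n. (H (fst (\<omega> i)))\<^sup>2) / real n + \<mu> / 2 * (LINT t:{- L..L}|lborel. (\<gamma> t)\<^sup>2)
          \<le> 2 / real n * (\<Sum>i<n. snd (\<omega> i) * H (fst (\<omega> i))) + b"
  defines "\<pi> \<equiv> real r * exp (- (real n / (4 * real r)))"
  shows "(\<integral>\<^sup>+\<omega>. loss \<omega> \<partial>PiM {..<n} (\<lambda>_. Q))
    \<le> ennreal (64 * (72 * \<sigma>\<^sup>2 * real m / real n + 16 * L * \<kappa> * (2 * L / real m) * \<sigma>\<^sup>2 / (\<mu> * real n)) + 64 * b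
        + (2 + 4 * L) / \<mu> * 4 * s * (12 * \<sigma>\<^sup>2 * M\<^sup>2) + (2 + 4 * L) / \<mu> * (4 / s + 2 * b) * \<pi>)"
proof -
  let ?PM = "PiM {..<n} (\<lambda>_::nat. Q)"
  interpret PM: prob_space ?PM by (intro prob_space_PiM Q_prob)
  have "AE x in P. x \<in> {- L..L}" using P_supp by eventually_elim auto
  then obtain q' where part': "cell_partition L q' r" and mass': "\<And>k. k < r \<Longrightarrow> measure P {q' k..<q' (Suc k)} = 1 / real r"
    using quantile_cells[OF P_prob P_sets L_pos r(1) _ P_atomless] by blast
  define q where "q j = - L + 2 * L / real m * real j" for j
  have part: "cell_partition L q m" and \<Delta>: "\<And>j. q (Suc j) - q j = 2 * L / real m"
    using uniform_cells[OF L_pos m(1)] by (auto simp: q_def[abs_def] q_def)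
  interpret c: cell_partition L q m by fact
  define A where "A k = {z::real \<times> real. fst z \<in> {q' k..<q' (Suc k)}}" for k
  have A_sets: "A k \<in> sets Q" for k
    using measurable_sets[OF fst_measurable, of "{q' k..<q' (Suc k)}"] by (simp add: A_def space_Q vimage_def)
  have A_mass: "measure Q (A k) = 1 / real r" if "k < r" for k
    using mass'[OF that] measure_P[of "{q' k..<q' (Suc k)}"] by (simp add: A_def)
  define Bad_k where "Bad_k k = {\<omega> \<in> space ?PM. (\<Sum>i<n. indicat_real (A k) (\<omega> i)) < real n * measure Q (A k) / 4}" for k
  define Bad where "Bad = (\<Union>k<r. Bad_k k)"
  have Bad_k_sets: "Bad_k k \<in> sets ?PM" for k
  proof -
    have "(\<lambda>\<omega>. \<Sum>i<n. indicat_real (A k) (\<omega> i)) \<in> borel_measurable ?PM"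
      using A_sets[of k] by (intro borel_measurable_sum measurable_compose[OF measurable_component_singleton]) auto
    then show ?thesis unfolding Bad_k_def by measurable
  qed
  have Bad_sets: "Bad \<in> sets ?PM" unfolding Bad_def using Bad_k_sets by auto
  have "emeasure ?PM Bad \<le> (\<Sum>k<r. emeasure ?PM (Bad_k k))"
    unfolding Bad_def by (rule emeasure_subadditive_finite) (use Bad_k_sets in auto)
  also have "\<dots> \<le> (\<Sum>k<r. ennreal (exp (- (real n / (4 * real r)))))"
  proof (rule sum_mono)
    fix k assume "k \<in> {..<r}"
    then have "real n * measure Q (A k) / 4 = real n / (4 * real r)" using A_mass[of k] by simp
    with empirical_count_lower_tail[OF Q_prob A_sets[of k], of n]
    show "emeasure ?PM (Bad_k k) \<le> ennreal (exp (- (real n / (4 * real r))))"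
      unfolding Bad_k_def by (simp only:)
  qed
  also have "\<dots> = ennreal \<pi>"
    by (simp add: \<pi>_def ennreal_mult ennreal_of_nat_eq_real_of_nat)
  finally have Bad_prob: "emeasure ?PM Bad \<le> ennreal \<pi>" .
  define N where "N \<omega> = noise_size L P q m \<mu> n (\<lambda>i. fst (\<omega> i)) (\<lambda>i. snd (\<omega> i))" for \<omega>
  define C where "C = (2 + 4 * L) / \<mu>"
  have C0: "C \<ge> 0" using L_pos \<mu> by (simp add: C_def)
  define E4 where "E4 \<omega> = (\<Sum>i<n. (snd (\<omega> i)) ^ 4)" for \<omega> :: "nat \<Rightarrow> real \<times> real"
  have N0: "0 \<le> N \<omega>" for \<omega> unfolding N_def by (rule noise_size_nonneg[OF \<mu>(1)])
  have E40: "0 \<le> E4 \<omega>" for \<omega> unfolding E4_def by (intro sum_nonneg) auto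
  \<comment> \<open>Deterministic part of the crude bound, charged on \<open>Bad\<close> alone. The
    fourth-moment part of \<open>U\<close> carries no indicator, so no joint expectation of noise
    and \<open>Bad\<close> arises.\<close>
  define z where "z = C * (4 / s + 2 * b)"
  have z0: "0 \<le> z" using C0 s b by (simp add: z_def)
  define U where "U \<omega> = 64 * N \<omega> + 64 * b + C * 4 * s / real n * E4 \<omega> + z * indicator Bad \<omega>" for \<omega>
  have U_split: "ennreal (U \<omega>) = ennreal 64 * ennreal (N \<omega>) + ennreal (64 * b)
      + ennreal (C * 4 * s / real n) * ennreal (E4 \<omega>) + ennreal z * indicator Bad \<omega>" for \<omega>
  proof -
    have lin: "ennreal (64 * x + y + c * e + z * indicator Bad \<omega>)
        = ennreal 64 * ennreal x + ennreal y + ennreal c * ennreal e + ennreal z * indicator Bad \<omega>"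
      if "0 \<le> x" "0 \<le> y" "0 \<le> c" "0 \<le> e" for x y c e :: real
      using that z0 by (simp add: ennreal_plus ennreal_mult indicator_def)
    show ?thesis
      unfolding U_def by (rule lin) (use N0 b C0 s E40 in auto)
  qed
  have "AE \<omega> in ?PM. \<forall>i<n. fst (\<omega> i) \<in> {- L..<L}"
    by (rule AE_PiM_all[OF AE_Q_of_P[OF P_supp]])
  moreover have "AE \<omega> in ?PM. \<forall>i<n. \<forall>j\<in>{j. j < m \<and> measure P {q j..<q (Suc j)} = 0}. fst (\<omega> i) \<notin> {q j..<q (Suc j)}"
  proof (rule AE_PiM_all, rule AE_Q_of_P, rule eventually_ball_finite)
    show "\<forall>j\<in>{j. j < m \<and> measure P {q j..<q (Suc j)} = 0}. AE x in P. x \<notin> {q j..<q (Suc j)}"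
    proof
      fix j assume "j \<in> {j. j < m \<and> measure P {q j..<q (Suc j)} = 0}"
      then show "AE x in P. x \<notin> {q j..<q (Suc j)}"
        using P.prob_eq_0[of "{q j..<q (Suc j)}"] by (simp add: P_sets)
    qed
  qed simp
  moreover have "AE \<omega> in ?PM. \<omega> \<in> space ?PM" by simp
  ultimately have "AE \<omega> in ?PM. loss \<omega> \<le> ennreal (U \<omega>)"
    using loss
  proof eventually_elim
    case (elim \<omega>)
    define xs where "xs = (\<lambda>i. fst (\<omega> i))"
    define es where "es = (\<lambda>i. snd (\<omega> i))"
    obtain H \<gamma> where prim: "primitive_on (- L) L H \<gamma>" and \<gamma>: "set_integrable lborel {- L..L} (\<lambda>t. (\<gamma> t)\<^sup>2)"
      and l: "loss \<omega> = (\<integral>\<^sup>+x. ennreal (indicator {- L..<L} x * (H x)\<^sup>2) \<partial>P)"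
      and basic': "(\<Sum>i<n. (H (xs i))\<^sup>2) / real n + \<mu> / 2 * (LINT t:{- L..L}|lborel. (\<gamma> t)\<^sup>2)
          \<le> 2 / real n * (\<Sum>i<n. es i * H (xs i)) + b"
      using elim(4) unfolding xs_def es_def by blast
    interpret S: sobolev_design L P H \<gamma>
      by standard (use L_pos P_sets P_supp prim \<gamma> in auto)
    have basic: "(\<Sum>i<n. (H (xs i))\<^sup>2) / real n + \<mu> / 2 * S.energy L \<le> 2 / real n * (\<Sum>i<n. es i * H (xs i)) + b"
      using basic' by (simp add: S.energy_def)
    have lr: "loss \<omega> = ennreal S.risk"
      unfolding l S.risk_def
      by (rule nn_integral_eq_integral) (auto intro!: S.H_sq_indicator_integrable)
    have xs: "xs i \<in> {- L..<L}" if "i < n" for i using elim(1) that by (simp add: xs_def)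
    have "S.risk \<le> U \<omega>"
    proof (cases "\<omega> \<in> Bad")
      case False
      have count: "real n / (4 * real r) \<le> real (card {i. i < n \<and> xs i \<in> {q' k..<q' (Suc k)}})" if k: "k < r" for k
      proof -
        have "\<omega> \<notin> Bad_k k" using False k by (auto simp: Bad_def)
        then have "real n * measure Q (A k) / 4 \<le> (\<Sum>i<n. indicat_real (A k) (\<omega> i))"
          using elim(3) unfolding Bad_k_def by auto
        also have "(\<Sum>i<n. indicat_real (A k) (\<omega> i)) = real (card {i. i < n \<and> xs i \<in> {q' k..<q' (Suc k)}})"
        proof -
          have "(\<Sum>i<n. indicat_real (A k) (\<omega> i)) = (\<Sum>i\<in>{i. i < n \<and> xs i \<in> {q' k..<q' (Suc k)}}. 1)"
            by (rule sum.mono_neutral_cong_right) (auto simp: A_def xs_def indicator_def)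
          then show ?thesis by simp
        qed
        finally show ?thesis using A_mass[OF k] by simp
      qed
      have "S.risk \<le> 64 * (noise_size L P q m \<mu> n xs es + b)"
      proof (rule S.risk_le_noise_size[OF basic n \<mu>(1) xs part \<Delta> _ m(2) _ part' r mass' count])
        show "measure P {q j..<q (Suc j)} \<le> \<kappa> * (2 * L / real m)" if "j < m" for j
          using measure_P_interval_le[OF c.q_mono[OF that]] \<Delta>[of j] by simp
        show "xs i \<notin> {q j..<q (Suc j)}" if "i < n" "j < m" "measure P {q j..<q (Suc j)} = 0" for i j
          using elim(2) that by (simp add: xs_def)
      qed
      also have "\<dots> = 64 * N \<omega> + 64 * b" by (simp add: N_def xs_def es_def)
      also have "\<dots> \<le> U \<omega>" unfolding U_def using E40[of \<omega>] z0 C0 s by simp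
      finally show ?thesis .
    next
      case True
      have "S.risk \<le> C * (4 * ((\<Sum>i<n. (es i)\<^sup>2) / real n) + 2 * b)"
        unfolding C_def by (rule S.risk_le_crude[OF basic n \<mu> xs])
      also have "(\<Sum>i<n. (es i)\<^sup>2) / real n \<le> (\<Sum>i<n. s * (es i) ^ 4 + 1 / s) / real n"
      proof (intro divide_right_mono sum_mono)
        fix i
        \<comment> \<open>This even gives 2 \<epsilon>^2 \<le> s \<epsilon>^4 + 1/s; one copy of
          \<epsilon>^2 is dropped.\<close>
        have "0 \<le> s * ((es i)\<^sup>2 - 1 / s)\<^sup>2" using s by simp
        also have "\<dots> = s * (es i) ^ 4 - 2 * (es i)\<^sup>2 + 1 / s"
          using s by (simp add: power2_diff field_simps power2_eq_square power4_eq_xxxx)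
        finally show "(es i)\<^sup>2 \<le> s * (es i) ^ 4 + 1 / s"
          using zero_le_power2[of "es i"] by linarith
      qed simp
      also have "(\<Sum>i<n. s * (es i) ^ 4 + 1 / s) / real n = s / real n * E4 \<omega> + 1 / s"
        using n by (simp add: sum.distrib E4_def es_def sum_distrib_left[symmetric] add_divide_distrib)
      finally have "S.risk \<le> C * (4 * (s / real n * E4 \<omega> + 1 / s) + 2 * b)"
        using C0 by (simp add: mult_left_mono)
      also have "\<dots> = C * 4 * s / real n * E4 \<omega> + z" by (simp add: z_def algebra_simps)
      also have "\<dots> \<le> U \<omega>" unfolding U_def using True N0[of \<omega>] b by simp
      finally show ?thesis .
    qed
    then show ?case unfolding lr by (rule ennreal_leI)
  qed
  then have "(\<integral>\<^sup>+\<omega>. loss \<omega> \<partial>?PM) \<le> (\<integral>\<^sup>+\<omega>. ennreal (U \<omega>) \<partial>?PM)"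
    by (rule nn_integral_mono_AE)
  also have "\<dots> = ennreal 64 * (\<integral>\<^sup>+\<omega>. ennreal (N \<omega>) \<partial>?PM) + ennreal (64 * b)
      + ennreal (C * 4 * s / real n) * (\<integral>\<^sup>+\<omega>. ennreal (E4 \<omega>) \<partial>?PM) + ennreal z * emeasure ?PM Bad"
  proof -
    have [measurable]: "(\<lambda>\<omega>. ennreal (N \<omega>)) \<in> borel_measurable ?PM"
      unfolding N_def by (rule noise_size_expectation(1)[OF part \<Delta> _ n \<mu>(1)]) (use L_pos in auto)
    have [measurable]: "E4 \<in> borel_measurable ?PM"
      unfolding E4_def by (intro borel_measurable_sum borel_measurable_power component_measurable) auto
    show ?thesis
      unfolding U_split using Bad_sets
      by (simp add: nn_integral_add nn_integral_cmult PM.emeasure_space_1)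
  qed
  also have "\<dots> \<le> ennreal 64 * ennreal (72 * \<sigma>\<^sup>2 * real m / real n + 16 * L * \<kappa> * (2 * L / real m) * \<sigma>\<^sup>2 / (\<mu> * real n))
      + ennreal (64 * b) + ennreal (C * 4 * s / real n) * ennreal (real n * (12 * \<sigma>\<^sup>2 * M\<^sup>2)) + ennreal z * ennreal \<pi>"
  proof (intro add_mono mult_left_mono order_refl Bad_prob)
    show "(\<integral>\<^sup>+\<omega>. ennreal (N \<omega>) \<partial>?PM) \<le> ennreal (72 * \<sigma>\<^sup>2 * real m / real n + 16 * L * \<kappa> * (2 * L / real m) * \<sigma>\<^sup>2 / (\<mu> * real n))"
      unfolding N_def by (rule noise_size_expectation(2)[OF part \<Delta> _ n \<mu>(1)]) (use L_pos in auto)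
    have "(\<integral>\<^sup>+\<omega>. ennreal (E4 \<omega>) \<partial>?PM) = (\<integral>\<^sup>+\<omega>. (\<Sum>i<n. ennreal ((snd (\<omega> i)) ^ 4)) \<partial>?PM)"
      by (simp add: E4_def sum_ennreal)
    also have "\<dots> = (\<Sum>i<n. \<integral>\<^sup>+\<omega>. ennreal ((snd (\<omega> i)) ^ 4) \<partial>?PM)"
    proof (rule nn_integral_sum)
      fix i assume "i \<in> {..<n}"
      then have [measurable]: "(\<lambda>\<omega>. snd (\<omega> i)) \<in> borel_measurable ?PM" by (intro component_measurable) auto
      show "(\<lambda>\<omega>. ennreal ((snd (\<omega> i)) ^ 4)) \<in> borel_measurable ?PM" by measurable
    qed
    also have "\<dots> \<le> (\<Sum>i<n. ennreal (12 * \<sigma>\<^sup>2 * M\<^sup>2))"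
    proof (rule sum_mono)
      fix i assume "i \<in> {..<n}"
      then have "(\<integral>\<^sup>+\<omega>. ennreal ((snd (\<omega> i)) ^ 4) \<partial>?PM) = (\<integral>\<^sup>+z. ennreal ((snd z) ^ 4) \<partial>Q)"
        by (intro nn_integral_PiM_component) auto
      then show "(\<integral>\<^sup>+\<omega>. ennreal ((snd (\<omega> i)) ^ 4) \<partial>?PM) \<le> ennreal (12 * \<sigma>\<^sup>2 * M\<^sup>2)"
        using noise_fourth_moment by simp
    qed
    also have "\<dots> = ennreal (real n * (12 * \<sigma>\<^sup>2 * M\<^sup>2))"
      by (simp add: ennreal_mult ennreal_of_nat_eq_real_of_nat)
    finally show "(\<integral>\<^sup>+\<omega>. ennreal (E4 \<omega>) \<partial>?PM) \<le> ennreal (real n * (12 * \<sigma>\<^sup>2 * M\<^sup>2))" .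
  qed auto
  also have "\<dots> = ennreal (64 * (72 * \<sigma>\<^sup>2 * real m / real n + 16 * L * \<kappa> * (2 * L / real m) * \<sigma>\<^sup>2 / (\<mu> * real n)) + 64 * b
        + C * 4 * s / real n * (real n * (12 * \<sigma>\<^sup>2 * M\<^sup>2)) + z * \<pi>)"
  proof -
    have "0 \<le> 72 * \<sigma>\<^sup>2 * real m / real n + 16 * L * \<kappa> * (2 * L / real m) * \<sigma>\<^sup>2 / (\<mu> * real n)"
      using L_pos \<kappa>_pos \<mu> by simp
    moreover have "0 \<le> C * 4 * s / real n * (real n * (12 * \<sigma>\<^sup>2 * M\<^sup>2))" "0 \<le> C * 4 * s / real n" "0 \<le> z * \<pi>" "0 \<le> \<pi>"
      using C0 s z0 by (auto simp: \<pi>_def)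
    ultimately show ?thesis
      using b z0 by (simp only: ennreal_mult'[symmetric] ennreal_plus[symmetric] add_nonneg_nonneg mult_nonneg_nonneg zero_le_numeral)
  qed
  also have "C * 4 * s / real n * (real n * (12 * \<sigma>\<^sup>2 * M\<^sup>2)) = (2 + 4 * L) / \<mu> * 4 * s * (12 * \<sigma>\<^sup>2 * M\<^sup>2)"
    using n by (simp add: C_def)
  finally show ?thesis by (simp add: z_def C_def)
qed

end

section \<open>The estimator\<close>

text \<open>The data terms expand around \<open>f0\<close>, and the squared noise cancels. The
  penalty controls \<open>g\<close>, not g - g0; through (g - g0)^2 \<le> 2 g^2 + 2 g0^2 a penalty
  with \<mu>/2 passes to the difference, and the bias becomes 2 \<mu> times the energy of
  \<open>g0\<close>. The Sobolev penalty of \<open>f\<close> is nonnegative and dropped.\<close>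

lemma pi_estimator_basic_inequality:
  fixes n :: nat
  assumes est: "is_pi_estimator L lam mu n xs ys f" and H0: "H1per L f0 g0" and L: "L > 0"
    and lam: "lam \<ge> 0" and mu: "mu \<ge> 0" and n: "n > 0"
    and ys: "\<And>i. i < n \<Longrightarrow> ys i = f0 (xs i) + es i"
  obtains g where "primitive_on (- L) L (\<lambda>x. f x - f0 x) (\<lambda>t. g t - g0 t)"
    "set_integrable lborel {- L..L} (\<lambda>t. (g t - g0 t)\<^sup>2)"
    "(\<Sum>i<n. (f (xs i) - f0 (xs i))\<^sup>2) / real n + mu / 2 * (LINT t:{- L..L}|lborel. (g t - g0 t)\<^sup>2)
      \<le> 2 / real n * (\<Sum>i<n. es i * (f (xs i) - f0 (xs i)))
        + (lam * (LINT x:{- 2 * L..2 * L}|lborel. (f0 x)\<^sup>2 + (g0 x)\<^sup>2) + 2 * mu * (LINT x:{- L..L}|lborel. (g0 x)\<^sup>2))"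
proof -
  obtain g where H: "H1per L f g" and min: "pi_objective L lam mu n xs ys f g \<le> pi_objective L lam mu n xs ys f0 g0"
    using est H0 unfolding is_pi_estimator_def by blast
  have prim: "primitive_on (- L) L (\<lambda>x. f x - f0 x) (\<lambda>t. g t - g0 t)"
    by (intro primitive_on_diff H1per_primitive_on H H0 L)
  have sq: "set_integrable lborel {- L..L} (\<lambda>t. (h t)\<^sup>2)" if "H1per L u h" for u h
  proof -
    have "set_integrable lborel {- 4 * L..4 * L} (\<lambda>t. (h t)\<^sup>2)"
      using that by (simp add: H1per_def H1_def L2_on_def)
    then show ?thesis by (rule set_integrable_Icc_subset) (use L in auto)
  qed
  have g2: "set_integrable lborel {- L..L} (\<lambda>t. 2 * (g t)\<^sup>2 + 2 * (g0 t)\<^sup>2)"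
    using sq[OF H] sq[OF H0] by (intro set_integral_add set_integrable_mult_right)
  have le: "(g t - g0 t)\<^sup>2 \<le> 2 * (g t)\<^sup>2 + 2 * (g0 t)\<^sup>2" for t
    using zero_le_power2[of "g t + g0 t"] by (simp add: power2_eq_square algebra_simps)
  have d2: "set_integrable lborel {- L..L} (\<lambda>t. (g t - g0 t)\<^sup>2)"
  proof (rule set_integrable_bound[OF g2])
    have "(\<lambda>t. indicator {- L..L} t *\<^sub>R (g t - g0 t)) \<in> borel_measurable lborel"
      using prim unfolding primitive_on_def set_integrable_def by (auto dest: borel_measurable_integrable)
    then have "(\<lambda>t. (indicator {- L..L} t *\<^sub>R (g t - g0 t))\<^sup>2) \<in> borel_measurable lborel" by measurable
    moreover have "(\<lambda>t. (indicator {- L..L} t *\<^sub>R (g t - g0 t))\<^sup>2) = (\<lambda>t. indicator {- L..L} t *\<^sub>R (g t - g0 t)\<^sup>2)"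
      by (auto simp: indicator_def)
    ultimately show "set_borel_measurable lborel {- L..L} (\<lambda>t. (g t - g0 t)\<^sup>2)"
      by (simp add: set_borel_measurable_def)
    show "AE t in lborel. t \<in> {- L..L} \<longrightarrow> norm ((g t - g0 t)\<^sup>2) \<le> norm (2 * (g t)\<^sup>2 + 2 * (g0 t)\<^sup>2)"
      using le by (intro AE_I2 impI) (simp add: order_trans)
  qed
  define G where "G = (LINT x:{- L..L}|lborel. (g x)\<^sup>2)"
  define G0 where "G0 = (LINT x:{- L..L}|lborel. (g0 x)\<^sup>2)"
  define Dd where "Dd = (LINT t:{- L..L}|lborel. (g t - g0 t)\<^sup>2)"
  define K where "K = (LINT x:{- 2 * L..2 * L}|lborel. (f x)\<^sup>2 + (g x)\<^sup>2)"
  define K0 where "K0 = (LINT x:{- 2 * L..2 * L}|lborel. (f0 x)\<^sup>2 + (g0 x)\<^sup>2)"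
  have K: "K \<ge> 0" unfolding K_def set_lebesgue_integral_def by (intro Bochner_Integration.integral_nonneg) auto
  have "Dd \<le> (LINT t:{- L..L}|lborel. 2 * (g t)\<^sup>2 + 2 * (g0 t)\<^sup>2)"
    unfolding Dd_def by (rule set_integral_mono[OF d2 g2 le])
  also have "\<dots> = 2 * G + 2 * G0"
    using sq[OF H] sq[OF H0] by (simp add: G_def G0_def)
  finally have Dd: "mu / 2 * Dd \<le> mu * G + mu * G0"
    using mult_left_mono[of Dd "2 * G + 2 * G0" "mu / 2"] mu by (simp add: algebra_simps)
  have e: "(\<Sum>i<n. (f (xs i) - ys i)\<^sup>2) = (\<Sum>i<n. (f (xs i) - f0 (xs i))\<^sup>2)
      - 2 * (\<Sum>i<n. es i * (f (xs i) - f0 (xs i))) + (\<Sum>i<n. (es i)\<^sup>2)"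
    unfolding sum_distrib_left sum_subtractf[symmetric] sum.distrib[symmetric]
    by (intro sum.cong refl) (simp add: ys power2_eq_square algebra_simps)
  have e0: "(\<Sum>i<n. (f0 (xs i) - ys i)\<^sup>2) = (\<Sum>i<n. (es i)\<^sup>2)"
    by (intro sum.cong refl) (simp add: ys)
  have "(\<Sum>i<n. (f (xs i) - ys i)\<^sup>2) / real n + lam * K + mu * G \<le> (\<Sum>i<n. (es i)\<^sup>2) / real n + lam * K0 + mu * G0"
    using min unfolding pi_objective_def e0 K_def K0_def G_def G0_def by simp
  moreover have "0 \<le> lam * K" using lam K by simp
  ultimately have "(\<Sum>i<n. (f (xs i) - f0 (xs i))\<^sup>2) / real n + mu / 2 * Dd
      \<le> 2 / real n * (\<Sum>i<n. es i * (f (xs i) - f0 (xs i))) + (lam * K0 + 2 * mu * G0)"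
    using Dd unfolding e by (simp add: add_divide_distrib diff_divide_distrib)
  then show thesis using that[OF prim d2] unfolding Dd_def K0_def G0_def by blast
qed

section \<open>Choice of the cell numbers and rates\<close>

text \<open>The bound of \<open>expected_risk_le\<close> as a function of w = 1/\<mu>, the bias b
  and the sample size x, with s = 1/x^2 and the numbers of cells replaced by the real upper bounds 2
  L sqrt(\<kappa> w) + 1 and 4 L w + 1. As a closed real expression it has computable
  asymptotics.\<close>

definition risk_bound :: "real \<Rightarrow> real \<Rightarrow> real \<Rightarrow> real \<Rightarrow> real \<Rightarrow> real \<Rightarrow> real \<Rightarrow> real" where
  "risk_bound L \<kappa> \<sigma> M w b x =
     64 * (72 * \<sigma>\<^sup>2 * (2 * L * sqrt \<kappa> * sqrt w + 1) / x + 16 * L * sqrt \<kappa> * \<sigma>\<^sup>2 * sqrt w / x) + 64 * b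
     + (2 + 4 * L) * w * 4 / x\<^sup>2 * (12 * \<sigma>\<^sup>2 * M\<^sup>2)
     + (2 + 4 * L) * w * (4 * x\<^sup>2 + 2 * b) * ((4 * L * w + 1) * exp (- (x / (4 * (4 * L * w + 1)))))"

lemma (in noisy_design) expected_risk_le_bound:
  fixes n :: nat and loss :: "(nat \<Rightarrow> real \<times> real) \<Rightarrow> ennreal"
  assumes n: "n > 0" and w: "w \<ge> 1" and b: "0 \<le> b"
    and loss: "AE \<omega> in PiM {..<n} (\<lambda>_. Q). \<exists>H \<gamma>. primitive_on (- L) L H \<gamma> \<and>
        set_integrable lborel {- L..L} (\<lambda>t. (\<gamma> t)\<^sup>2) \<and>
        loss \<omega> = (\<integral>\<^sup>+x. ennreal (indicator {- L..<L} x * (H x)\<^sup>2) \<partial>P) \<and>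
        (\<Sum>i<n. (H (fst (\<omega> i)))\<^sup>2) / real n + (1 / w) / 2 * (LINT t:{- L..L}|lborel. (\<gamma> t)\<^sup>2)
          \<le> 2 / real n * (\<Sum>i<n. snd (\<omega> i) * H (fst (\<omega> i))) + b"
  shows "(\<integral>\<^sup>+\<omega>. loss \<omega> \<partial>PiM {..<n} (\<lambda>_. Q)) \<le> ennreal (risk_bound L \<kappa> \<sigma> M w b (real n))"
proof -
  \<comment> \<open>The smallest value with \<kappa> (2L/y)^2 \<le> 1/w; likewise 4 L w is the
    smallest with 4L / (4 L w) \<le> 1/w. Both are rounded up.\<close>
  define y where "y = 2 * L * sqrt \<kappa> * sqrt w"
  define m where "m = nat \<lceil>y\<rceil>"
  define r where "r = nat \<lceil>4 * L * w\<rceil>"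
  have y: "y > 0" using L_pos \<kappa>_pos w by (simp add: y_def)
  have m: "m > 0" "y \<le> real m" "real m \<le> y + 1" using y by (auto simp: m_def)
  have Lw: "4 * L * w > 0" using L_pos w by simp
  have r: "r > 0" "4 * L * w \<le> real r" "real r \<le> 4 * L * w + 1" using Lw by (auto simp: r_def)
  have lm: "2 * L / real m \<le> 1 / (sqrt \<kappa> * sqrt w)"
  proof -
    have "2 * L / real m \<le> 2 * L / y"
      using m y L_pos by (intro divide_left_mono) auto
    also have "\<dots> = 1 / (sqrt \<kappa> * sqrt w)" using L_pos by (simp add: y_def)
    finally show ?thesis .
  qed
  have "\<kappa> * (2 * L / real m)\<^sup>2 \<le> \<kappa> * (1 / (sqrt \<kappa> * sqrt w))\<^sup>2"
    using lm L_pos \<kappa>_pos by (intro mult_left_mono power_mono) auto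
  also have "\<dots> = 1 / w" using \<kappa>_pos w by (simp add: power_divide power_mult_distrib)
  finally have m2: "\<kappa> * (2 * L / real m)\<^sup>2 \<le> 1 / w" .
  have r2: "4 * L / real r \<le> 1 / w" using r w by (simp add: field_simps)
  define \<pi> where "\<pi> = real r * exp (- (real n / (4 * real r)))"
  have "(\<integral>\<^sup>+\<omega>. loss \<omega> \<partial>PiM {..<n} (\<lambda>_. Q))
    \<le> ennreal (64 * (72 * \<sigma>\<^sup>2 * real m / real n + 16 * L * \<kappa> * (2 * L / real m) * \<sigma>\<^sup>2 / ((1 / w) * real n)) + 64 * b
        + (2 + 4 * L) / (1 / w) * 4 * (1 / (real n)\<^sup>2) * (12 * \<sigma>\<^sup>2 * M\<^sup>2)
        + (2 + 4 * L) / (1 / w) * (4 / (1 / (real n)\<^sup>2) + 2 * b) * \<pi>)"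
    \<comment> \<open>Here s = 1/n^2: the fourth-moment part becomes of order w/n^2, and 4/s = 4 n^2
      is harmless against the exponential.\<close>
    unfolding \<pi>_def using w n by (intro expected_risk_le m m2 r r2 b loss) auto
  also have "\<dots> \<le> ennreal (risk_bound L \<kappa> \<sigma> M w b (real n))"
    unfolding risk_bound_def
  proof (intro ennreal_leI add_mono mult_left_mono order_refl)
    show "72 * \<sigma>\<^sup>2 * real m / real n \<le> 72 * \<sigma>\<^sup>2 * (2 * L * sqrt \<kappa> * sqrt w + 1) / real n"
      using m by (intro divide_right_mono mult_left_mono) (auto simp: y_def)
    have "16 * L * \<kappa> * (2 * L / real m) * \<sigma>\<^sup>2 / (1 / w * real n) \<le> 16 * L * \<kappa> * (1 / (sqrt \<kappa> * sqrt w)) * \<sigma>\<^sup>2 / (1 / w * real n)"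
      using lm L_pos \<kappa>_pos w by (intro divide_right_mono mult_right_mono mult_left_mono) auto
    also have "\<dots> = 16 * L * (\<kappa> / sqrt \<kappa>) * \<sigma>\<^sup>2 * (w / sqrt w) / real n"
      by simp
    also have "\<dots> = 16 * L * sqrt \<kappa> * \<sigma>\<^sup>2 * sqrt w / real n"
      using \<kappa>_pos w by (simp add: real_div_sqrt)
    finally show "16 * L * \<kappa> * (2 * L / real m) * \<sigma>\<^sup>2 / (1 / w * real n) \<le> 16 * L * sqrt \<kappa> * \<sigma>\<^sup>2 * sqrt w / real n" .
    show "(2 + 4 * L) / (1 / w) * 4 * (1 / (real n)\<^sup>2) * (12 * \<sigma>\<^sup>2 * M\<^sup>2) \<le> (2 + 4 * L) * w * 4 / (real n)\<^sup>2 * (12 * \<sigma>\<^sup>2 * M\<^sup>2)"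
      by simp
    have "\<pi> \<le> (4 * L * w + 1) * exp (- (real n / (4 * (4 * L * w + 1))))"
      unfolding \<pi>_def using r Lw by (intro mult_mono) (auto intro!: divide_left_mono)
    then have "(2 + 4 * L) * w * (4 * (real n)\<^sup>2 + 2 * b) * \<pi> \<le> (2 + 4 * L) * w * (4 * (real n)\<^sup>2 + 2 * b) * ((4 * L * w + 1) * exp (- (real n / (4 * (4 * L * w + 1)))))"
      using L_pos w b by (intro mult_left_mono) auto
    then show "(2 + 4 * L) / (1 / w) * (4 / (1 / (real n)\<^sup>2) + 2 * b) * \<pi> \<le> (2 + 4 * L) * w * (4 * (real n)\<^sup>2 + 2 * b) * ((4 * L * w + 1) * exp (- (real n / (4 * (4 * L * w + 1)))))"
      by simp
  qed auto
  finally show ?thesis .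
qed

text \<open>With w = D n^(2/3) the variance of order sqrt(w)/n and the penalty bias 2 D n^(-2/3) are
  both of order n^(-2/3), the fourth-moment part is of order n^(-4/3), and the exceptional event
  contributes a power of n times exp(-c n^(1/3)). Dividing by the extra logarithms gives the limit
  0.\<close>

lemma risk_bound_asymp_nonconstant:
  fixes L D K :: real
  assumes "L > 0" "D > 0"
  shows "(\<lambda>n::nat. risk_bound L \<kappa> \<sigma> M (D * real n powr (2/3)) (ln (real n) / real n * K + 2 * (real n powr (-2/3) / D) * D\<^sup>2) (real n)
      / (D * real n powr (-2/3) * (ln (real n)) ^ 3)) \<longlonglongrightarrow> 0"
  unfolding risk_bound_def using assms by real_asymp

text \<open>With w = ln n the bias is at most of order ln n / n and the variance of order sqrt(ln n)
  / n, so the cubed logarithm leaves two powers to spare.\<close>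

lemma risk_bound_asymp_constant:
  fixes L K c :: real
  assumes "L > 0" "c > 0"
  shows "(\<lambda>n::nat. risk_bound L \<kappa> \<sigma> M (ln (real n)) (ln (real n) / real n * K) (real n)
      / (c * (ln (real n)) ^ 3 / real n)) \<longlonglongrightarrow> 0"
  unfolding risk_bound_def using assms by real_asymp

text \<open>\<open>K\<close> is the squared norm of the reflected extension, fixed before
  \<open>n\<close>, the tuning parameters and the estimator, so that it may enter the asymptotic
  comparison as a constant.\<close>

lemma (in noisy_design) estimator_risk_le:
  assumes H1: "H1 (- L) L fstar Df"
  obtains K where "K \<ge> 0" "\<And>(n::nat) w lam fh. n > 0 \<Longrightarrow> w \<ge> 1 \<Longrightarrow> lam \<ge> 0 \<Longrightarrow>
      (\<forall>\<omega>. is_pi_estimator L lam (1 / w) n (\<lambda>i. fst (\<omega> i)) (\<lambda>i. fstar (fst (\<omega> i)) + snd (\<omega> i)) (fh \<omega>)) \<Longrightarrow>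
      (\<integral>\<^sup>+\<omega>. (\<integral>\<^sup>+x. indicator {- L..L} x * ennreal ((fh \<omega> x - fstar x)\<^sup>2) \<partial>distr Q lborel fst) \<partial>PiM {..<n} (\<lambda>_. Q))
        \<le> ennreal (risk_bound L \<kappa> \<sigma> M w (lam * K + 2 * (1 / w) * (LINT x:{- L..L}|lborel. (Df x)\<^sup>2)) (real n))"
proof -
  have LL: "- L < L" using L_pos by simp
  obtain F where F: "primitive_on (- L) L F Df" and Fae: "AE x in lborel. x \<in> {- L..L} \<longrightarrow> fstar x = F x"
    using H1_continuous_representative[OF H1 LL] .
  define f0 where "f0 x = F (fold_pos L x)" for x
  define g0 where "g0 x = fold_sign L x * Df (fold_pos L x)" for x
  have H0: "H1per L f0 g0"
    unfolding f0_def g0_def by (rule H1per_fold[OF F _ L_pos]) (use H1 in \<open>simp add: H1_def\<close>)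
  define K where "K = (LINT x:{- 2 * L..2 * L}|lborel. (f0 x)\<^sup>2 + (g0 x)\<^sup>2)"
  define G where "G = (LINT x:{- L..L}|lborel. (Df x)\<^sup>2)"
  have K0: "K \<ge> 0" unfolding K_def set_lebesgue_integral_def by (intro Bochner_Integration.integral_nonneg) auto
  have G0: "G \<ge> 0" unfolding G_def set_lebesgue_integral_def by (intro Bochner_Integration.integral_nonneg) auto
  \<comment> \<open>On [-L, L] the folding is the identity with slope 1, so the energy there is that
    of \<open>Df\<close>, without an extension constant.\<close>
  have gG: "(LINT x:{- L..L}|lborel. (g0 x)\<^sup>2) = G"
    unfolding G_def set_lebesgue_integral_def using L_pos
    by (intro Bochner_Integration.integral_cong) (auto simp: indicator_def g0_def fold_pos_def fold_sign_def)
  have "AE x in lborel. x \<in> {- L..L} \<longrightarrow> fstar x = f0 x"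
    using Fae by eventually_elim (use L_pos in \<open>auto simp: f0_def fold_pos_def\<close>)
  from AE_P_of_lborel[OF this] have eqP: "AE x in P. x \<in> {- L..<L} \<and> fstar x = f0 x"
    using P_supp by eventually_elim auto
  show thesis
  proof (rule that[OF K0])
    fix n :: nat and w lam :: real and fh
    assume n: "n > 0" and w: "w \<ge> 1" and lam: "lam \<ge> 0"
      and est: "\<forall>\<omega>. is_pi_estimator L lam (1 / w) n (\<lambda>i. fst (\<omega> i)) (\<lambda>i. fstar (fst (\<omega> i)) + snd (\<omega> i)) (fh \<omega>)"
    define b where "b = lam * K + 2 * (1 / w) * G"
    have b: "b \<ge> 0" unfolding b_def using lam K0 w G0 by simp
    \<comment> \<open>The labels are generated by \<open>fstar\<close>, the competitor is
      \<open>f0\<close>; almost surely they agree at all sample points, so the noise is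
      unchanged.\<close>
    have "AE \<omega> in PiM {..<n} (\<lambda>_. Q). \<forall>i<n. fst (\<omega> i) \<in> {- L..<L} \<and> fstar (fst (\<omega> i)) = f0 (fst (\<omega> i))"
      by (rule AE_PiM_all[OF AE_Q_of_P[OF eqP]])
    then have "AE \<omega> in PiM {..<n} (\<lambda>_. Q). \<exists>H \<gamma>. primitive_on (- L) L H \<gamma> \<and>
        set_integrable lborel {- L..L} (\<lambda>t. (\<gamma> t)\<^sup>2) \<and>
        (\<integral>\<^sup>+x. indicator {- L..L} x * ennreal ((fh \<omega> x - fstar x)\<^sup>2) \<partial>distr Q lborel fst)
          = (\<integral>\<^sup>+x. ennreal (indicator {- L..<L} x * (H x)\<^sup>2) \<partial>P) \<and>
        (\<Sum>i<n. (H (fst (\<omega> i)))\<^sup>2) / real n + (1 / w) / 2 * (LINT t:{- L..L}|lborel. (\<gamma> t)\<^sup>2)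
          \<le> 2 / real n * (\<Sum>i<n. snd (\<omega> i) * H (fst (\<omega> i))) + b"
    proof eventually_elim
      case (elim \<omega>)
      have mu0: "1 / w \<ge> 0" using w by simp
      have ys: "fstar (fst (\<omega> i)) + snd (\<omega> i) = f0 (fst (\<omega> i)) + snd (\<omega> i)" if "i < n" for i
        using elim that by simp
      obtain g where g: "primitive_on (- L) L (\<lambda>x. fh \<omega> x - f0 x) (\<lambda>t. g t - g0 t)"
        "set_integrable lborel {- L..L} (\<lambda>t. (g t - g0 t)\<^sup>2)"
        "(\<Sum>i<n. (fh \<omega> (fst (\<omega> i)) - f0 (fst (\<omega> i)))\<^sup>2) / real n + (1 / w) / 2 * (LINT t:{- L..L}|lborel. (g t - g0 t)\<^sup>2)
      \<le> 2 / real n * (\<Sum>i<n. snd (\<omega> i) * (fh \<omega> (fst (\<omega> i)) - f0 (fst (\<omega> i))))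
        + (lam * K + 2 * (1 / w) * G)"
        using pi_estimator_basic_inequality[OF est[rule_format, of \<omega>] H0 L_pos lam mu0 n, of "\<lambda>i. snd (\<omega> i)"] ys
        unfolding K_def[symmetric] gG by blast
      have "(\<integral>\<^sup>+x. indicator {- L..L} x * ennreal ((fh \<omega> x - fstar x)\<^sup>2) \<partial>distr Q lborel fst)
          = (\<integral>\<^sup>+x. ennreal (indicator {- L..<L} x * (fh \<omega> x - f0 x)\<^sup>2) \<partial>P)"
        unfolding P_def[symmetric]
        by (rule nn_integral_cong_AE) (use eqP in eventually_elim, auto)
      with g show ?case unfolding b_def by blast
    qed
    from expected_risk_le_bound[OF n w b this]
    show "(\<integral>\<^sup>+\<omega>. (\<integral>\<^sup>+x. indicator {- L..L} x * ennreal ((fh \<omega> x - fstar x)\<^sup>2) \<partial>distr Q lborel fst) \<partial>PiM {..<n} (\<lambda>_. Q))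
        \<le> ennreal (risk_bound L \<kappa> \<sigma> M w (lam * K + 2 * (1 / w) * (LINT x:{- L..L}|lborel. (Df x)\<^sup>2)) (real n))"
      unfolding b_def G_def .
  qed
qed

lemma eventually_le_of_quotient_tendsto_0:
  fixes f g :: "nat \<Rightarrow> real"
  assumes "(\<lambda>n. f n / g n) \<longlonglongrightarrow> 0" "\<forall>\<^sub>F n in sequentially. g n > 0"
  shows "\<forall>\<^sub>F n in sequentially. f n \<le> g n"
proof -
  have "\<forall>\<^sub>F n in sequentially. f n / g n < 1" using assms(1) by (rule order_tendstoD) simp
  with assms(2) show ?thesis by eventually_elim (simp add: field_simps)
qed

theorem mainTheorem11:
  fixes L \<kappa> :: real
  assumes "L > 0" and "\<kappa> > 0"
  shows "\<exists>C > 0. \<forall>(fstar :: real \<Rightarrow> real) (Dfstar :: real \<Rightarrow> real)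
            (Q :: (real \<times> real) measure) (p :: real \<Rightarrow> ennreal) (\<sigma> :: real) (M :: real)
            (fhat :: nat \<Rightarrow> (nat \<Rightarrow> real \<times> real) \<Rightarrow> real \<Rightarrow> real).
     H1 (-L) L fstar Dfstar \<longrightarrow>
     prob_space Q \<longrightarrow> sets Q = sets borel \<longrightarrow>
     distributed Q lborel fst p \<longrightarrow>
     (AE x in lborel. p x \<le> ennreal \<kappa>) \<longrightarrow>
     (AE z in Q. fst z \<in> {-L..L}) \<longrightarrow>
     \<sigma> > 0 \<longrightarrow> M > 0 \<longrightarrow>
     (\<forall>l::nat. AE z in Q.
        nn_cond_exp Q (vimage_algebra (space Q) fst borel) (\<lambda>w. ennreal (\<bar>snd w\<bar> ^ l)) z
          \<le> ennreal (1/2 * fact l * \<sigma>\<^sup>2 * M powr (real l - 2))) \<longrightarrow>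
     (AE z in Q. real_cond_exp Q (vimage_algebra (space Q) fst borel) snd z = 0) \<longrightarrow>
     (let D = sqrt (LINT x:{-L..L}|lborel. (Dfstar x)\<^sup>2);
          H1sq = (LINT x:{-L..L}|lborel. (fstar x)\<^sup>2 + (Dfstar x)\<^sup>2);
          lam = (\<lambda>n::nat. ln (real n) / real n);
          mu = (\<lambda>n::nat. if D \<noteq> 0 then real n powr (-2/3) / D else 1 / ln (real n))
      in
      (\<forall>n \<ge> 2. \<forall>\<omega>. is_pi_estimator L (lam n) (mu n) n (\<lambda>i. fst (\<omega> i))
                      (\<lambda>i. fstar (fst (\<omega> i)) + snd (\<omega> i)) (fhat n \<omega>)) \<longrightarrow>
      (\<exists>N. \<forall>n \<ge> N.
         (\<integral>\<^sup>+ \<omega>. (\<integral>\<^sup>+ x. indicator {-L..L} x * ennreal ((fhat n \<omega> x - fstar x)\<^sup>2)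
                        \<partial>(distr Q lborel fst))
            \<partial>(PiM {..<n} (\<lambda>_. Q)))
         \<le> ennreal (C * (D * real n powr (-2/3) * (ln (real n))^3
                         + (H1sq + \<sigma>\<^sup>2 + M\<^sup>2) * (ln (real n))^3 / real n))))"
proof (intro exI[of _ 1] conjI allI impI)
  fix fstar Df :: "real \<Rightarrow> real" and Q :: "(real \<times> real) measure" and p :: "real \<Rightarrow> ennreal" and \<sigma> M :: real
    and fhat :: "nat \<Rightarrow> (nat \<Rightarrow> real \<times> real) \<Rightarrow> real \<Rightarrow> real"
  assume H1: "H1 (- L) L fstar Df" and Q: "prob_space Q" "sets Q = sets borel" "distributed Q lborel fst p"
    "AE x in lborel. p x \<le> ennreal \<kappa>" "AE z in Q. fst z \<in> {- L..L}" "\<sigma> > 0" "M > 0"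
    and mom: "\<forall>l::nat. AE z in Q.
        nn_cond_exp Q (vimage_algebra (space Q) fst borel) (\<lambda>w. ennreal (\<bar>snd w\<bar> ^ l)) z
          \<le> ennreal (1/2 * fact l * \<sigma>\<^sup>2 * M powr (real l - 2))"
    and cen: "AE z in Q. real_cond_exp Q (vimage_algebra (space Q) fst borel) snd z = 0"
  interpret noisy_design L \<kappa> \<sigma> M Q p
    by (rule noisy_design.intro) (fact assms Q mom[rule_format] cen)+
  define G where "G = (LINT x:{- L..L}|lborel. (Df x)\<^sup>2)"
  define D where "D = sqrt G"
  define S where "S = (LINT x:{- L..L}|lborel. (fstar x)\<^sup>2 + (Df x)\<^sup>2)"
  define lam where "lam n = ln (real n) / real n" for n
  define mu where "mu n = (if D \<noteq> 0 then real n powr (-2/3) / D else 1 / ln (real n))" for n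
  \<comment> \<open>Reciprocal of the tuning parameter, also for small n by the convention 1/0 = 0.
    The requirement \<mu> \<le> 1 becomes w \<ge> 1, which holds for large n in both cases.\<close>
  define w where "w n = (if D \<noteq> 0 then D * real n powr (2/3) else ln (real n))" for n
  have G0: "G \<ge> 0" unfolding G_def set_lebesgue_integral_def by (intro Bochner_Integration.integral_nonneg) auto
  have S0: "S \<ge> 0" unfolding S_def set_lebesgue_integral_def by (intro Bochner_Integration.integral_nonneg) auto
  have D0: "D \<ge> 0" and DG: "G = D\<^sup>2" using G0 by (auto simp: D_def)
  have muw: "mu n = 1 / w n" for n
    by (simp add: mu_def w_def powr_minus_divide)
  obtain K where K: "K \<ge> 0" and bound: "\<And>(n::nat) w lam fh. n > 0 \<Longrightarrow> w \<ge> 1 \<Longrightarrow> lam \<ge> 0 \<Longrightarrow>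
      (\<forall>\<omega>. is_pi_estimator L lam (1 / w) n (\<lambda>i. fst (\<omega> i)) (\<lambda>i. fstar (fst (\<omega> i)) + snd (\<omega> i)) (fh \<omega>)) \<Longrightarrow>
      (\<integral>\<^sup>+\<omega>. (\<integral>\<^sup>+x. indicator {- L..L} x * ennreal ((fh \<omega> x - fstar x)\<^sup>2) \<partial>distr Q lborel fst) \<partial>PiM {..<n} (\<lambda>_. Q))
        \<le> ennreal (risk_bound L \<kappa> \<sigma> M w (lam * K + 2 * (1 / w) * G) (real n))"
    using estimator_risk_le[OF H1] unfolding G_def by blast
  have w1: "\<forall>\<^sub>F n in sequentially. w n \<ge> 1"
  proof (cases "D = 0")
    case True
    have "\<forall>\<^sub>F n::nat in sequentially. ln (real n) \<ge> 1" by real_asymp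
    then show ?thesis by (simp add: w_def True)
  next
    case False
    then have "D > 0" using D0 by simp
    then have "\<forall>\<^sub>F n::nat in sequentially. D * real n powr (2/3) \<ge> 1" by real_asymp
    then show ?thesis by (simp add: w_def False)
  qed
  define c where "c = S + \<sigma>\<^sup>2 + M\<^sup>2"
  \<comment> \<open>Strict because \<sigma> and M are positive, even for \<open>fstar\<close> equal
    to 0; the comparison of quotients divides by \<open>c\<close> when D = 0.\<close>
  have c: "c > 0" unfolding c_def using S0 Q(6,7) by (simp add: add_nonneg_pos)
  have rate: "\<forall>\<^sub>F n in sequentially. risk_bound L \<kappa> \<sigma> M (w n) (lam n * K + 2 * (1 / w n) * G) (real n)
      \<le> D * real n powr (-2/3) * (ln (real n)) ^ 3 + c * (ln (real n)) ^ 3 / real n"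
  proof (cases "D = 0")
    case True
    have pos: "\<forall>\<^sub>F n::nat in sequentially. c * (ln (real n)) ^ 3 / real n > 0" using c by real_asymp
    have "\<forall>\<^sub>F n in sequentially. risk_bound L \<kappa> \<sigma> M (ln (real n)) (ln (real n) / real n * K) (real n) \<le> c * (ln (real n)) ^ 3 / real n"
      by (rule eventually_le_of_quotient_tendsto_0[OF risk_bound_asymp_constant[OF L_pos c] pos])
    \<comment> \<open>D = 0 removes both the first term of the rate and, through G = D^2, the
      penalty part of the bias.\<close>
    then show ?thesis by (simp add: w_def lam_def True DG)
  next
    case False
    then have D: "D > 0" using D0 by simp
    have pos: "\<forall>\<^sub>F n::nat in sequentially. D * real n powr (-2/3) * (ln (real n)) ^ 3 > 0" using D by real_asymp
    have "\<forall>\<^sub>F n in sequentially. risk_bound L \<kappa> \<sigma> M (D * real n powr (2/3))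
        (ln (real n) / real n * K + 2 * (real n powr (-2/3) / D) * D\<^sup>2) (real n) \<le> D * real n powr (-2/3) * (ln (real n)) ^ 3"
      \<comment> \<open>The first term of the rate alone dominates; the second is eventually
        positive and merely added.\<close>
      by (rule eventually_le_of_quotient_tendsto_0[OF risk_bound_asymp_nonconstant[OF L_pos D] pos])
    moreover have "\<forall>\<^sub>F n::nat in sequentially. c * (ln (real n)) ^ 3 / real n > 0" using c by real_asymp
    ultimately show ?thesis
    proof eventually_elim
      case (elim n)
      have "1 / w n = real n powr (-2/3) / D" using muw[of n] False by (simp add: mu_def)
      then show ?case using elim False unfolding DG by (simp add: w_def lam_def)
    qed
  qed
  have "\<forall>\<^sub>F n::nat in sequentially. n \<ge> 2" by (rule eventually_ge_at_top)
  \<comment> \<open>The hypothesis on the estimator starts at n = 2, which also makes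
    \<open>lam n\<close> nonnegative.\<close>
  with w1 rate have ev: "\<forall>\<^sub>F n in sequentially. n \<ge> 2 \<and> w n \<ge> 1 \<and>
      risk_bound L \<kappa> \<sigma> M (w n) (lam n * K + 2 * (1 / w n) * G) (real n)
      \<le> D * real n powr (-2/3) * (ln (real n)) ^ 3 + c * (ln (real n)) ^ 3 / real n"
    by eventually_elim auto
  have "\<exists>N. \<forall>n\<ge>N.
         (\<integral>\<^sup>+ \<omega>. (\<integral>\<^sup>+ x. indicator {-L..L} x * ennreal ((fhat n \<omega> x - fstar x)\<^sup>2)
                        \<partial>(distr Q lborel fst))
            \<partial>(PiM {..<n} (\<lambda>_. Q)))
         \<le> ennreal (1 * (D * real n powr (-2/3) * (ln (real n))^3 + (S + \<sigma>\<^sup>2 + M\<^sup>2) * (ln (real n))^3 / real n))"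
    if est: "\<forall>n \<ge> 2. \<forall>\<omega>. is_pi_estimator L (lam n) (mu n) n (\<lambda>i. fst (\<omega> i))
                      (\<lambda>i. fstar (fst (\<omega> i)) + snd (\<omega> i)) (fhat n \<omega>)"
  proof -
    obtain N where N: "\<And>n. n \<ge> N \<Longrightarrow> n \<ge> 2 \<and> w n \<ge> 1 \<and>
      risk_bound L \<kappa> \<sigma> M (w n) (lam n * K + 2 * (1 / w n) * G) (real n)
      \<le> D * real n powr (-2/3) * (ln (real n)) ^ 3 + c * (ln (real n)) ^ 3 / real n"
      using ev unfolding eventually_sequentially by blast
    show ?thesis
    proof (intro exI[of _ N] allI impI)
      fix n assume "n \<ge> N"
      note Nn = N[OF this]
      have "lam n \<ge> 0" unfolding lam_def using Nn by simp
      then have "(\<integral>\<^sup>+ \<omega>. (\<integral>\<^sup>+ x. indicator {-L..L} x * ennreal ((fhat n \<omega> x - fstar x)\<^sup>2)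
                        \<partial>(distr Q lborel fst)) \<partial>(PiM {..<n} (\<lambda>_. Q)))
          \<le> ennreal (risk_bound L \<kappa> \<sigma> M (w n) (lam n * K + 2 * (1 / w n) * G) (real n))"
        using Nn est unfolding muw by (intro bound) auto
      also have "\<dots> \<le> ennreal (1 * (D * real n powr (-2/3) * (ln (real n))^3 + (S + \<sigma>\<^sup>2 + M\<^sup>2) * (ln (real n))^3 / real n))"
        using Nn by (intro ennreal_leI) (simp add: c_def)
      finally show "(\<integral>\<^sup>+ \<omega>. (\<integral>\<^sup>+ x. indicator {-L..L} x * ennreal ((fhat n \<omega> x - fstar x)\<^sup>2)
                        \<partial>(distr Q lborel fst)) \<partial>(PiM {..<n} (\<lambda>_. Q)))
          \<le> ennreal (1 * (D * real n powr (-2/3) * (ln (real n))^3 + (S + \<sigma>\<^sup>2 + M\<^sup>2) * (ln (real n))^3 / real n))" .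
    qed
  qed
  then show "let D = sqrt (LINT x:{-L..L}|lborel. (Df x)\<^sup>2);
          H1sq = (LINT x:{-L..L}|lborel. (fstar x)\<^sup>2 + (Df x)\<^sup>2);
          lam = (\<lambda>n::nat. ln (real n) / real n);
          mu = (\<lambda>n::nat. if D \<noteq> 0 then real n powr (-2/3) / D else 1 / ln (real n))
      in
      (\<forall>n \<ge> 2. \<forall>\<omega>. is_pi_estimator L (lam n) (mu n) n (\<lambda>i. fst (\<omega> i))
                      (\<lambda>i. fstar (fst (\<omega> i)) + snd (\<omega> i)) (fhat n \<omega>)) \<longrightarrow>
      (\<exists>N. \<forall>n \<ge> N.
         (\<integral>\<^sup>+ \<omega>. (\<integral>\<^sup>+ x. indicator {-L..L} x * ennreal ((fhat n \<omega> x - fstar x)\<^sup>2)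
                        \<partial>(distr Q lborel fst))
            \<partial>(PiM {..<n} (\<lambda>_. Q)))
         \<le> ennreal (1 * (D * real n powr (-2/3) * (ln (real n))^3
                         + (H1sq + \<sigma>\<^sup>2 + M\<^sup>2) * (ln (real n))^3 / real n)))"
    unfolding Let_def lam_def[abs_def] mu_def[abs_def] D_def G_def S_def by blast
qed simp

end
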